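(* Consider two single-server FIFO queues in tandem ($GI/GI/1/\infty\to\cdot/GI/1/\infty$) with i.i.d. interarrival times $\{\tau_n\}$ at station 1 of mean $a$ and service times $\{\sigma_n^{(i)}\}$ at station $i$, $i=1,2$, of mean $b^{(i)}$, as specified in the context, with $b\equiv\max(b^{(1)},b^{(2)})<a$. Assume that $\mathbf{P}(\sigma^{(i)}>x)\sim d^{(i)}\overline{F}(x)$ as $x\to\infty$ for $i=1,2$, with $d^{(i)}\ge0$ and $d^{(1)}+d^{(2)}>0$, where both $F$ and $F^s$ are subexponential. Then the stationary end-to-end sojourn time $Z$ satisfies, as $x\to\infty$, $$\mathbf{P}(Z>x)\sim\Bigl(\frac{d^{(1)}}{a-b}+\frac{d^{(2)}}{a-b^{(2)}}\Bigr)\overline{F}^s(x).$$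
   Context: For $c>0$, $f\sim cg$ means $f(x)/g(x)\to c$ as $x\to\infty$; $f\sim cg$ with $c=0$ means $f(x)=o(g(x))$. $F$ is a distribution function on $\mathbb{R}^+$ with finite mean, $\overline{F}=1-F$, and $F^s$ is the integrated tail distribution, with tail $\overline{F}^s(x)=\min\{1,\int_x^\infty\overline{F}(u)\,du\}$. Tandem queue: customer $n\in\mathbb{Z}$ arrives at station 1 at time $T_n$, $\tau_n=T_{n+1}-T_n\ge 0$. The sequences $\{\tau_n\}$, $\{\sigma_n^{(1)}\}$, $\{\sigma_n^{(2)}\}$ are mutually independent, and each consists of i.i.d. nonnegative random variables with means $a$, $b^{(1)}$, $b^{(2)}$. Customers are served in order of arrival at station 1, then at station 2, by a single server at each station. The stationary maximal dater (end-to-end sojourn time of customer 0) is $$Z=\sup_{p\le0}\ \sup_{p\le q\le0}\Bigl(\sum_{m=p}^q\sigma_m^{(1)}+\sum_{m=q}^0\sigma_m^{(2)}-(T_0-T_p)\Bigr).$$ *)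

theory Defs
  imports "HOL-Probability.Probability" "HOL-Library.Landau_Symbols"
begin

definition tail_sim :: "(real \<Rightarrow> real) \<Rightarrow> real \<Rightarrow> (real \<Rightarrow> real) \<Rightarrow> bool" where
  "tail_sim f c g \<longleftrightarrow>
     (if c = 0 then f \<in> o[at_top](g) else ((\<lambda>x. f x / g x) \<longlongrightarrow> c) at_top)"

definition df_on_Rplus :: "(real \<Rightarrow> real) \<Rightarrow> bool" where
  "df_on_Rplus F \<longleftrightarrow>
     mono F \<and> (\<forall>x. continuous (at_right x) F) \<and> (\<forall>x<0. F x = 0) \<and> (F \<longlongrightarrow> 1) at_top"

text \<open>The law with distribution function \<open>F\<close> is \<open>interval_measure F\<close>, and the twofold
  convolution of \<open>F\<close> is the distribution function of \<open>interval_measure F \<star> interval_measure F\<close>.\<close>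

definition has_finite_mean :: "(real \<Rightarrow> real) \<Rightarrow> bool" where
  "has_finite_mean F \<longleftrightarrow> integrable (interval_measure F) (\<lambda>x. x)"

definition subexponential :: "(real \<Rightarrow> real) \<Rightarrow> bool" where
  "subexponential F \<longleftrightarrow>
     df_on_Rplus F \<and> (\<forall>x. F x < 1) \<and>
     ((\<lambda>x. (1 - cdf (interval_measure F \<star> interval_measure F) x) / (1 - F x)) \<longlongrightarrow> 2) at_top"

text \<open>The integrated tail distribution lives on the nonnegative half-line, so its distribution
  function vanishes on the negative reals. The formula alone would not enforce this when
  the mean of \<open>F\<close> is less than 1; in that case there is an atom at 0.\<close>

definition integrated_tail :: "(real \<Rightarrow> real) \<Rightarrow> real \<Rightarrow> real" where
  "integrated_tail F x = (if x < 0 then 0 else 1 - min 1 (LBINT u:{x..}. 1 - F u))"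

definition (in prob_space) iid_nonneg_with_mean :: "(int \<Rightarrow> 'a \<Rightarrow> real) \<Rightarrow> real \<Rightarrow> bool" where
  "iid_nonneg_with_mean X m \<longleftrightarrow>
     indep_vars (\<lambda>_. borel) X UNIV \<and>
     (\<forall>n. distr M borel (X n) = distr M borel (X 0)) \<and>
     (\<forall>n. AE \<omega> in M. 0 \<le> X n \<omega>) \<and>
     (\<forall>n. integrable M (X n) \<and> expectation (X n) = m)"

text \<open>Each sequence is a random element of the product space of real sequences
  indexed by the integers.\<close>

definition (in prob_space) indep_sequences ::
    "'i set \<Rightarrow> ('i \<Rightarrow> int \<Rightarrow> 'a \<Rightarrow> real) \<Rightarrow> bool" where
  "indep_sequences I X \<longleftrightarrow>
     indep_vars (\<lambda>_. PiM UNIV (\<lambda>_. borel)) (\<lambda>i \<omega> n. X i n \<omega>) I"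

text \<open>The supremum is taken in the extended reals, so it is meaningful before one knows that
  it is almost surely finite.\<close>

definition tandem_dater ::
    "(int \<Rightarrow> 'a \<Rightarrow> real) \<Rightarrow> (nat \<Rightarrow> int \<Rightarrow> 'a \<Rightarrow> real) \<Rightarrow> 'a \<Rightarrow> ereal" where
  "tandem_dater T \<sigma> \<omega> =
     (SUP p\<in>{..0}. SUP q\<in>{p..0}.
        ereal ((\<Sum>m=p..q. \<sigma> 1 m \<omega>) + (\<Sum>m=q..0. \<sigma> 2 m \<omega>) - (T 0 \<omega> - T p \<omega>)))"

end

theory Submission
  imports Defs
begin

text \<open>One large service time makes \<open>Z\<close> large. Reading the customers backwards, the maximal score
  \<open>V n\<close> over paths through the last \<open>n\<close> customers drifts like \<open>- n (a - max b1 b2)\<close>, and the score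
  \<open>A n\<close> of the path that never leaves station 2 like \<open>- n (a - b2)\<close>. A service time at station 1
  extends the best path, one at station 2 only extends \<open>A n\<close>; summing the tails \<open>1 - F\<close> along these two
  lines gives the two terms of the constant.

  For the upper bound, stop at the first \<open>n\<close> at which \<open>V\<close> or \<open>A\<close> lies above its line, raised by a
  constant \<open>R\<close>. This has small probability for large \<open>R\<close>, the overshoot requires a jump, and after
  stopping the supremum is dominated by the overshoot plus an independent copy of itself. As at most a
  small part of the mass is passed on, iterating the resulting inequality for the tail yields the sharp
  constant. For the lower bound, the first jump events are disjoint.\<close>

section \<open>Subexponential tails\<close>

text \<open>The restarted copy forgets which station the path has reached and may return to station
  2, so the comparison is only an inequality. This costs little: the copy enters with the weight of
  the crossing event, which is small for large \<open>R\<close>. What the iteration does need is a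
  bound on the tail of the copy by a multiple of that of \<open>F^s\<close> before any asymptotics
  are known; it comes from an induction over finite horizons, with a constant independent of the
  horizon. Subexponentiality acts on two scales. For \<open>F\<close> it makes the tails of the two
  service times of one customer add; for \<open>F^s\<close> it controls the overshoot plus the copy.
  Long-tailedness absorbs \<open>R\<close> and the other additive constants. Interarrival times are
  known through their mean only, and a long one can swallow a jump. The upper bound discards the one
  at the jump; the lower bound asks for it to be at most a constant, which independence makes cheap.
  The dater omits the interarrival time of customer 0, so this time is added back to
  \<open>V (Suc k)\<close>, a correction that needs its own argument.\<close>

lemma df_on_Rplus_law:
  assumes "df_on_Rplus F"
  shows "real_distribution (interval_measure F)"
    and "measure (interval_measure F) {x<..} = 1 - F x"
    and "measure (interval_measure F) {..x} = F x"
    and "measure (interval_measure F) {0..} = 1"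
    and "measure (interval_measure F) {0..x} = F x"
    and "0 \<le> F x" and "F x \<le> 1"
proof -
  have m: "\<And>x y. x \<le> y \<Longrightarrow> F x \<le> F y" and r: "\<And>x. continuous (at_right x) F"
    and t: "(F \<longlongrightarrow> 1) at_top" and neg: "\<And>x. x < 0 \<Longrightarrow> F x = 0"
    using assms by (auto simp: df_on_Rplus_def mono_def)
  have b: "(F \<longlongrightarrow> 0) at_bot"
    by (rule tendsto_eventually) (auto simp: eventually_at_bot_linorder neg intro!: exI[of _ "-1"])
  show rd: "real_distribution (interval_measure F)"
    by (rule real_distribution_interval_measure[OF m r b t])
  interpret real_distribution "interval_measure F" by (rule rd)
  have c: "cdf (interval_measure F) y = F y" for y
    by (subst cdf_interval_measure[OF m r b]) (use t in auto)
  then show le: "measure (interval_measure F) {..x} = F x" for x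
    by (simp add: cdf_def2)
  have "measure (interval_measure F) (space (interval_measure F) - {..x}) = 1 - F x"
    by (subst prob_compl) (auto simp: le)
  also have "space (interval_measure F) - {..x} = {x<..}" by auto
  finally show "measure (interval_measure F) {x<..} = 1 - F x" .
  show "0 \<le> F x" "F x \<le> 1" using le[of x] by (auto simp flip: le)
  have "(\<lambda>n. measure (interval_measure F) {.. - 1 / real (Suc n)}) \<longlonglongrightarrow>
      measure (interval_measure F) (\<Union>n. {.. - 1 / real (Suc n)})"
    by (rule finite_Lim_measure_incseq) (auto simp: incseq_def frac_le intro: order_trans)
  moreover have "(\<Union>n. {.. - 1 / real (Suc n)}) = {..<0::real}"
  proof safe
    fix y :: real assume "y < 0"
    then obtain n where "inverse (real (Suc n)) < - y" using reals_Archimedean[of "-y"] by auto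
    then show "y \<in> (\<Union>n. {.. - 1 / real (Suc n)})" by (auto simp: inverse_eq_divide intro!: exI[of _ n])
  next
    fix y :: real and n assume "y \<le> - 1 / real (Suc n)"
    moreover have "- 1 / real (Suc n) < 0" by simp
    ultimately show "y < 0" by linarith
  qed
  ultimately have "(\<lambda>n. 0) \<longlonglongrightarrow> measure (interval_measure F) {..<0}"
    by (simp add: le neg)
  then have "measure (interval_measure F) {..<0} = 0" by (rule LIMSEQ_unique) simp
  moreover have "measure (interval_measure F) (space (interval_measure F) - {..<0}) =
      1 - measure (interval_measure F) {..<0}" by (rule prob_compl) auto
  moreover have "space (interval_measure F) - {..<0} = {0..}" by auto
  ultimately show 1: "measure (interval_measure F) {0..} = 1" by simp
  then have "AE x in interval_measure F. x \<in> {0..}" by (intro AE_prob_1) simp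
  then have "measure (interval_measure F) {0..x} = measure (interval_measure F) {..x}"
    by (intro finite_measure_eq_AE) auto
  then show "measure (interval_measure F) {0..x} = F x" by (simp add: le)
qed

lemma pair_sum_sets:
  "{z. x < fst z + snd z} \<in> sets (borel \<Otimes>\<^sub>M (borel :: real measure))"
  "{z. B < fst z \<and> B < snd z \<and> x < fst z + snd z} \<in> sets (borel \<Otimes>\<^sub>M (borel :: real measure))"
proof -
  have "{z \<in> space (borel \<Otimes>\<^sub>M (borel :: real measure)). x < fst z + snd z} \<in> sets (borel \<Otimes>\<^sub>M borel)"
    "{z \<in> space (borel \<Otimes>\<^sub>M (borel :: real measure)). B < fst z \<and> B < snd z \<and> x < fst z + snd z}
       \<in> sets (borel \<Otimes>\<^sub>M borel)"
    by measurable
  then show "{z. x < fst z + snd z} \<in> sets (borel \<Otimes>\<^sub>M (borel :: real measure))"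
    "{z. B < fst z \<and> B < snd z \<and> x < fst z + snd z} \<in> sets (borel \<Otimes>\<^sub>M (borel :: real measure))"
    by (simp_all add: space_pair_measure)
qed

text \<open>Rephrases the convolution as a product measure, so that the event of a large sum can be
  cut into rectangles.\<close>

lemma subexponential_law:
  assumes "subexponential F"
  shows "df_on_Rplus F" and "F x < 1"
    and "((\<lambda>x. measure (interval_measure F \<Otimes>\<^sub>M interval_measure F) {z. x < fst z + snd z} / (1 - F x))
           \<longlongrightarrow> 2) at_top"
proof -
  let ?G = "interval_measure F"
  show df: "df_on_Rplus F" and "F x < 1"
    using assms by (auto simp: subexponential_def)
  interpret G: real_distribution ?G using df by (rule df_on_Rplus_law)
  interpret GG: pair_prob_space ?G ?G ..
  have [measurable_cong]: "sets ?G = sets borel" by simp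
  have pair: "sets (?G \<Otimes>\<^sub>M ?G) = sets (borel \<Otimes>\<^sub>M borel)" by (rule sets_pair_measure_cong) auto
  have "1 - cdf (?G \<star> ?G) x = measure (?G \<Otimes>\<^sub>M ?G) {z. x < fst z + snd z}" for x
  proof -
    have "cdf (?G \<star> ?G) x = measure (?G \<Otimes>\<^sub>M ?G) ((\<lambda>z. fst z + snd z) -` {..x} \<inter> space (?G \<Otimes>\<^sub>M ?G))"
      unfolding cdf_def convolution_def case_prod_beta by (rule measure_distr) auto
    also have "\<dots> = 1 - measure (?G \<Otimes>\<^sub>M ?G) (space (?G \<Otimes>\<^sub>M ?G) - ((\<lambda>z. fst z + snd z) -` {..x} \<inter> space (?G \<Otimes>\<^sub>M ?G)))"
      by (subst GG.prob_compl, rule measurable_sets[of _ _ borel]) auto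
    also have "space (?G \<Otimes>\<^sub>M ?G) - ((\<lambda>z. fst z + snd z) -` {..x} \<inter> space (?G \<Otimes>\<^sub>M ?G)) = {z. x < fst z + snd z}"
      by (auto simp: space_pair_measure)
    finally show ?thesis by simp
  qed
  then show "((\<lambda>x. measure (?G \<Otimes>\<^sub>M ?G) {z. x < fst z + snd z} / (1 - F x)) \<longlongrightarrow> 2) at_top"
    using assms by (simp add: subexponential_def)
qed

lemma measure_rect:
  assumes "prob_space P" "prob_space Q" "A \<in> sets P" "B \<in> sets Q"
  shows "measure (P \<Otimes>\<^sub>M Q) (A \<times> B) = measure P A * measure Q B"
proof -
  interpret PP: prob_space P by fact
  interpret QQ: prob_space Q by fact
  show ?thesis using assms(3,4)
    by (simp add: measure_def QQ.emeasure_pair_measure_Times enn2real_mult)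
qed

text \<open>The event \<open>x < fst z + snd z\<close> contains three disjoint rectangles. The first
  two have total probability (1 + F B)(1 - F x), the third one,
  \<open>{B<..x} \<times> {x-B<..}\<close>, has (F x - F B)(1 - F (x - B)). As the whole event is
  asymptotic to 2 (1 - F x), the ratio in question is asymptotically at most (2 - 1 - F B) / (1 - F
  B) = 1.\<close>

lemma subexponential_long_tailed:
  assumes "subexponential F" "0 \<le> B"
  shows "((\<lambda>x. (1 - F (x - B)) / (1 - F x)) \<longlongrightarrow> 1) at_top"
proof -
  let ?G = "interval_measure F"
  note df = subexponential_law(1)[OF assms(1)] and lt = subexponential_law(2)[OF assms(1)]
    and lim = subexponential_law(3)[OF assms(1)]
  interpret G: real_distribution ?G using df by (rule df_on_Rplus_law)
  interpret GG: pair_prob_space ?G ?G ..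
  have [measurable_cong]: "sets ?G = sets borel" by simp
  have pair: "sets (?G \<Otimes>\<^sub>M ?G) = sets (borel \<Otimes>\<^sub>M borel)" by (rule sets_pair_measure_cong) auto
  note law = df_on_Rplus_law(2,3,4,5)[OF df]
  have F1: "(F \<longlongrightarrow> 1) at_top" and mono: "\<And>x y. x \<le> y \<Longrightarrow> F x \<le> F y"
    using df by (auto simp: df_on_Rplus_def mono_def)
  let ?s = "\<lambda>x. measure (?G \<Otimes>\<^sub>M ?G) {z. x < fst z + snd z}"
  have up: "(1 - F (x - B)) / (1 - F x) \<le> (?s x / (1 - F x) - 1 - F B) / (F x - F B)"
    if "x > B" "F x > F B" for x
  proof -
    have "?s x \<ge> measure (?G \<Otimes>\<^sub>M ?G) ({x<..} \<times> {0..} \<union> {0..B} \<times> {x<..} \<union> {B<..x} \<times> {x-B<..})"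
      using that by (intro GG.finite_measure_mono) (auto simp: pair_sum_sets pair)
    moreover have "measure (?G \<Otimes>\<^sub>M ?G) ({x<..} \<times> {0..} \<union> {0..B} \<times> {x<..} \<union> {B<..x} \<times> {x-B<..})
      = measure (?G \<Otimes>\<^sub>M ?G) ({x<..} \<times> {0..}) + measure (?G \<Otimes>\<^sub>M ?G) ({0..B} \<times> {x<..})
        + measure (?G \<Otimes>\<^sub>M ?G) ({B<..x} \<times> {x-B<..})"
    proof -
      have "({x<..} \<times> {0..} \<union> {0..B} \<times> {x<..}) \<inter> {B<..x} \<times> {x-B<..} = {}"
        "{x<..} \<times> {0..} \<inter> {0..B} \<times> {x<..} = {}"
        using that by auto
      then show ?thesis by (subst GG.finite_measure_Union, simp, simp, simp, subst GG.finite_measure_Union) simp_all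
    qed
    moreover have "measure ?G {B<..x} = F x - F B"
    proof -
      have "measure ?G ({..x} - {..B}) = measure ?G {..x} - measure ?G {..B}"
        using that by (intro G.finite_measure_Diff) auto
      moreover have "{..x} - {..B} = {B<..x}" by auto
      ultimately show ?thesis by (simp add: law)
    qed
    ultimately have *: "?s x \<ge> (1 - F x) + F B * (1 - F x) + (F x - F B) * (1 - F (x - B))"
      by (simp add: measure_rect G.prob_space_axioms law)
    have "?s x / (1 - F x) \<ge> ((1 - F x) + F B * (1 - F x) + (F x - F B) * (1 - F (x - B))) / (1 - F x)"
      using * lt[of x] by (intro divide_right_mono) auto
    also have "((1 - F x) + F B * (1 - F x) + (F x - F B) * (1 - F (x - B))) / (1 - F x) =
        1 + F B + (F x - F B) * ((1 - F (x - B)) / (1 - F x))"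
      using lt[of x] by (simp add: add_divide_distrib)
    finally have "?s x / (1 - F x) \<ge> 1 + F B + (F x - F B) * ((1 - F (x - B)) / (1 - F x))" .
    then show ?thesis using that by (simp add: field_simps)
  qed
  have ev: "\<forall>\<^sub>F x in at_top. (1 - F (x - B)) / (1 - F x) \<le> (?s x / (1 - F x) - 1 - F B) / (F x - F B)"
    using eventually_gt_at_top[of B] order_tendstoD(1)[OF F1 lt[of B]]
    by eventually_elim (use up in auto)
  have lo: "\<forall>\<^sub>F x in at_top. 1 \<le> (1 - F (x - B)) / (1 - F x)"
    using mono[of "_ - B" ] lt assms(2) by (auto intro!: always_eventually simp: field_simps)
  have "((\<lambda>x. (?s x / (1 - F x) - 1 - F B) / (F x - F B)) \<longlongrightarrow> (2 - 1 - F B) / (1 - F B)) at_top"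
    using lt[of B] by (intro tendsto_intros lim F1) auto
  moreover have "(2 - 1 - F B) / (1 - F B) = 1" using lt[of B] by (simp add: field_simps)
  ultimately show ?thesis
    by (intro tendsto_sandwich[OF lo ev]) auto
qed

text \<open>Of the limit 2, the pairs with one coordinate in \<open>{0..B}\<close> and the other
  above \<open>x\<close> take 2 F(B), so that at most 2 (1 - F B) is left for two large coordinates.
  \<open>B\<close> makes this less than \<open>e / 2\<close>; the other half of \<open>e\<close>
  pays for the convergence.\<close>

lemma subexponential_both_large:
  assumes "subexponential F" "0 < e"
  obtains B x0 where "0 \<le> B"
    "\<And>x. x0 \<le> x \<Longrightarrow> measure (interval_measure F \<Otimes>\<^sub>M interval_measure F)
       {z. B < fst z \<and> B < snd z \<and> x < fst z + snd z} \<le> e * (1 - F x)"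
proof -
  let ?G = "interval_measure F"
  note df = subexponential_law(1)[OF assms(1)] and lt = subexponential_law(2)[OF assms(1)]
    and lim = subexponential_law(3)[OF assms(1)]
  interpret G: real_distribution ?G using df by (rule df_on_Rplus_law)
  interpret GG: pair_prob_space ?G ?G ..
  have [measurable_cong]: "sets ?G = sets borel" by simp
  have pair: "sets (?G \<Otimes>\<^sub>M ?G) = sets (borel \<Otimes>\<^sub>M borel)" by (rule sets_pair_measure_cong) auto
  note law = df_on_Rplus_law(2,3,4,5)[OF df]
  have F1: "(F \<longlongrightarrow> 1) at_top" and mono: "\<And>x y. x \<le> y \<Longrightarrow> F x \<le> F y"
    using df by (auto simp: df_on_Rplus_def mono_def)
  let ?s = "\<lambda>x. measure (?G \<Otimes>\<^sub>M ?G) {z. x < fst z + snd z}"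
  obtain B where B: "0 \<le> B" "1 - e / 4 < F B"
  proof -
    have "\<forall>\<^sub>F x in at_top. 1 - e / 4 < F x" using order_tendstoD(1)[OF F1, of "1 - e/4"] assms(2) by simp
    then show ?thesis using that eventually_happens[OF eventually_conj[OF _ eventually_ge_at_top[of 0]]]
      by auto
  qed
  have "\<forall>\<^sub>F x in at_top. ?s x / (1 - F x) < 2 + e / 2"
    using order_tendstoD(2)[OF lim, of "2 + e/2"] assms(2) by simp
  then obtain x1 where x1: "\<And>x. x1 \<le> x \<Longrightarrow> ?s x / (1 - F x) < 2 + e / 2"
    by (auto simp: eventually_at_top_linorder)
  show ?thesis
  proof (rule that[of B "max x1 (2 * B)"])
    fix x assume x: "max x1 (2 * B) \<le> x"
    let ?L = "{z. B < fst z \<and> B < snd z \<and> x < fst z + snd z}"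
    have L: "?L \<in> sets (?G \<Otimes>\<^sub>M ?G)" by (simp add: pair pair_sum_sets)
    have "measure (?G \<Otimes>\<^sub>M ?G) (?L \<union> {x<..} \<times> {0..B} \<union> {0..B} \<times> {x<..}) \<le> ?s x"
      using x by (intro GG.finite_measure_mono) (auto simp: pair_sum_sets pair)
    also have "measure (?G \<Otimes>\<^sub>M ?G) (?L \<union> {x<..} \<times> {0..B} \<union> {0..B} \<times> {x<..}) =
       measure (?G \<Otimes>\<^sub>M ?G) ?L + measure (?G \<Otimes>\<^sub>M ?G) ({x<..} \<times> {0..B})
       + measure (?G \<Otimes>\<^sub>M ?G) ({0..B} \<times> {x<..})"
    proof -
      have "(?L \<union> {x<..} \<times> {0..B}) \<inter> {0..B} \<times> {x<..} = {}" "?L \<inter> {x<..} \<times> {0..B} = {}"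
        using x B(1) by auto
      then show ?thesis using L
        by (subst GG.finite_measure_Union, simp, simp, simp, subst GG.finite_measure_Union) simp_all
    qed
    finally have "measure (?G \<Otimes>\<^sub>M ?G) ?L \<le> ?s x - 2 * F B * (1 - F x)"
      by (simp add: measure_rect G.prob_space_axioms law)
    also have "\<dots> \<le> (2 + e / 2) * (1 - F x) - 2 * F B * (1 - F x)"
      using x1[of x] x lt[of x] by (simp add: field_simps)
    also have "\<dots> = (2 + e / 2 - 2 * F B) * (1 - F x)" by (simp add: algebra_simps)
    also have "\<dots> \<le> e * (1 - F x)"
      using B lt[of x] by (intro mult_right_mono) auto
    finally show "measure (?G \<Otimes>\<^sub>M ?G) ?L \<le> e * (1 - F x)" .
  qed (rule B)
qed

section \<open>Sums of independent variables with dominated tails\<close>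

text \<open>For fixed \<open>p\<close> with \<open>\<eta> p\<close> above \<open>B\<close>, the
  section is the event that the second variable exceeds \<open>max B (x - \<eta> p)\<close>. This
  level is at least \<open>B\<close>, where the domination holds, so the claim follows by
  integration over \<open>p\<close>.\<close>

lemma both_large_dominated:
  fixes \<eta> :: "'a \<Rightarrow> real" and W1 :: "'b \<Rightarrow> real" and W2 :: "'c \<Rightarrow> real"
  assumes "prob_space P" "prob_space Q1" "prob_space Q2"
    and [measurable]: "\<eta> \<in> borel_measurable P" "W1 \<in> borel_measurable Q1" "W2 \<in> borel_measurable Q2"
    and "0 \<le> K"
    and dom: "\<And>u. B \<le> u \<Longrightarrow> measure Q1 {w \<in> space Q1. u < W1 w} \<le> K * measure Q2 {w \<in> space Q2. u < W2 w}"
  shows "measure (P \<Otimes>\<^sub>M Q1) {z \<in> space (P \<Otimes>\<^sub>M Q1). B < \<eta> (fst z) \<and> B < W1 (snd z) \<and> x < \<eta> (fst z) + W1 (snd z)}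
     \<le> K * measure (P \<Otimes>\<^sub>M Q2) {z \<in> space (P \<Otimes>\<^sub>M Q2). B < \<eta> (fst z) \<and> B < W2 (snd z) \<and> x < \<eta> (fst z) + W2 (snd z)}"
    (is "measure _ ?X1 \<le> K * measure _ ?X2")
proof -
  interpret PP: prob_space P by fact
  interpret Q1: prob_space Q1 by fact
  interpret Q2: prob_space Q2 by fact
  interpret PQ1: pair_prob_space P Q1 ..
  interpret PQ2: pair_prob_space P Q2 ..
  have X1: "?X1 \<in> sets (P \<Otimes>\<^sub>M Q1)" and X2: "?X2 \<in> sets (P \<Otimes>\<^sub>M Q2)"
    by measurable
  have "emeasure (P \<Otimes>\<^sub>M Q1) ?X1 = (\<integral>\<^sup>+p. emeasure Q1 (Pair p -` ?X1) \<partial>P)"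
    by (rule Q1.emeasure_pair_measure_alt[OF X1])
  also have "\<dots> \<le> (\<integral>\<^sup>+p. ennreal K * emeasure Q2 (Pair p -` ?X2) \<partial>P)"
  proof (rule nn_integral_mono)
    fix p assume p: "p \<in> space P"
    show "emeasure Q1 (Pair p -` ?X1) \<le> ennreal K * emeasure Q2 (Pair p -` ?X2)"
    proof (cases "B < \<eta> p")
      case True
      have "Pair p -` ?X1 = {w \<in> space Q1. max B (x - \<eta> p) < W1 w}"
        using p True by (auto simp: space_pair_measure)
      moreover have "Pair p -` ?X2 = {w \<in> space Q2. max B (x - \<eta> p) < W2 w}"
        using p True by (auto simp: space_pair_measure)
      ultimately show ?thesis using dom[of "max B (x - \<eta> p)"] \<open>0 \<le> K\<close>
        by (simp add: Q1.emeasure_eq_measure Q2.emeasure_eq_measure flip: ennreal_mult)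
    next
      case False
      then have "Pair p -` ?X1 = {}" by auto
      then show ?thesis by (simp only:) simp
    qed
  qed
  also have "\<dots> = ennreal K * (\<integral>\<^sup>+p. emeasure Q2 (Pair p -` ?X2) \<partial>P)"
    using X2 by (intro nn_integral_cmult Q2.measurable_emeasure_Pair)
  also have "(\<integral>\<^sup>+p. emeasure Q2 (Pair p -` ?X2) \<partial>P) = emeasure (P \<Otimes>\<^sub>M Q2) ?X2"
    by (rule Q2.emeasure_pair_measure_alt[OF X2, symmetric])
  finally show ?thesis using \<open>0 \<le> K\<close>
    by (simp add: PQ1.emeasure_eq_measure PQ2.emeasure_eq_measure flip: ennreal_mult)
qed

lemma measure_pair_swap:
  assumes "prob_space P" "prob_space Q" "{z \<in> space (P \<Otimes>\<^sub>M Q). R (fst z) (snd z)} \<in> sets (P \<Otimes>\<^sub>M Q)"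
  shows "measure (P \<Otimes>\<^sub>M Q) {z \<in> space (P \<Otimes>\<^sub>M Q). R (fst z) (snd z)} =
    measure (Q \<Otimes>\<^sub>M P) {z \<in> space (Q \<Otimes>\<^sub>M P). R (snd z) (fst z)}"
proof -
  interpret PP: prob_space P by fact
  interpret QQ: prob_space Q by fact
  interpret pair_prob_space P Q ..
  have "measure (P \<Otimes>\<^sub>M Q) {z \<in> space (P \<Otimes>\<^sub>M Q). R (fst z) (snd z)} =
    measure (distr (Q \<Otimes>\<^sub>M P) (P \<Otimes>\<^sub>M Q) (\<lambda>(x, y). (y, x))) {z \<in> space (P \<Otimes>\<^sub>M Q). R (fst z) (snd z)}"
    using distr_pair_swap by simp
  also have "\<dots> = measure (Q \<Otimes>\<^sub>M P) ((\<lambda>(x, y). (y, x)) -` {z \<in> space (P \<Otimes>\<^sub>M Q). R (fst z) (snd z)} \<inter> space (Q \<Otimes>\<^sub>M P))"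
    by (rule measure_distr[OF measurable_pair_swap' assms(3)])
  also have "(\<lambda>(x, y). (y, x)) -` {z \<in> space (P \<Otimes>\<^sub>M Q). R (fst z) (snd z)} \<inter> space (Q \<Otimes>\<^sub>M P) =
     {z \<in> space (Q \<Otimes>\<^sub>M P). R (snd z) (fst z)}"
    by (auto simp: space_pair_measure)
  finally show ?thesis .
qed

text \<open>If the sum exceeds \<open>x\<close>, then either one summand is at most \<open>B\<close>
  and the other exceeds \<open>x - B\<close>, or both exceed \<open>B\<close>. In the latter case
  both are exchanged for variables with law \<open>F\<close>, at the price \<open>C * K\<close>. The
  point of the form is that the tail of \<open>W\<close> keeps the factor
  \<open>measure P D\<close>, which makes the later iteration a contraction, while \<open>C\<close>
  and \<open>K\<close> occur only in an error that \<open>e\<close> can make small.\<close>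

lemma sum_tail_bound:
  fixes \<eta> :: "'a \<Rightarrow> real" and W :: "'b \<Rightarrow> real"
  assumes F: "df_on_Rplus F" and "0 \<le> B"
    and both: "measure (interval_measure F \<Otimes>\<^sub>M interval_measure F)
       {z. B < fst z \<and> B < snd z \<and> x < fst z + snd z} \<le> e * (1 - F x)"
    and P: "prob_space P" and Q: "prob_space Q"
    and [measurable]: "D \<in> sets P" "\<eta> \<in> borel_measurable P" "W \<in> borel_measurable Q"
    and "0 \<le> C" "0 \<le> K"
    and \<eta>: "\<And>u. 0 \<le> u \<Longrightarrow> measure P {p \<in> space P. p \<in> D \<and> u < \<eta> p} \<le> C * (1 - F u)"
    and W: "\<And>u. 0 \<le> u \<Longrightarrow> measure Q {w \<in> space Q. u < W w} \<le> K * (1 - F u)"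
  shows "measure (P \<Otimes>\<^sub>M Q) {z \<in> space (P \<Otimes>\<^sub>M Q). fst z \<in> D \<and> x < \<eta> (fst z) + W (snd z)}
    \<le> measure P D * measure Q {w \<in> space Q. x - B < W w}
      + measure P {p \<in> space P. p \<in> D \<and> x - B < \<eta> p} + C * K * e * (1 - F x)"
proof -
  let ?G = "interval_measure F"
  interpret PP: prob_space P by fact
  interpret QQ: prob_space Q by fact
  interpret PQ: pair_prob_space P Q ..
  interpret G: real_distribution ?G using F by (rule df_on_Rplus_law)
  have [measurable_cong]: "sets ?G = sets borel" by simp
  have pair: "sets (?G \<Otimes>\<^sub>M ?G) = sets (borel \<Otimes>\<^sub>M borel)" by (rule sets_pair_measure_cong) auto
  note law = df_on_Rplus_law(2)[OF F]
  \<comment> \<open>The value -1 lies below \<open>B\<close>, so outside \<open>D\<close> the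
    modified variable never counts as large.\<close>
  define \<eta>' where "\<eta>' p = (if p \<in> D then \<eta> p else - 1)" for p
  have [measurable]: "\<eta>' \<in> borel_measurable P" unfolding \<eta>'_def by measurable
  have \<eta>': "measure P {p \<in> space P. u < \<eta>' p} \<le> C * measure ?G {v \<in> space ?G. u < v}" if "B \<le> u" for u
  proof -
    have "{p \<in> space P. u < \<eta>' p} = {p \<in> space P. p \<in> D \<and> u < \<eta> p}"
      using that \<open>0 \<le> B\<close> by (auto simp: \<eta>'_def)
    moreover have "{v. u < v} = {u<..}" by auto
    ultimately show ?thesis using \<eta>[of u] that \<open>0 \<le> B\<close> by (simp add: law)
  qed
  have W': "measure Q {w \<in> space Q. u < W w} \<le> K * measure ?G {v \<in> space ?G. u < v}" if "B \<le> u" for u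
  proof -
    have "{v. u < v} = {u<..}" by auto
    then show ?thesis using W[of u] that \<open>0 \<le> B\<close> by (simp add: law)
  qed
  let ?X = "{z \<in> space (P \<Otimes>\<^sub>M Q). B < \<eta>' (fst z) \<and> B < W (snd z) \<and> x < \<eta>' (fst z) + W (snd z)}"
  have "measure (P \<Otimes>\<^sub>M Q) ?X \<le> K * measure (P \<Otimes>\<^sub>M ?G) {z \<in> space (P \<Otimes>\<^sub>M ?G). B < \<eta>' (fst z) \<and> B < snd z \<and> x < \<eta>' (fst z) + snd z}"
    by (rule both_large_dominated[OF P Q G.prob_space_axioms _ _ _ \<open>0 \<le> K\<close> W']) auto
  also have "measure (P \<Otimes>\<^sub>M ?G) {z \<in> space (P \<Otimes>\<^sub>M ?G). B < \<eta>' (fst z) \<and> B < snd z \<and> x < \<eta>' (fst z) + snd z} =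
     measure (?G \<Otimes>\<^sub>M P) {z \<in> space (?G \<Otimes>\<^sub>M P). B < \<eta>' (snd z) \<and> B < fst z \<and> x < \<eta>' (snd z) + fst z}"
    by (rule measure_pair_swap[OF P G.prob_space_axioms]) measurable
  also have "\<dots> = measure (?G \<Otimes>\<^sub>M P) {z \<in> space (?G \<Otimes>\<^sub>M P). B < fst z \<and> B < \<eta>' (snd z) \<and> x < fst z + \<eta>' (snd z)}"
    by (simp add: conj_ac add.commute)
  also have "\<dots> \<le> C * measure (?G \<Otimes>\<^sub>M ?G) {z \<in> space (?G \<Otimes>\<^sub>M ?G). B < fst z \<and> B < snd z \<and> x < fst z + snd z}"
    by (rule both_large_dominated[OF G.prob_space_axioms P G.prob_space_axioms _ _ _ \<open>0 \<le> C\<close> \<eta>']) auto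
  also have "{z \<in> space (?G \<Otimes>\<^sub>M ?G). B < fst z \<and> B < snd z \<and> x < fst z + snd z} = {z. B < fst z \<and> B < snd z \<and> x < fst z + snd z}"
    by (auto simp: space_pair_measure)
  finally have "measure (P \<Otimes>\<^sub>M Q) ?X \<le>
      K * (C * measure (?G \<Otimes>\<^sub>M ?G) {z. B < fst z \<and> B < snd z \<and> x < fst z + snd z})"
    using \<open>0 \<le> K\<close> by (simp add: mult_left_mono)
  also have "\<dots> \<le> K * (C * (e * (1 - F x)))"
    using \<open>0 \<le> K\<close> \<open>0 \<le> C\<close> by (intro mult_left_mono both)
  finally have X: "measure (P \<Otimes>\<^sub>M Q) ?X \<le> C * K * e * (1 - F x)"
    by (simp add: mult_ac)
  have "measure (P \<Otimes>\<^sub>M Q) {z \<in> space (P \<Otimes>\<^sub>M Q). fst z \<in> D \<and> x < \<eta> (fst z) + W (snd z)} \<le>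
     measure (P \<Otimes>\<^sub>M Q) (D \<times> {w \<in> space Q. x - B < W w} \<union> {p \<in> space P. p \<in> D \<and> x - B < \<eta> p} \<times> space Q \<union> ?X)"
    by (rule PQ.finite_measure_mono) (auto simp: \<eta>'_def space_pair_measure)
  also have "\<dots> \<le> measure (P \<Otimes>\<^sub>M Q) (D \<times> {w \<in> space Q. x - B < W w}) +
      measure (P \<Otimes>\<^sub>M Q) ({p \<in> space P. p \<in> D \<and> x - B < \<eta> p} \<times> space Q) + measure (P \<Otimes>\<^sub>M Q) ?X"
    by (intro order_trans[OF measure_Un_le] add_mono order_refl) measurable
  also have "measure (P \<Otimes>\<^sub>M Q) (D \<times> {w \<in> space Q. x - B < W w}) = measure P D * measure Q {w \<in> space Q. x - B < W w}"
    by (rule measure_rect[OF P Q]) measurable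
  also have "measure (P \<Otimes>\<^sub>M Q) ({p \<in> space P. p \<in> D \<and> x - B < \<eta> p} \<times> space Q) =
      measure P {p \<in> space P. p \<in> D \<and> x - B < \<eta> p}"
    by (subst measure_rect[OF P Q]) (auto simp: QQ.prob_space)
  finally show ?thesis using X by linarith
qed

section \<open>The integrated tail\<close>

locale subexp_integrated_tail =
  fixes F :: "real \<Rightarrow> real"
  assumes df: "df_on_Rplus F" and subexp: "subexponential F"
    and subexp_it: "subexponential (integrated_tail F)"
begin

abbreviation tl :: "real \<Rightarrow> real" where "tl x \<equiv> 1 - F x"
abbreviation it :: "real \<Rightarrow> real" where "it x \<equiv> 1 - integrated_tail F x"

text \<open>The integrated tail without truncation at 1. Unlike \<open>it\<close> it is additive
  over intervals everywhere on the half-line, so sums of increments telescope.\<close>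

definition H :: "real \<Rightarrow> real" where "H x = (LBINT u:{x..}. 1 - F u)"

lemma tl_antimono: "x \<le> y \<Longrightarrow> tl y \<le> tl x"
  using df by (auto simp: df_on_Rplus_def mono_def)

lemma tl_nonneg: "0 \<le> tl x"
  using df_on_Rplus_law(7)[OF df] by simp

lemma tl_pos: "0 < tl x"
  using subexponential_law(2)[OF subexp, of x] by simp

lemma df_it: "df_on_Rplus (integrated_tail F)"
  by (rule subexponential_law(1)[OF subexp_it])

lemma it_pos: "0 < it x"
  using subexponential_law(2)[OF subexp_it, of x] by simp

lemma it_antimono: "x \<le> y \<Longrightarrow> it y \<le> it x"
  using df_it by (auto simp: df_on_Rplus_def mono_def)

lemma it_tendsto: "(it \<longlongrightarrow> 0) at_top"
  using df_it tendsto_diff[OF tendsto_const, of "integrated_tail F" 1 at_top 1] by (simp add: df_on_Rplus_def)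

lemma it_eq: "0 \<le> x \<Longrightarrow> it x = min 1 (H x)"
  by (simp add: integrated_tail_def H_def)

lemma it_eq_H: "\<forall>\<^sub>F x in at_top. it x = H x"
proof -
  have "\<forall>\<^sub>F x in at_top. it x < 1" by (rule order_tendstoD(2)[OF it_tendsto]) simp
  then show ?thesis using eventually_ge_at_top[of 0]
    by eventually_elim (auto simp: it_eq min_def split: if_splits)
qed

lemma H_tendsto: "(H \<longlongrightarrow> 0) at_top"
  using it_tendsto it_eq_H by (rule Lim_transform_eventually)

text \<open>Not integrable would mean that the Bochner integral takes the value 0, whereas a
  subexponential distribution function is everywhere below 1.\<close>

lemma tl_integrable: assumes "0 \<le> x" shows "set_integrable lborel {x..} tl"
proof (rule ccontr)
  assume "\<not> ?thesis"
  then have "H x = 0"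
    by (simp add: H_def set_lebesgue_integral_def set_integrable_def not_integrable_integral_eq)
  with it_pos[of x] it_eq[OF assms] show False by simp
qed

lemma H_diff:
  assumes "0 \<le> x" "0 < s"
  shows "s * tl (x + s) \<le> H x - H (x + s)" and "H x - H (x + s) \<le> s * tl x"
proof -
  have i1: "set_integrable lborel {x..<x+s} tl"
    by (rule set_integrable_subset[OF tl_integrable[OF assms(1)]]) auto
  have "H x = (LBINT u:{x..<x+s} \<union> {x+s..}. tl u)"
    unfolding H_def using assms by (intro arg_cong[where f="\<lambda>A. set_lebesgue_integral lborel A tl"]) auto
  also have "\<dots> = (LBINT u:{x..<x+s}. tl u) + H (x + s)"
    unfolding H_def using i1 tl_integrable[of "x+s"] assms by (intro set_integral_Un) auto
  finally have *: "H x - H (x + s) = (LBINT u:{x..<x+s}. tl u)" by simp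
  have c: "set_integrable lborel {x..<x+s} (\<lambda>_. c)" "(LBINT u:{x..<x+s}. c) = s * c" for c :: real
    using assms by (auto simp: set_integrable_def set_lebesgue_integral_def)
  show "s * tl (x + s) \<le> H x - H (x + s)"
    unfolding * c(2)[symmetric] by (intro set_integral_mono c i1 tl_antimono) auto
  show "H x - H (x + s) \<le> s * tl x"
    unfolding * c(2)[symmetric] by (intro set_integral_mono c i1 tl_antimono) auto
qed

lemma H_nonneg: "0 \<le> H x"
  unfolding H_def set_lebesgue_integral_def using tl_nonneg
  by (intro integral_nonneg_AE) (auto simp: indicator_def)

text \<open>A Riemann sum on a grid of width \<open>s\<close>: summing the tail of \<open>F\<close>
  along a line of slope \<open>s\<close> gives the integrated tail divided by \<open>s\<close>,
  whence the denominators of the final constant. The upper bound must start at \<open>Suc n\<close>,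
  since each term is compared with the interval to its left.\<close>

lemma sum_tl_upper:
  assumes "0 \<le> x" "0 < s"
  shows "(\<Sum>n<N. tl (x + real (Suc n) * s)) \<le> H x / s"
proof -
  have "s * (\<Sum>n<N. tl (x + real (Suc n) * s)) \<le> H x - H (x + real N * s)"
  proof (induction N)
    case (Suc N)
    have "s * tl (x + real N * s + s) \<le> H (x + real N * s) - H (x + real N * s + s)"
      using assms by (intro H_diff) auto
    with Suc show ?case by (simp add: algebra_simps)
  qed simp
  with H_nonneg[of "x + real N * s"] have "s * (\<Sum>n<N. tl (x + real (Suc n) * s)) \<le> H x" by linarith
  then show ?thesis using assms by (simp add: field_simps)
qed

lemma sum_tl_lower:
  assumes "0 \<le> x" "0 < s"
  shows "(H x - H (x + real N * s)) / s \<le> (\<Sum>n<N. tl (x + real n * s))"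
proof -
  have "s * (\<Sum>n<N. tl (x + real n * s)) \<ge> H x - H (x + real N * s)"
  proof (induction N)
    case (Suc N)
    have "s * tl (x + real N * s) \<ge> H (x + real N * s) - H (x + real N * s + s)"
      using assms by (intro H_diff) auto
    with Suc show ?case by (simp add: algebra_simps)
  qed simp
  then show ?thesis using assms by (simp add: field_simps)
qed

lemma H_tendsto_step:
  assumes "0 < s"
  shows "(\<lambda>N. H (x + real N * s)) \<longlonglongrightarrow> 0"
proof (rule filterlim_compose[OF H_tendsto])
  show "filterlim (\<lambda>N. x + real N * s) at_top sequentially"
    using assms by (intro filterlim_tendsto_add_at_top[OF tendsto_const]
        filterlim_at_top_mult_tendsto_pos[OF tendsto_const] filterlim_real_sequentially)
qed

lemma it_shift:
  assumes "0 < e"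
  shows "\<forall>\<^sub>F x in at_top. it (x - B) \<le> (1 + e) * it x"
    and "\<forall>\<^sub>F x in at_top. (1 - e) * it x \<le> it (x + B)"
proof -
  have le: "\<forall>\<^sub>F x in at_top. it (x - B) \<le> (1 + e) * it x" if "0 < e" for e B
  proof -
    \<comment> \<open>\<open>B\<close> may be negative; then monotonicity alone suffices and the
      shift is taken to be 0.\<close>
    have "\<forall>\<^sub>F x in at_top. it (x - max 0 B) / it x < 1 + e"
      using that by (intro order_tendstoD(2)[OF subexponential_long_tailed[OF subexp_it]]) auto
    then show ?thesis
    proof eventually_elim
      case (elim x)
      have "it (x - B) \<le> it (x - max 0 B)" by (rule it_antimono) auto
      with elim it_pos[of x] show ?case by (simp add: field_simps)
    qed
  qed
  show "\<forall>\<^sub>F x in at_top. it (x - B) \<le> (1 + e) * it x" by (rule le[OF assms])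
  have "\<forall>\<^sub>F x in at_top. it (x + B - B) \<le> (1 + e) * it (x + B)"
    by (rule eventually_compose_filterlim[OF le[OF assms, of B]])
       (use filterlim_tendsto_add_at_top[OF tendsto_const filterlim_ident, of B] in \<open>simp add: add.commute\<close>)
  then show "\<forall>\<^sub>F x in at_top. (1 - e) * it x \<le> it (x + B)"
  proof eventually_elim
    case (elim x)
    show ?case
    proof (cases "e < 1")
      case True
      have "(1 - e) * it x \<le> (1 - e) * ((1 + e) * it (x + B))"
        using elim True by (intro mult_left_mono) auto
      also have "\<dots> = (1 - e^2) * it (x + B)" by (simp add: algebra_simps power2_eq_square)
      also have "\<dots> \<le> 1 * it (x + B)" using it_pos[of "x + B"] by (intro mult_right_mono) auto
      finally show ?thesis by simp
    next
      case False
      then have "(1 - e) * it x \<le> 0" using it_pos[of x] by (intro mult_nonpos_nonneg) auto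
      with it_pos[of "x + B"] show ?thesis by linarith
    qed
  qed
qed

text \<open>Long-tailedness makes \<open>F\<close>'s tail negligible against its integral over a unit interval.\<close>

lemma tl_le_it:
  assumes "0 < e"
  shows "\<forall>\<^sub>F x in at_top. tl x \<le> e * it x"
proof -
  have "filterlim (\<lambda>x::real. x - 1) at_top at_top"
    using filterlim_tendsto_add_at_top[OF tendsto_const filterlim_ident, of "-1::real"] by simp
  then have "\<forall>\<^sub>F x in at_top. it (x - 1) = H (x - 1)"
    by (rule eventually_compose_filterlim[OF it_eq_H])
  with it_shift(1)[OF assms, of 1] it_eq_H eventually_ge_at_top[of 1]
  show ?thesis
  proof eventually_elim
    case (elim x)
    have "it (x - 1) - it x \<le> e * it x" using elim(1) by (simp add: distrib_right)
    moreover have "tl x \<le> H (x - 1) - H x" using H_diff(1)[of "x - 1" 1] elim(3) by simp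
    ultimately show ?case using elim(2,4) by linarith
  qed
qed

end

section \<open>Independent sequences\<close>

context sequence_space
begin

definition shift :: "(nat \<Rightarrow> 'a) \<Rightarrow> nat \<Rightarrow> 'a" where
  "shift \<omega> = (\<lambda>i. \<omega> (Suc i))"

lemma measurable_shift [measurable]: "shift \<in> measurable S S"
  unfolding shift_def by (rule measurable_PiM_single') (auto simp: space_PiM PiE_iff)

lemma distr_shift: "distr S S shift = S"
  using distr_PiM_reindex[of UNIV "\<lambda>_. M" Suc UNIV] M.prob_space_axioms
  by (simp add: shift_def[abs_def] restrict_def)

lemma shift_comb_seq: "shift (comb_seq 1 \<omega> \<omega>') = \<omega>'"
  by (auto simp: shift_def comb_seq_def)

lemma distr_coord: "distr S M (\<lambda>\<omega>. \<omega> i) = M"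
  by (rule PiM_component) simp

lemma integrable_coord:
  fixes f :: "'a \<Rightarrow> real"
  assumes "integrable M f"
  shows "integrable S (\<lambda>\<omega>. f (\<omega> i))"
proof -
  have "integrable (distr S M (\<lambda>\<omega>. \<omega> i)) f" using assms by (simp add: distr_coord)
  then show ?thesis by (rule integrable_distr[rotated]) simp
qed

lemma measure_comb_seq:
  assumes "A \<in> sets S"
  shows "measure S A = measure (S \<Otimes>\<^sub>M S) {z \<in> space (S \<Otimes>\<^sub>M S). comb_seq n (fst z) (snd z) \<in> A}"
proof -
  have "measure S A = measure (distr (S \<Otimes>\<^sub>M S) S (\<lambda>(\<omega>, \<omega>'). comb_seq n \<omega> \<omega>')) A"
    by (simp add: PiM_comb_seq)
  also have "\<dots> = measure (S \<Otimes>\<^sub>M S) ((\<lambda>(\<omega>, \<omega>'). comb_seq n \<omega> \<omega>') -` A \<inter> space (S \<Otimes>\<^sub>M S))"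
    by (rule measure_distr[OF measurable_comb_seq assms])
  also have "(\<lambda>(\<omega>, \<omega>'). comb_seq n \<omega> \<omega>') -` A \<inter> space (S \<Otimes>\<^sub>M S) =
      {z \<in> space (S \<Otimes>\<^sub>M S). comb_seq n (fst z) (snd z) \<in> A}"
    by auto
  finally show ?thesis .
qed

text \<open>Garsia's proof of the maximal ergodic lemma, restricted to the event that the partial sums
  are unbounded. This event is shift invariant, hence independent of the first increment.\<close>

lemma AE_partial_sums_bounded:
  fixes f :: "'a \<Rightarrow> real"
  assumes f: "integrable M f" and neg: "(\<integral>x. f x \<partial>M) < 0"
  shows "AE \<omega> in S. \<exists>C. \<forall>n. (\<Sum>i<n. f (\<omega> i)) \<le> C"
proof -
  have [measurable]: "f \<in> borel_measurable M" using f by auto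
  define s where "s n \<omega> = (\<Sum>i<n. f (\<omega> i))" for n and \<omega> :: "nat \<Rightarrow> 'a"
  define X where "X n \<omega> = Max ((\<lambda>k. s k \<omega>) ` {..n})" for n \<omega>
  define U where "U = {\<omega> \<in> space S. \<forall>C::nat. \<exists>n. real C < s n \<omega>}"
  have [measurable]: "s n \<in> borel_measurable S" for n unfolding s_def by measurable
  have [measurable]: "X n \<in> borel_measurable S" for n unfolding X_def by measurable
  have [measurable]: "U \<in> sets S" unfolding U_def by measurable
  have sS: "s (Suc n) \<omega> = f (\<omega> 0) + s n (shift \<omega>)" for n \<omega>
    unfolding s_def shift_def by (rule sum.lessThan_Suc_shift)
  have X0: "0 \<le> X n \<omega>" for n \<omega>
    unfolding X_def by (rule Max_ge_iff[THEN iffD2]) (auto simp: s_def intro!: bexI[of _ 0])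
  have sX: "k \<le> n \<Longrightarrow> s k \<omega> \<le> X n \<omega>" for k n \<omega>
    unfolding X_def by (rule Max_ge) auto
  have inv: "shift \<omega> \<in> U \<longleftrightarrow> \<omega> \<in> U" if \<omega>: "\<omega> \<in> space S" for \<omega>
  proof -
    have sh: "shift \<omega> \<in> space S" using measurable_space[OF measurable_shift \<omega>] .
    have U: "\<exists>n. c < s n \<omega>'" if "\<omega>' \<in> U" for c \<omega>'
    proof -
      obtain C :: nat where "c < real C" using reals_Archimedean2 by blast
      with that show ?thesis unfolding U_def using less_trans by fastforce
    qed
    show ?thesis
    proof
      assume "shift \<omega> \<in> U"
      have "\<exists>n. real C < s n \<omega>" for C
      proof -
        obtain n where "real C - f (\<omega> 0) < s n (shift \<omega>)" using U[OF \<open>shift \<omega> \<in> U\<close>] by blast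
        then show ?thesis by (intro exI[of _ "Suc n"]) (simp add: sS)
      qed
      then show "\<omega> \<in> U" using \<omega> by (auto simp: U_def)
    next
      assume "\<omega> \<in> U"
      have "\<exists>n. real C < s n (shift \<omega>)" for C
      proof -
        \<comment> \<open>The maximum with 0 excludes \<open>n = 0\<close>, so that the index can be
          lowered by one after the shift.\<close>
        obtain n where n: "max 0 (real C + f (\<omega> 0)) < s n \<omega>" using U[OF \<open>\<omega> \<in> U\<close>] by blast
        then obtain k where "n = Suc k" by (cases n) (auto simp: s_def)
        then show ?thesis using n by (intro exI[of _ k]) (simp add: sS)
      qed
      then show "shift \<omega> \<in> U" using sh by (auto simp: U_def)
    qed
  qed
  have Xint: "integrable S (X n)" for n
  proof (rule Bochner_Integration.integrable_bound)
    show "integrable S (\<lambda>\<omega>. \<Sum>i<n. \<bar>f (\<omega> i)\<bar>)" using f by (intro Bochner_Integration.integrable_sum integrable_abs integrable_coord)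
    have "X n \<omega> \<le> (\<Sum>i<n. \<bar>f (\<omega> i)\<bar>)" for \<omega>
    proof -
      have "s k \<omega> \<le> (\<Sum>i<n. \<bar>f (\<omega> i)\<bar>)" if "k \<le> n" for k
      proof -
        have "s k \<omega> \<le> (\<Sum>i<k. \<bar>f (\<omega> i)\<bar>)" unfolding s_def by (intro sum_mono) auto
        also have "\<dots> \<le> (\<Sum>i<n. \<bar>f (\<omega> i)\<bar>)" using that by (intro sum_mono2) auto
        finally show ?thesis .
      qed
      then show ?thesis unfolding X_def by (subst Max_le_iff) auto
    qed
    then show "AE \<omega> in S. norm (X n \<omega>) \<le> norm (\<Sum>i<n. \<bar>f (\<omega> i)\<bar>)"
      using X0 by (intro AE_I2) (auto intro: order_trans)
  qed measurable
  \<comment> \<open>A positive maximum is attained at an index at least 1. Splitting off its first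
    summand leaves a partial sum of the shifted sequence.\<close>
  have step: "X n \<omega> \<le> (if 0 < X n \<omega> then f (\<omega> 0) else 0) + X n (shift \<omega>)" for n \<omega>
  proof (cases "0 < X n \<omega>")
    case True
    have "X n \<omega> \<in> (\<lambda>k. s k \<omega>) ` {..n}" unfolding X_def by (rule Max_in) auto
    then obtain k where k: "k \<le> n" "X n \<omega> = s k \<omega>" by auto
    with True obtain j where "k = Suc j" by (cases k) (auto simp: s_def)
    with k sX[of j n "shift \<omega>"] True show ?thesis by (simp add: sS)
  next
    case False
    with X0[of n \<omega>] X0[of n "shift \<omega>"] show ?thesis by simp
  qed
  define g where "g n \<omega> = indicator U \<omega> * (if 0 < X n \<omega> then f (\<omega> 0) else 0)" for n \<omega>
  have [measurable]: "g n \<in> borel_measurable S" for n unfolding g_def by measurable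
  have f0: "integrable S (\<lambda>\<omega>. f (\<omega> 0))" by (rule integrable_coord[OF f])
  have gint: "integrable S (g n)" for n
    by (rule Bochner_Integration.integrable_bound[OF f0]) (auto simp: g_def indicator_def)
  have UX: "integrable S (\<lambda>\<omega>. indicator U \<omega> * X n \<omega>)" for n
    by (rule Bochner_Integration.integrable_bound[OF Xint[of n]]) (auto simp: indicator_def)
  have sh: "integrable S (\<lambda>\<omega>. indicator U (shift \<omega>) * X n (shift \<omega>))"
      "(\<integral>\<omega>. indicator U (shift \<omega>) * X n (shift \<omega>) \<partial>S) = (\<integral>\<omega>. indicator U \<omega> * X n \<omega> \<partial>S)" for n
  proof -
    have "integrable (distr S S shift) (\<lambda>\<omega>. indicator U \<omega> * X n \<omega>)" using UX by (simp add: distr_shift)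
    then show "integrable S (\<lambda>\<omega>. indicator U (shift \<omega>) * X n (shift \<omega>))"
      by (rule integrable_distr[rotated]) simp
    have "(\<integral>\<omega>. indicator U \<omega> * X n \<omega> \<partial>distr S S shift) = (\<integral>\<omega>. indicator U (shift \<omega>) * X n (shift \<omega>) \<partial>S)"
      by (rule integral_distr) auto
    then show "(\<integral>\<omega>. indicator U (shift \<omega>) * X n (shift \<omega>) \<partial>S) = (\<integral>\<omega>. indicator U \<omega> * X n \<omega> \<partial>S)"
      by (simp add: distr_shift)
  qed
  \<comment> \<open>\<open>U\<close> and the law are shift invariant, so the two maxima have the
    same integral over \<open>U\<close> and cancel.\<close>
  have gpos: "0 \<le> (\<integral>\<omega>. g n \<omega> \<partial>S)" for n
  proof -
    have "(\<integral>\<omega>. indicator U \<omega> * X n \<omega> \<partial>S) \<le> (\<integral>\<omega>. g n \<omega> + indicator U (shift \<omega>) * X n (shift \<omega>) \<partial>S)"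
    proof (rule integral_mono)
      fix \<omega> assume "\<omega> \<in> space S"
      then show "indicator U \<omega> * X n \<omega> \<le> g n \<omega> + indicator U (shift \<omega>) * X n (shift \<omega>)"
        using inv[of \<omega>] step[of n \<omega>] by (auto simp: indicator_def g_def)
    qed (auto intro: UX gint sh Bochner_Integration.integrable_add)
    also have "\<dots> = (\<integral>\<omega>. g n \<omega> \<partial>S) + (\<integral>\<omega>. indicator U \<omega> * X n \<omega> \<partial>S)"
      by (simp add: sh gint)
    finally show ?thesis by simp
  qed
  \<comment> \<open>On \<open>U\<close> some partial sum is positive, so the restriction to a
    positive maximum disappears in the limit.\<close>
  have "(\<lambda>n. \<integral>\<omega>. g n \<omega> \<partial>S) \<longlonglongrightarrow> (\<integral>\<omega>. indicator U \<omega> * f (\<omega> 0) \<partial>S)"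
  proof (rule integral_dominated_convergence[where w="\<lambda>\<omega>. \<bar>f (\<omega> 0)\<bar>"])
    show "integrable S (\<lambda>\<omega>. \<bar>f (\<omega> 0)\<bar>)" using f0 by auto
    show "AE \<omega> in S. (\<lambda>n. g n \<omega>) \<longlonglongrightarrow> indicator U \<omega> * f (\<omega> 0)"
    proof (rule AE_I2)
      fix \<omega> show "(\<lambda>n. g n \<omega>) \<longlonglongrightarrow> indicator U \<omega> * f (\<omega> 0)"
      proof (cases "\<omega> \<in> U")
        case True
        then obtain k where "0 < s k \<omega>" by (auto simp: U_def dest: spec[of _ 0])
        then have "\<forall>\<^sub>F n in sequentially. g n \<omega> = indicator U \<omega> * f (\<omega> 0)"
          unfolding eventually_sequentially using sX[of k _ \<omega>] True by (intro exI[of _ k]) (fastforce simp: g_def)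
        then show ?thesis by (rule tendsto_eventually)
      qed (simp add: g_def)
    qed
  qed (auto simp: g_def indicator_def)
  then have "0 \<le> (\<integral>\<omega>. indicator U \<omega> * f (\<omega> 0) \<partial>S)"
    by (rule LIMSEQ_le_const) (use gpos in auto)
  \<comment> \<open>Written with \<open>shift \<omega>\<close>, the indicator involves only the
    coordinates after the first. The integral therefore factors into the mean of \<open>f\<close>,
    which is negative, and the probability of \<open>U\<close>.\<close>
  also have "(\<integral>\<omega>. indicator U \<omega> * f (\<omega> 0) \<partial>S) = (\<integral>\<omega>. indicator U (shift \<omega>) * f (\<omega> 0) \<partial>S)"
    by (intro Bochner_Integration.integral_cong) (auto simp: indicator_def inv)
  also have "\<dots> = (\<integral>\<omega>. indicator U (shift \<omega>) * f (\<omega> 0) \<partial>distr (S \<Otimes>\<^sub>M S) S (\<lambda>(\<omega>, \<omega>'). comb_seq 1 \<omega> \<omega>'))"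
    by (simp only: PiM_comb_seq)
  also have "\<dots> = (\<integral>z. f (fst z 0) * indicator U (snd z) \<partial>(S \<Otimes>\<^sub>M S))"
    by (subst integral_distr[OF measurable_comb_seq])
       (auto simp: case_prod_beta shift_comb_seq comb_seq_less intro!: Bochner_Integration.integral_cong simp del: One_nat_def)
  also have "\<dots> = (\<integral>\<omega>. f (\<omega> 0) \<partial>S) * measure S U"
  proof -
    interpret SS: pair_prob_space S S ..
    have [simp]: "integrable S (indicat_real U)"
      by (rule integrable_real_indicator) (auto simp: P.emeasure_eq_measure)
    have "integrable (S \<Otimes>\<^sub>M S) (\<lambda>z. f (fst z 0) * indicator U (snd z))"
      by (rule SS.Fubini_integrable) (auto simp: abs_mult intro!: integrable_mult_left integrable_abs f0 AE_I2)
    from SS.integral_fst'[OF this] show ?thesis by simp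
  qed
  also have "(\<integral>\<omega>. f (\<omega> 0) \<partial>S) = (\<integral>x. f x \<partial>M)"
    using integral_distr[of "\<lambda>\<omega>. \<omega> 0" S M f] by (simp add: distr_coord)
  finally have "measure S U = 0"
    using neg measure_nonneg[of S U] by (auto simp: zero_le_mult_iff not_le)
  then have "AE \<omega> in S. \<omega> \<notin> U" by (intro AE_not_in) (simp add: null_sets_def P.emeasure_eq_measure)
  then show ?thesis
  proof (rule AE_mp, intro AE_I2 impI)
    fix \<omega> assume "\<omega> \<in> space S" "\<omega> \<notin> U"
    then show "\<exists>C. \<forall>n. (\<Sum>i<n. f (\<omega> i)) \<le> C" by (auto simp: U_def s_def not_less)
  qed
qed

end

section \<open>The tandem recursion\<close>

text \<open>The sequence \<open>\<omega>\<close> lists the customers backwards in time, starting with customer 0. With \<open>n\<close>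
  customers, \<open>A n\<close> is the score of a path that stays at station 2 and \<open>V n\<close> the best score of a
  path that switches once from station 2 to station 1 (or is empty, for \<open>n = 0\<close>).\<close>

locale tandem = sequence_space M for M :: "'a measure" +
  fixes s1 s2 t :: "'a \<Rightarrow> real" and b1 b2 a :: real
  assumes meas [measurable]: "s1 \<in> borel_measurable M" "s2 \<in> borel_measurable M" "t \<in> borel_measurable M"
    and s1_nonneg: "\<And>x. 0 \<le> s1 x" and s2_nonneg: "\<And>x. 0 \<le> s2 x" and t_nonneg: "\<And>x. 0 \<le> t x"
    and integ: "integrable M s1" "integrable M s2" "integrable M t"
    and mean: "(\<integral>x. s1 x \<partial>M) = b1" "(\<integral>x. s2 x \<partial>M) = b2" "(\<integral>x. t x \<partial>M) = a"
    and stable: "b1 < a" "b2 < a"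
begin

definition A :: "nat \<Rightarrow> (nat \<Rightarrow> 'a) \<Rightarrow> real" where
  "A n \<omega> = (\<Sum>i<n. s2 (\<omega> i) - t (\<omega> i))"

text \<open>The customer at which the path switches contributes both service times, because
  \<open>q\<close> occurs in both sums of the dater. The time \<open>t\<close> is subtracted for
  every customer, including customer 0, which makes the increments identically distributed.\<close>

primrec V :: "nat \<Rightarrow> (nat \<Rightarrow> 'a) \<Rightarrow> real" where
  "V 0 \<omega> = 0"
| "V (Suc n) \<omega> = max (V n \<omega> + s1 (\<omega> n)) (A n \<omega> + s2 (\<omega> n) + s1 (\<omega> n)) - t (\<omega> n)"

definition W :: "nat \<Rightarrow> (nat \<Rightarrow> 'a) \<Rightarrow> real" where
  "W N \<omega> = Max ((\<lambda>k. V k \<omega>) ` {..N})"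

definition shift_by :: "nat \<Rightarrow> (nat \<Rightarrow> 'a) \<Rightarrow> nat \<Rightarrow> 'a" where
  "shift_by n \<omega> = (\<lambda>i. \<omega> (n + i))"

lemma measurable_A [measurable]: "A n \<in> borel_measurable S"
  unfolding A_def by measurable

lemma measurable_V [measurable]: "V n \<in> borel_measurable S"
proof (induction n)
  case (Suc n)
  note [measurable] = Suc
  show ?case by (simp add: fun_eq_iff cong: measurable_cong) measurable
qed (simp add: measurable_cong[of S "V 0" "\<lambda>_. 0"])

lemma measurable_W [measurable]: "W N \<in> borel_measurable S"
  unfolding W_def by measurable

lemma measurable_shift_by [measurable]: "shift_by n \<in> measurable S S"
  unfolding shift_by_def by (rule measurable_PiM_single') (auto simp: space_PiM PiE_iff)

lemma W_gt: "x < W N \<omega> \<longleftrightarrow> (\<exists>k\<le>N. x < V k \<omega>)"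
  unfolding W_def by (subst Max_gr_iff) auto

lemma A_le_V: "A n \<omega> \<le> V n \<omega>"
  using s1_nonneg[of "\<omega> (n - 1)"] by (cases n) (auto simp: A_def)

lemma station1_le_V: "(\<Sum>i<n. s1 (\<omega> i) - t (\<omega> i)) \<le> V n \<omega>"
  by (induction n) auto

lemma A_add: "A (n + k) \<omega> = A n \<omega> + A k (shift_by n \<omega>)"
  by (induction k) (auto simp: A_def shift_by_def)

text \<open>A path that has switched within the first \<open>n\<close> customers continues at
  station 1, and one that has not scores \<open>A n\<close>, which is at most \<open>V n\<close>.
  The right side also admits a second visit to station 2, hence no equality.\<close>

lemma V_restart: "V (n + k) \<omega> \<le> V n \<omega> + V k (shift_by n \<omega>)"
proof (induction k)
  case (Suc k)
  then show ?case using A_le_V[of n \<omega>]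
    by (auto simp: A_add shift_by_def max_def)
qed simp

lemma A_cong: "(\<And>i. i < n \<Longrightarrow> \<omega> i = \<omega>' i) \<Longrightarrow> A n \<omega> = A n \<omega>'"
  unfolding A_def by (intro sum.cong) auto

lemma V_cong: "(\<And>i. i < n \<Longrightarrow> \<omega> i = \<omega>' i) \<Longrightarrow> V n \<omega> = V n \<omega>'"
proof (induction n)
  case (Suc n)
  then have "V n \<omega> = V n \<omega>'" "A n \<omega> = A n \<omega>'" "\<omega> n = \<omega>' n" by (auto intro!: A_cong)
  then show ?case by simp
qed simp

lemma A_comb: "m \<le> n \<Longrightarrow> A m (comb_seq n \<omega> \<omega>') = A m \<omega>"
  and V_comb: "m \<le> n \<Longrightarrow> V m (comb_seq n \<omega> \<omega>') = V m \<omega>"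
  by (auto intro!: A_cong V_cong simp: comb_seq_def)

lemma shift_by_comb: "shift_by n (comb_seq n \<omega> \<omega>') = \<omega>'"
  by (auto simp: shift_by_def comb_seq_def)

section \<open>Almost sure linear bounds for the scores\<close>

text \<open>The path that switches at \<open>j\<close> scores as much as the path that is at station
  1 throughout, plus the station 2 times up to and including \<open>j\<close>, minus the station 1
  times before \<open>j\<close>. The number \<open>m\<close> bounds this gain for all
  \<open>j\<close>.\<close>

lemma V_le_potential:
  assumes "0 \<le> m" "\<And>j. j < n \<Longrightarrow> (\<Sum>i<Suc j. s2 (\<omega> i)) - (\<Sum>i<j. s1 (\<omega> i)) \<le> m"
  shows "V n \<omega> \<le> (\<Sum>i<n. s1 (\<omega> i) - t (\<omega> i)) + m"
  using assms(2)
proof (induction n)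
  case (Suc n)
  then have "V n \<omega> \<le> (\<Sum>i<n. s1 (\<omega> i) - t (\<omega> i)) + m" by auto
  moreover have "(\<Sum>i<n. s2 (\<omega> i)) + s2 (\<omega> n) - (\<Sum>i<n. s1 (\<omega> i)) \<le> m"
    using Suc.prems[of n] by simp
  ultimately show ?case by (simp add: A_def sum_subtractf)
qed (use assms(1) in simp)

text \<open>Centred at \<open>c\<close> the summands have negative mean, so their partial sums are
  bounded above. This one-sided statement takes the place of the law of large numbers.\<close>

lemma AE_sum_upper:
  assumes "integrable M f" "(\<integral>x. f x \<partial>M) < (c :: real)"
  shows "AE \<omega> in S. \<exists>C. \<forall>n. (\<Sum>i<n. f (\<omega> i)) \<le> C + real n * c"
proof -
  have "AE \<omega> in S. \<exists>C. \<forall>n. (\<Sum>i<n. f (\<omega> i) - c) \<le> C"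
    using assms by (intro AE_partial_sums_bounded) (auto simp: M.prob_space)
  then show ?thesis
    by (rule AE_mp) (auto intro!: AE_I2 simp: sum_subtractf algebra_simps)
qed

lemma AE_A_upper:
  assumes "0 < e"
  shows "AE \<omega> in S. \<exists>C. \<forall>n. A n \<omega> \<le> C - real n * (a - b2 - e)"
proof -
  have "AE \<omega> in S. \<exists>C. \<forall>n. (\<Sum>i<n. s2 (\<omega> i) - t (\<omega> i)) \<le> C + real n * (b2 - a + e)"
    using assms integ by (intro AE_sum_upper) (auto simp: mean)
  then show ?thesis
    by (rule AE_mp) (auto intro!: AE_I2 simp: A_def algebra_simps)
qed

text \<open>The gain from switching at \<open>j < n\<close> grows at most like
  \<open>n (max b1 b2 - b1)\<close>; added to the station 1 drift \<open>n (b1 - a)\<close> it gives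
  the drift with \<open>max b1 b2\<close>. Four sums are estimated, each with error rate
  \<open>e / 4\<close>.\<close>

lemma AE_V_upper:
  assumes "0 < e"
  shows "AE \<omega> in S. \<exists>C. \<forall>n. V n \<omega> \<le> C - real n * (a - max b1 b2 - e)"
proof -
  define d where "d = e / 4"
  have d: "0 < d" "e = 4 * d" using assms by (auto simp: d_def)
  have 1: "AE \<omega> in S. \<exists>C. \<forall>n. (\<Sum>i<n. s1 (\<omega> i)) \<le> C + real n * (b1 + d)"
    and 2: "AE \<omega> in S. \<exists>C. \<forall>n. (\<Sum>i<n. - s1 (\<omega> i)) \<le> C + real n * (- b1 + d)"
    and 3: "AE \<omega> in S. \<exists>C. \<forall>n. (\<Sum>i<n. s2 (\<omega> i)) \<le> C + real n * (b2 + d)"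
    and 4: "AE \<omega> in S. \<exists>C. \<forall>n. (\<Sum>i<n. - t (\<omega> i)) \<le> C + real n * (- a + d)"
    using d integ by (intro AE_sum_upper; simp add: mean)+
  show ?thesis
    using 1 2 3 4
  proof eventually_elim
    case (elim \<omega>)
    then obtain C1 C2 C3 C4 where
      C: "\<And>n. (\<Sum>i<n. s1 (\<omega> i)) \<le> C1 + real n * (b1 + d)"
         "\<And>n. (\<Sum>i<n. - s1 (\<omega> i)) \<le> C2 + real n * (- b1 + d)"
         "\<And>n. (\<Sum>i<n. s2 (\<omega> i)) \<le> C3 + real n * (b2 + d)"
         "\<And>n. (\<Sum>i<n. - t (\<omega> i)) \<le> C4 + real n * (- a + d)" by blast
    have C0: "0 \<le> C2" "0 \<le> C3" using C(2)[of 0] C(3)[of 0] by auto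
    have b2: "0 \<le> b2" using s2_nonneg by (auto simp flip: mean)
    have "V n \<omega> \<le> (C1 + C2 + C3 + C4 + b2 + d) - real n * (a - max b1 b2 - e)" for n
    proof -
      \<comment> \<open>The term \<open>b2 + d\<close> pays for the one customer by which the
        station 2 sum is longer than the station 1 sum. Replacing \<open>b2\<close> by the maximum
        makes the coefficient nonnegative, so that \<open>j\<close> can be raised to
        \<open>n\<close>.\<close>
      define m where "m = C2 + C3 + b2 + d + real n * (max b1 b2 - b1 + 2 * d)"
      have "(\<Sum>i<Suc j. s2 (\<omega> i)) - (\<Sum>i<j. s1 (\<omega> i)) \<le> m" if "j < n" for j
      proof -
        have "(\<Sum>i<Suc j. s2 (\<omega> i)) \<le> C3 + real (Suc j) * (b2 + d)" by (rule C(3))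
        moreover have "- (\<Sum>i<j. s1 (\<omega> i)) \<le> C2 + real j * (- b1 + d)" using C(2)[of j] by (simp add: sum_negf)
        ultimately have "(\<Sum>i<Suc j. s2 (\<omega> i)) - (\<Sum>i<j. s1 (\<omega> i)) \<le> C2 + C3 + b2 + d + real j * (b2 - b1 + 2 * d)"
          by (simp add: algebra_simps)
        also have "real j * (b2 - b1 + 2 * d) \<le> real j * (max b1 b2 - b1 + 2 * d)"
          by (intro mult_left_mono) auto
        also have "real j * (max b1 b2 - b1 + 2 * d) \<le> real n * (max b1 b2 - b1 + 2 * d)"
          using that d by (intro mult_right_mono) auto
        finally show ?thesis by (simp add: m_def)
      qed
      moreover have "0 \<le> m" using C0 b2 d by (auto simp: m_def intro!: add_nonneg_nonneg mult_nonneg_nonneg)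
      ultimately have "V n \<omega> \<le> (\<Sum>i<n. s1 (\<omega> i) - t (\<omega> i)) + m" by (intro V_le_potential)
      also have "(\<Sum>i<n. s1 (\<omega> i) - t (\<omega> i)) = (\<Sum>i<n. s1 (\<omega> i)) + (\<Sum>i<n. - t (\<omega> i))"
        by (simp add: sum_subtractf sum_negf)
      finally show ?thesis using C(1)[of n] C(4)[of n] d(2) by (simp add: m_def algebra_simps)
    qed
    then show ?case by blast
  qed
qed

lemma AE_lower:
  assumes "0 < e"
  shows "AE \<omega> in S. \<exists>C. \<forall>n. - C - real n * (a - b2 + e) \<le> A n \<omega>"
    and "AE \<omega> in S. \<exists>C. \<forall>n. - C - real n * (a - b1 + e) \<le> (\<Sum>i<n. s1 (\<omega> i) - t (\<omega> i))"
proof -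
  have "AE \<omega> in S. \<exists>C. \<forall>n. (\<Sum>i<n. t (\<omega> i) - s2 (\<omega> i)) \<le> C + real n * (a - b2 + e)"
    using assms integ by (intro AE_sum_upper) (auto simp: mean)
  then show "AE \<omega> in S. \<exists>C. \<forall>n. - C - real n * (a - b2 + e) \<le> A n \<omega>"
    by (rule AE_mp) (fastforce intro!: AE_I2 simp: A_def sum_subtractf algebra_simps)
  have "AE \<omega> in S. \<exists>C. \<forall>n. (\<Sum>i<n. t (\<omega> i) - s1 (\<omega> i)) \<le> C + real n * (a - b1 + e)"
    using assms integ by (intro AE_sum_upper) (auto simp: mean)
  then show "AE \<omega> in S. \<exists>C. \<forall>n. - C - real n * (a - b1 + e) \<le> (\<Sum>i<n. s1 (\<omega> i) - t (\<omega> i))"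
    by (rule AE_mp) (fastforce intro!: AE_I2 simp: sum_subtractf algebra_simps)
qed

section \<open>Stopping at the first crossing\<close>

text \<open>Continuity from above along the natural numbers turns an almost surely finite random
  constant into a deterministic one that fails with small probability.\<close>

lemma small_prob:
  assumes "\<And>R. {\<omega> \<in> space S. Q R \<omega>} \<in> sets S" "AE \<omega> in S. \<exists>R. \<not> Q R \<omega>"
    and "\<And>R R' \<omega>. R \<le> R' \<Longrightarrow> Q R' \<omega> \<Longrightarrow> Q (R :: real) \<omega>" and "0 < e"
  obtains R where "0 \<le> R" "measure S {\<omega> \<in> space S. Q R \<omega>} < e"
proof -
  let ?Q = "\<lambda>R. {\<omega> \<in> space S. Q R \<omega>}"
  have "(\<lambda>n. measure S (?Q (real n))) \<longlonglongrightarrow> measure S (\<Inter>n. ?Q (real n))"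
    using assms(1,3) by (intro P.finite_Lim_measure_decseq) (auto simp: decseq_def, metis of_nat_mono)
  moreover have "AE \<omega> in S. \<omega> \<notin> (\<Inter>n. ?Q (real n))"
    using assms(2)
  proof eventually_elim
    case (elim \<omega>)
    then obtain R where "\<not> Q R \<omega>" by blast
    moreover obtain n where "R \<le> real n" using real_arch_simple by blast
    ultimately show ?case using assms(3) by blast
  qed
  then have "measure S (\<Inter>n. ?Q (real n)) = 0"
    using assms(1) by (subst P.prob_eq_0) auto
  ultimately have "\<forall>\<^sub>F n in sequentially. measure S (?Q (real n)) < e"
    using \<open>0 < e\<close> by (auto dest: order_tendstoD(2))
  then obtain n where "measure S (?Q (real n)) < e" by (auto simp: eventually_sequentially)
  then show ?thesis by (intro that[of "real n"]) auto
qed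

text \<open>The restart uses only \<open>V\<close>. The line for \<open>A\<close> is there so that a
  jump at station 2 is measured against the slope \<open>a - b2\<close>; with the line for
  \<open>V\<close> alone, \<open>d2\<close> would be divided by the smaller slope.\<close>

definition ok :: "real \<Rightarrow> real \<Rightarrow> nat \<Rightarrow> (nat \<Rightarrow> 'a) \<Rightarrow> bool" where
  "ok e R n \<omega> \<longleftrightarrow> A n \<omega> \<le> R - real n * (a - b2 - e) \<and> V n \<omega> \<le> R - real n * (a - max b1 b2 - e)"

definition D :: "real \<Rightarrow> real \<Rightarrow> (nat \<Rightarrow> 'a) set" where
  "D e R = {\<omega> \<in> space S. \<exists>n. \<not> ok e R n \<omega>}"

text \<open>\<open>V\<close> is evaluated even if it was \<open>A\<close> that crossed its line,
  since the restart continues from \<open>V\<close>. Outside \<open>D e R\<close> the value has no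
  meaning, so it only occurs together with that event.\<close>

definition \<eta> :: "real \<Rightarrow> real \<Rightarrow> (nat \<Rightarrow> 'a) \<Rightarrow> real" where
  "\<eta> e R \<omega> = V (LEAST n. \<not> ok e R n \<omega>) \<omega>"

lemma measurable_ok [measurable]: "Measurable.pred S (ok e R n)"
  unfolding ok_def by measurable

lemma measurable_D [measurable]: "D e R \<in> sets S"
  unfolding D_def by measurable

lemma measurable_\<eta> [measurable]: "\<eta> e R \<in> borel_measurable S"
proof -
  have "(\<lambda>\<omega>. LEAST n. \<not> ok e R n \<omega>) \<in> measurable S (count_space UNIV)" by measurable
  then show ?thesis unfolding \<eta>_def by (rule measurable_compose_countable[rotated]) measurable
qed

lemma D_small:
  assumes "0 < e" "0 < g"
  obtains R where "0 \<le> R" "measure S (D e R) < g"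
proof -
  have "AE \<omega> in S. \<exists>R. \<not> (\<exists>n. \<not> ok e R n \<omega>)"
    using AE_A_upper[OF assms(1)] AE_V_upper[OF assms(1)]
  proof eventually_elim
    case (elim \<omega>)
    then obtain C1 C2 where "\<And>n. A n \<omega> \<le> C1 - real n * (a - b2 - e)"
      "\<And>n. V n \<omega> \<le> C2 - real n * (a - max b1 b2 - e)" by blast
    then have "ok e (max C1 C2) n \<omega>" for n
      unfolding ok_def by (meson diff_right_mono max.cobounded1 max.cobounded2 order_trans)
    then show ?case by blast
  qed
  then show ?thesis
    by (rule small_prob[of "\<lambda>R \<omega>. \<exists>n. \<not> ok e R n \<omega>", rotated])
       (use assms(2) that in \<open>auto simp: D_def ok_def intro: order_trans\<close>)
qed

text \<open>Since the line for \<open>V\<close> never rises above \<open>R\<close>, exceeding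
  \<open>x\<close> is itself a violation of \<open>ok\<close>, so a first violation exists. That it
  happens at \<open>n\<close> depends on the first \<open>n\<close> coordinates only and is
  independent of the sequence after them. The events for different \<open>n\<close> are disjoint, so
  they can be reassembled on the product space.\<close>

lemma restart_tail:
  assumes e: "0 \<le> R" "R \<le> x" "e \<le> a - max b1 b2"
  shows "measure S {\<omega> \<in> space S. x < W (Suc N) \<omega>} \<le>
     measure (S \<Otimes>\<^sub>M S) {z \<in> space (S \<Otimes>\<^sub>M S). fst z \<in> D e R \<and> x < \<eta> e R (fst z) + W N (snd z)}"
proof -
  interpret SS: pair_prob_space S S ..
  define E where "E n \<omega> \<longleftrightarrow> \<not> ok e R n \<omega> \<and> (\<forall>m<n. ok e R m \<omega>)" for n \<omega>
  define Y where "Y n = {\<omega> \<in> space S. E n \<omega> \<and> x < V n \<omega> + W N (shift_by n \<omega>)}" for n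
  define Y' where "Y' n = {z \<in> space (S \<Otimes>\<^sub>M S). E n (fst z) \<and> x < V n (fst z) + W N (snd z)}" for n
  have [measurable]: "Measurable.pred S (E n)" for n unfolding E_def by measurable
  have Y: "Y n \<in> sets S" for n unfolding Y_def by measurable
  have Y': "Y' n \<in> sets (S \<Otimes>\<^sub>M S)" for n unfolding Y'_def by measurable
  have eqY: "measure S (Y n) = measure (S \<Otimes>\<^sub>M S) (Y' n)" for n
  proof -
    have "ok e R m (comb_seq n \<omega> \<omega>') = ok e R m \<omega>" if "m \<le> n" for m \<omega> \<omega>'
      using that by (simp add: ok_def A_comb V_comb)
    then have "E n (comb_seq n \<omega> \<omega>') = E n \<omega>" for \<omega> \<omega>' by (auto simp: E_def)
    moreover have "comb_seq n (fst z) (snd z) \<in> space S" if "z \<in> space (S \<Otimes>\<^sub>M S)" for z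
      using that measurable_space[OF measurable_comb_seq, of z M n] by (simp add: case_prod_beta)
    ultimately show ?thesis
      by (subst measure_comb_seq[OF Y, of n n]) (auto simp: Y_def Y'_def V_comb shift_by_comb intro!: arg_cong2[where f=measure])
  qed
  have "measure S {\<omega> \<in> space S. x < W (Suc N) \<omega>} \<le> measure S (\<Union>n\<le>Suc N. Y n)"
  proof (rule P.finite_measure_mono)
    show "{\<omega> \<in> space S. x < W (Suc N) \<omega>} \<subseteq> (\<Union>n\<le>Suc N. Y n)"
    proof safe
      fix \<omega> assume \<omega>: "\<omega> \<in> space S" "x < W (Suc N) \<omega>"
      then obtain k where k: "k \<le> Suc N" "x < V k \<omega>" by (auto simp: W_gt)
      have "0 \<le> real k * (a - max b1 b2 - e)" using e by (intro mult_nonneg_nonneg) auto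
      then have "\<not> V k \<omega> \<le> R - real k * (a - max b1 b2 - e)" using e(2) k(2) by linarith
      then have nk: "\<not> ok e R k \<omega>" by (simp add: ok_def)
      define n where "n = (LEAST n. \<not> ok e R n \<omega>)"
      have n: "\<not> ok e R n \<omega>" unfolding n_def by (rule LeastI[of _ k]) (rule nk)
      have nk': "n \<le> k" unfolding n_def by (rule Least_le) (rule nk)
      have "ok e R m \<omega>" if "m < n" for m using not_less_Least[of m "\<lambda>n. \<not> ok e R n \<omega>"] that by (simp add: n_def)
      then have E: "E n \<omega>" using n by (simp add: E_def)
      \<comment> \<open>As \<open>R\<close> is nonnegative, \<open>ok\<close> holds at 0. The
        crossing thus uses up at least one customer, which lowers the horizon from
        \<open>Suc N\<close> to \<open>N\<close> and permits induction.\<close>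
      have "n \<noteq> 0" using n e(1) by (auto simp: ok_def A_def intro: ccontr)
      then have "k - n \<le> N" using k by auto
      moreover have "V k \<omega> \<le> V n \<omega> + V (k - n) (shift_by n \<omega>)" using V_restart[of n "k - n" \<omega>] nk' by simp
      ultimately have "x < V n \<omega> + W N (shift_by n \<omega>)"
        using k(2) W_gt[of "x - V n \<omega>" N "shift_by n \<omega>"] by (force simp: algebra_simps)
      then show "\<omega> \<in> (\<Union>n\<le>Suc N. Y n)" using \<omega> E nk' k by (auto simp: Y_def intro!: bexI[of _ n])
    qed
  qed (use Y in auto)
  also have "\<dots> \<le> (\<Sum>n\<le>Suc N. measure S (Y n))"
    using Y by (intro measure_UNION_le) auto
  also have "\<dots> = (\<Sum>n\<le>Suc N. measure (S \<Otimes>\<^sub>M S) (Y' n))" by (simp only: eqY)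
  also have "\<dots> = measure (S \<Otimes>\<^sub>M S) (\<Union>n\<le>Suc N. Y' n)"
    using Y' by (intro SS.finite_measure_finite_Union[symmetric])
      (auto simp: disjoint_family_on_def Y'_def E_def, metis linorder_neqE_nat)
  also have "\<dots> \<le> measure (S \<Otimes>\<^sub>M S) {z \<in> space (S \<Otimes>\<^sub>M S). fst z \<in> D e R \<and> x < \<eta> e R (fst z) + W N (snd z)}"
  proof (rule SS.finite_measure_mono)
    have "\<eta> e R \<omega> = V n \<omega>" if "E n \<omega>" for n \<omega>
    proof -
      have "(LEAST n. \<not> ok e R n \<omega>) = n"
        using that by (intro Least_equality) (auto simp: E_def not_less[symmetric])
      then show ?thesis by (simp add: \<eta>_def)
    qed
    then show "(\<Union>n\<le>Suc N. Y' n) \<subseteq> {z \<in> space (S \<Otimes>\<^sub>M S). fst z \<in> D e R \<and> x < \<eta> e R (fst z) + W N (snd z)}"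
      by (auto simp: Y'_def D_def E_def space_pair_measure)
  qed measurable
  finally show ?thesis .
qed

text \<open>Both scores still lie below their lines at \<open>n\<close>, so one of the two branches
  of the recursion must bridge the gap by the service times of customer \<open>n\<close>; the
  interarrival time can only widen it.\<close>

lemma jump:
  assumes "ok e R n \<omega>" "y < V (Suc n) \<omega>"
  shows "y - R + real n * (a - max b1 b2 - e) < s1 (\<omega> n) \<or>
     y - R + real n * (a - b2 - e) < s1 (\<omega> n) + s2 (\<omega> n)"
  using assms t_nonneg[of "\<omega> n"] by (auto simp: ok_def max_def split: if_splits)

end

section \<open>Tail asymptotics\<close>

lemma eventually_at_top_shift:
  fixes c :: real
  assumes "eventually P at_top"
  shows "\<forall>\<^sub>F x in at_top. P (x - c)"
  using filterlim_tendsto_add_at_top[OF tendsto_const filterlim_ident, of "- c"]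
  by (intro eventually_compose_filterlim[OF assms]) simp

text \<open>Left of the threshold, \<open>G\<close> is at least its positive value there and
  \<open>g\<close> is at most 1, so enlarging the constant suffices.\<close>

lemma eventually_bound_imp_bound:
  fixes g G :: "real \<Rightarrow> real"
  assumes "\<And>x. g x \<le> 1" "\<And>x. 0 < G x" "\<And>x y. x \<le> y \<Longrightarrow> G y \<le> G x"
    and "\<forall>\<^sub>F x in at_top. g x \<le> c * G x"
  obtains C where "1 \<le> C" "\<And>x. g x \<le> C * G x"
proof -
  obtain x0 where x0: "\<And>x. x0 \<le> x \<Longrightarrow> g x \<le> c * G x"
    using assms(4) by (auto simp: eventually_at_top_linorder)
  define C where "C = max 1 (max c (1 / G x0))"
  have "g x \<le> C * G x" for x
  proof (cases "x0 \<le> x")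
    case True
    have "g x \<le> c * G x" by (rule x0[OF True])
    also have "\<dots> \<le> C * G x" using assms(2)[of x] by (intro mult_right_mono) (auto simp: C_def)
    finally show ?thesis .
  next
    case False
    have "g x \<le> 1 / G x0 * G x0" using assms(1)[of x] assms(2)[of x0] by simp
    also have "\<dots> \<le> C * G x" using assms(2)[of x0] assms(3)[of x x0] False
      by (intro mult_mono) (auto simp: C_def)
    finally show ?thesis .
  qed
  then show ?thesis by (intro that[of C]) (auto simp: C_def)
qed

text \<open>The slack is additive above and multiplicative below. In this form the statements also
  cover \<open>d = 0\<close>, where the lower bound reduces to nonnegativity.\<close>

lemma tail_simD:
  assumes "tail_sim f d g" "\<And>x. 0 < g x" "0 \<le> d" "\<And>x. 0 \<le> f x" "0 < e"
  shows "\<forall>\<^sub>F x in at_top. f x \<le> (d + e) * g x" and "\<forall>\<^sub>F x in at_top. (1 - e) * d * g x \<le> f x"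
proof -
  have "(\<forall>\<^sub>F x in at_top. f x \<le> (d + e) * g x) \<and> (\<forall>\<^sub>F x in at_top. (1 - e) * d * g x \<le> f x)"
  proof (cases "d = 0")
    case True
    then have "f \<in> o[at_top](g)" using assms(1) by (simp add: tail_sim_def)
    then have "\<forall>\<^sub>F x in at_top. norm (f x) \<le> e * norm (g x)" using assms(5) by (rule landau_o.smallD)
    then show ?thesis using True assms(2,4) by (auto elim!: eventually_mono simp: abs_of_pos)
  next
    case False
    then have lim: "((\<lambda>x. f x / g x) \<longlongrightarrow> d) at_top" using assms(1) by (simp add: tail_sim_def)
    have "\<forall>\<^sub>F x in at_top. f x / g x < d + e" using assms(5) by (intro order_tendstoD(2)[OF lim]) auto
    moreover have "\<forall>\<^sub>F x in at_top. (1 - e) * d < f x / g x"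
      using assms(3,5) False by (intro order_tendstoD(1)[OF lim]) auto
    ultimately have "\<forall>\<^sub>F x in at_top. f x / g x < d + e \<and> (1 - e) * d < f x / g x"
      by (rule eventually_conj)
    then show ?thesis
      by (auto elim!: eventually_mono simp: pos_less_divide_eq pos_divide_less_eq assms(2))
  qed
  then show "\<forall>\<^sub>F x in at_top. f x \<le> (d + e) * g x" and "\<forall>\<^sub>F x in at_top. (1 - e) * d * g x \<le> f x"
    by auto
qed

locale heavy_tandem = tandem M s1 s2 t b1 b2 a + subexp_integrated_tail F
  for M :: "'a measure" and s1 s2 t b1 b2 a F +
  fixes d1 d2 :: real
  assumes indep12: "distr M (borel \<Otimes>\<^sub>M borel) (\<lambda>p. (s1 p, s2 p)) = distr M borel s1 \<Otimes>\<^sub>M distr M borel s2"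
    and indep_t: "distr M ((borel \<Otimes>\<^sub>M borel) \<Otimes>\<^sub>M borel) (\<lambda>p. ((s1 p, s2 p), t p)) =
       distr M (borel \<Otimes>\<^sub>M borel) (\<lambda>p. (s1 p, s2 p)) \<Otimes>\<^sub>M distr M borel t"
    and d_nonneg: "0 \<le> d1" "0 \<le> d2"
    and tail1: "tail_sim (\<lambda>x. measure M {p \<in> space M. x < s1 p}) d1 (\<lambda>x. 1 - F x)"
    and tail2: "tail_sim (\<lambda>x. measure M {p \<in> space M. x < s2 p}) d2 (\<lambda>x. 1 - F x)"
begin

section \<open>The service times of one customer\<close>

definition q1 :: "real \<Rightarrow> real" where "q1 x = measure M {p \<in> space M. x < s1 p}"
definition q2 :: "real \<Rightarrow> real" where "q2 x = measure M {p \<in> space M. x < s2 p}"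
definition q12 :: "real \<Rightarrow> real" where "q12 x = measure M {p \<in> space M. x < s1 p + s2 p}"

lemma q_upper:
  assumes "0 < e"
  shows "\<forall>\<^sub>F x in at_top. q1 x \<le> (d1 + e) * tl x" "\<forall>\<^sub>F x in at_top. q2 x \<le> (d2 + e) * tl x"
  using tail_simD(1)[OF tail1 tl_pos d_nonneg(1) _ assms] tail_simD(1)[OF tail2 tl_pos d_nonneg(2) _ assms]
  by (auto simp: q1_def q2_def)

lemma q_lower:
  assumes "0 < e"
  shows "\<forall>\<^sub>F x in at_top. (1 - e) * d1 * tl x \<le> q1 x" "\<forall>\<^sub>F x in at_top. (1 - e) * d2 * tl x \<le> q2 x"
  using tail_simD(2)[OF tail1 tl_pos d_nonneg(1) _ assms] tail_simD(2)[OF tail2 tl_pos d_nonneg(2) _ assms]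
  by (auto simp: q1_def q2_def)

lemma tl_shift:
  assumes "0 \<le> B" "0 < e"
  shows "\<forall>\<^sub>F x in at_top. tl (x - B) \<le> (1 + e) * tl x"
proof -
  have "\<forall>\<^sub>F x in at_top. tl (x - B) / tl x < 1 + e"
    using assms by (intro order_tendstoD(2)[OF subexponential_long_tailed[OF subexp]]) auto
  then show ?thesis by (rule eventually_mono) (use tl_pos in \<open>simp add: pos_divide_less_eq\<close>)
qed

text \<open>Two independent service times are both large only with negligible probability, so the
  tail coefficients of their sum add up.\<close>

lemma q12_upper:
  assumes "0 < e"
  shows "\<forall>\<^sub>F x in at_top. q12 x \<le> (d1 + d2 + e) * tl x"
proof -
  \<comment> \<open>The errors below add up to \<open>g * (d1 + d2) + 3 * g + 2 * (g * g)\<close>,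
    which is at most \<open>g * (d1 + d2 + 5)\<close> for \<open>g\<close> at most 1.\<close>
  define g where "g = min 1 (e / (d1 + d2 + 5))"
  have "g \<le> e / (d1 + d2 + 5)" by (simp add: g_def)
  then have g: "0 < g" "g \<le> 1" "g * (d1 + d2 + 5) \<le> e"
    using d_nonneg assms pos_le_divide_eq[of "d1 + d2 + 5" g e] by (auto simp: g_def)
  let ?P = "distr M borel s1" and ?Q = "distr M borel s2"
  have P: "prob_space ?P" and Q: "prob_space ?Q" by (auto intro!: M.prob_space_distr)
  have mP: "measure ?P {x \<in> space ?P. x \<in> space ?P \<and> u < x} = q1 u" for u
    by (subst measure_distr) (auto simp: q1_def intro!: arg_cong[where f="measure M"])
  have mQ: "measure ?Q {x \<in> space ?Q. u < x} = q2 u" for u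
    by (subst measure_distr) (auto simp: q2_def intro!: arg_cong[where f="measure M"])
  obtain C where C: "1 \<le> C" "\<And>x. q1 x \<le> C * tl x"
    using eventually_bound_imp_bound[where g=q1, OF _ tl_pos tl_antimono q_upper(1)[of 1]] by (auto simp: q1_def)
  obtain K where K: "1 \<le> K" "\<And>x. q2 x \<le> K * tl x"
    using eventually_bound_imp_bound[where g=q2, OF _ tl_pos tl_antimono q_upper(2)[of 1]] by (auto simp: q2_def)
  obtain B x0 where B: "0 \<le> B" and both: "\<And>x. x0 \<le> x \<Longrightarrow> measure (interval_measure F \<Otimes>\<^sub>M interval_measure F)
       {z. B < fst z \<and> B < snd z \<and> x < fst z + snd z} \<le> (g / (C * K)) * (1 - F x)"
    using subexponential_both_large[OF subexp, of "g / (C * K)"] g C K by auto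
  have main: "q12 x \<le> q2 (x - B) + q1 (x - B) + g * tl x" if "x0 \<le> x" for x
  proof -
    have "q12 x = measure (distr M (borel \<Otimes>\<^sub>M borel) (\<lambda>p. (s1 p, s2 p))) {z. x < fst z + snd z}"
      using pair_sum_sets(1)[of x] by (subst measure_distr) (auto simp: q12_def intro!: arg_cong[where f="measure M"])
    also have "\<dots> = measure (?P \<Otimes>\<^sub>M ?Q) {z \<in> space (?P \<Otimes>\<^sub>M ?Q). fst z \<in> space ?P \<and> x < fst z + snd z}"
      unfolding indep12 by (rule arg_cong[where f="measure _"]) (auto simp: space_pair_measure)
    also have "\<dots> \<le> measure ?P (space ?P) * measure ?Q {x' \<in> space ?Q. x - B < x'}
        + measure ?P {x' \<in> space ?P. x' \<in> space ?P \<and> x - B < x'} + C * K * (g / (C * K)) * (1 - F x)"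
      by (rule sum_tail_bound[OF df B both[OF that] P Q]) (use C K in \<open>auto simp: mP[simplified] mQ[simplified]\<close>)
    also have "\<dots> = q2 (x - B) + q1 (x - B) + g * tl x"
      using C K by (simp only: mP mQ prob_space.prob_space[OF P]) auto
    finally show ?thesis .
  qed
  show ?thesis
    using eventually_ge_at_top[of x0] eventually_at_top_shift[OF q_upper(1)[OF g(1)], of B]
      eventually_at_top_shift[OF q_upper(2)[OF g(1)], of B] tl_shift[OF B g(1)]
  proof eventually_elim
    case (elim x)
    have "q12 x \<le> (d1 + d2 + 2 * g) * tl (x - B) + g * tl x"
      using main[OF elim(1)] elim(2,3) by (simp add: algebra_simps)
    also have "\<dots> \<le> (d1 + d2 + 2 * g) * ((1 + g) * tl x) + g * tl x"
      using d_nonneg g elim(4) by (intro add_right_mono mult_left_mono) auto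
    also have "\<dots> = ((d1 + d2) + (g * (d1 + d2) + 3 * g + 2 * (g * g))) * tl x" by (simp add: algebra_simps)
    also have "\<dots> \<le> (d1 + d2 + e) * tl x"
    proof (intro mult_right_mono)
      have "g * g \<le> g * 1" using g by (intro mult_left_mono) auto
      then have "g * (d1 + d2) + 3 * g + 2 * (g * g) \<le> g * (d1 + d2 + 5)" by (simp add: algebra_simps)
      with g(3) show "(d1 + d2) + (g * (d1 + d2) + 3 * g + 2 * (g * g)) \<le> d1 + d2 + e" by linarith
    qed (rule tl_nonneg)
    finally show ?case .
  qed
qed

text \<open>The event that only the sum exceeds \<open>z\<close> has probability
  \<open>q12 z - q1 z\<close>, as service times are nonnegative. The subtraction keeps
  \<open>d1\<close> from being counted on both lines: the difference is governed by
  \<open>d2\<close> alone.\<close>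

lemma jump_measure:
  assumes "y \<le> z"
  shows "measure M {p \<in> space M. y < s1 p \<or> z < s1 p + s2 p} \<le> q1 y + (q12 z - q1 z)"
proof -
  let ?L = "{p \<in> space M. z < s1 p + s2 p}" and ?L1 = "{p \<in> space M. z < s1 p}"
  have "measure M {p \<in> space M. y < s1 p \<or> z < s1 p + s2 p} \<le> measure M ({p \<in> space M. y < s1 p} \<union> (?L - ?L1))"
    using assms by (intro M.finite_measure_mono) auto
  also have "\<dots> \<le> q1 y + measure M (?L - ?L1)"
    unfolding q1_def by (intro measure_Un_le) auto
  also have "measure M (?L - ?L1) = measure M ?L - measure M ?L1"
    using add_increasing2[OF s2_nonneg] by (intro M.finite_measure_Diff) (auto intro: less_le_trans)
  finally show ?thesis by (simp add: q12_def q1_def)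
qed

section \<open>The overshoot and the upper bound\<close>

text \<open>The limiting constant with errors. The numerator \<open>d2 + e + e * d1\<close> is
  \<open>(d1 + d2 + e) - (1 - e) * d1\<close>, the bound for \<open>q12 - q1\<close>; the factor
  \<open>1 + e\<close> comes from a shift of the argument.\<close>

definition phi :: "real \<Rightarrow> real" where
  "phi e = ((d1 + e) / (a - max b1 b2 - e) + (d2 + e + e * d1) / (a - b2 - e)) * (1 + e)"

lemma measure_coord: "B \<in> sets M \<Longrightarrow> measure S {\<omega> \<in> space S. \<omega> n \<in> B} = measure M B"
  using measure_distr[of "\<lambda>\<omega>. \<omega> n" S M B]
  by (simp add: distr_coord vimage_def Int_def conj_commute)

text \<open>At the customer before the crossing both scores are below their lines, so the crossing
  customer made a jump. A union bound over its position, followed by the Riemann sums along the two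
  slopes, gives the two terms of \<open>phi\<close>.\<close>

lemma overshoot_tail:
  assumes e: "0 < e" "e < a - max b1 b2" and R: "0 \<le> R"
  shows "\<forall>\<^sub>F y in at_top. measure S {\<omega> \<in> space S. \<omega> \<in> D e R \<and> y < \<eta> e R \<omega>} \<le> phi e * it y"
proof -
  define al where "al = a - max b1 b2 - e"
  define al2 where "al2 = a - b2 - e"
  have al: "0 < al" "al \<le> al2" using e by (auto simp: al_def al2_def)
  define J where "J y n = {p \<in> space M. y - R + real n * al < s1 p \<or> y - R + real n * al2 < s1 p + s2 p}" for y n
  have J: "J y n \<in> sets M" for y n unfolding J_def by measurable
  have incl: "{\<omega> \<in> space S. \<omega> \<in> D e R \<and> y < \<eta> e R \<omega>} \<subseteq> (\<Union>n. {\<omega> \<in> space S. \<omega> n \<in> J y n})" for y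
  proof safe
    fix \<omega> assume \<omega>: "\<omega> \<in> space S" "\<omega> \<in> D e R" "y < \<eta> e R \<omega>"
    define n where "n = (LEAST n. \<not> ok e R n \<omega>)"
    from \<omega>(2) obtain k where "\<not> ok e R k \<omega>" by (auto simp: D_def)
    then have n: "\<not> ok e R n \<omega>" unfolding n_def by (rule LeastI)
    moreover have "ok e R 0 \<omega>" using R by (simp add: ok_def A_def)
    ultimately obtain m where m: "n = Suc m" by (cases n) auto
    then have "ok e R m \<omega>" using not_less_Least[of m "\<lambda>n. \<not> ok e R n \<omega>"] by (simp add: n_def)
    moreover have "y < V (Suc m) \<omega>" using \<omega>(3) m by (simp add: \<eta>_def n_def)
    ultimately have "\<omega> m \<in> J y m" using jump[of e R m \<omega> y] \<omega>(1)
      by (auto simp: J_def al_def al2_def space_PiM PiE_iff)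
    then show "\<omega> \<in> (\<Union>n. {\<omega> \<in> space S. \<omega> n \<in> J y n})" using \<omega> by auto
  qed
  have bound: "measure S {\<omega> \<in> space S. \<omega> \<in> D e R \<and> y < \<eta> e R \<omega>} \<le> c"
    if "\<And>N. (\<Sum>n<N. measure M (J y n)) \<le> c" for y c
  proof -
    have s: "summable (\<lambda>n. measure M (J y n))"
      by (rule summableI_nonneg_bounded[of _ c]) (use that in auto)
    have "measure S {\<omega> \<in> space S. \<omega> \<in> D e R \<and> y < \<eta> e R \<omega>} \<le> measure S (\<Union>n. {\<omega> \<in> space S. \<omega> n \<in> J y n})"
      using incl J by (intro P.finite_measure_mono) auto
    also have "\<dots> \<le> (\<Sum>n. measure S {\<omega> \<in> space S. \<omega> n \<in> J y n})"
      using J s by (intro P.finite_measure_subadditive_countably) (auto simp: measure_coord)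
    also have "\<dots> = (\<Sum>n. measure M (J y n))" using J by (simp add: measure_coord)
    also have "\<dots> \<le> c" by (rule suminf_le_const[OF s that])
    finally show ?thesis .
  qed
  have "\<forall>\<^sub>F u in at_top. q1 u \<le> (d1 + e) * tl u \<and> q12 u - q1 u \<le> (d2 + e + e * d1) * tl u"
    using q_upper(1)[OF e(1)] q12_upper[OF e(1)] q_lower(1)[OF e(1)]
    by eventually_elim (simp add: algebra_simps)
  then obtain u0 where u0: "\<And>u. u0 \<le> u \<Longrightarrow> q1 u \<le> (d1 + e) * tl u"
    "\<And>u. u0 \<le> u \<Longrightarrow> q12 u - q1 u \<le> (d2 + e + e * d1) * tl u"
    by (auto simp: eventually_at_top_linorder)
  \<comment> \<open>Besides \<open>R\<close>, one grid step is given away, so that the sums can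
    start at \<open>Suc n\<close>; \<open>al2\<close> is the larger of the two steps.\<close>
  define B where "B = R + al2"
  show ?thesis
    using eventually_ge_at_top[of "u0 + R"] eventually_ge_at_top[of B]
      eventually_at_top_shift[OF it_eq_H, of B] it_shift(1)[OF e(1), of B]
  proof eventually_elim
    case (elim y)
    have H: "(\<Sum>n<N. tl (y - R + real n * s)) \<le> (1 + e) * it y / s" if s: "0 < s" "s \<le> al2" for N s
    proof -
      have "(\<Sum>n<N. tl (y - R + real n * s)) \<le> (\<Sum>n<N. tl (y - B + real (Suc n) * s))"
        using s by (intro sum_mono tl_antimono) (simp add: B_def algebra_simps)
      also have "\<dots> \<le> H (y - B) / s" using elim(2) s by (intro sum_tl_upper) auto
      also have "\<dots> \<le> (1 + e) * it y / s" using elim(3,4) s by (intro divide_right_mono) auto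
      finally show ?thesis .
    qed
    show ?case
    proof (rule bound)
      fix N
      have "(\<Sum>n<N. measure M (J y n)) \<le> (\<Sum>n<N. (d1 + e) * tl (y - R + real n * al) + (d2 + e + e * d1) * tl (y - R + real n * al2))"
      proof (rule sum_mono)
        fix n
        have "measure M (J y n) \<le> q1 (y - R + real n * al) + (q12 (y - R + real n * al2) - q1 (y - R + real n * al2))"
          unfolding J_def using al by (intro jump_measure) (auto intro: mult_left_mono)
        also have "\<dots> \<le> (d1 + e) * tl (y - R + real n * al) + (d2 + e + e * d1) * tl (y - R + real n * al2)"
          using al elim(1) by (intro add_mono u0) (auto intro!: add_increasing2)
        finally show "measure M (J y n) \<le> (d1 + e) * tl (y - R + real n * al) + (d2 + e + e * d1) * tl (y - R + real n * al2)" .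
      qed
      also have "\<dots> = (d1 + e) * (\<Sum>n<N. tl (y - R + real n * al)) + (d2 + e + e * d1) * (\<Sum>n<N. tl (y - R + real n * al2))"
        by (simp only: sum.distrib sum_distrib_left)
      also have "\<dots> \<le> (d1 + e) * ((1 + e) * it y / al) + (d2 + e + e * d1) * ((1 + e) * it y / al2)"
        using al d_nonneg e by (intro add_mono mult_left_mono H) auto
      also have "\<dots> = ((d1 + e) / al + (d2 + e + e * d1) / al2) * ((1 + e) * it y)"
        by (simp only: distrib_right times_divide_eq_left times_divide_eq_right)
      also have "\<dots> = phi e * it y" by (simp add: phi_def al_def al2_def mult.assoc)
      finally show "(\<Sum>n<N. measure M (J y n)) \<le> phi e * it y" .
    qed
  qed
qed

lemma overshoot_bound:
  assumes e: "0 < e" "e < a - max b1 b2" and R: "0 \<le> R"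
  obtains C where "1 \<le> C" "\<And>y. measure S {\<omega> \<in> space S. \<omega> \<in> D e R \<and> y < \<eta> e R \<omega>} \<le> C * it y"
  using eventually_bound_imp_bound[OF _ it_pos it_antimono overshoot_tail[OF assms]] by auto

text \<open>Provides the a priori domination of \<open>W N\<close> that every later use of
  \<open>sum_tail_bound\<close> requires. The constant reproduces itself in the induction over
  \<open>N\<close>: the three terms contribute \<open>K / 4\<close>, at most \<open>K / 2\<close>
  and \<open>K / 4\<close>, where the factor 2 of \<open>it (x - B)\<close> against
  \<open>it x\<close> is included.\<close>

lemma crude_bound:
  assumes e: "0 < e" "e < a - max b1 b2" and R: "0 \<le> R" and small: "measure S (D e R) \<le> 1 / 8"
  obtains K where "1 \<le> K" "\<And>N x. measure S {\<omega> \<in> space S. x < W N \<omega>} \<le> K * it x"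
proof -
  obtain C where C: "1 \<le> C" "\<And>y. measure S {\<omega> \<in> space S. \<omega> \<in> D e R \<and> y < \<eta> e R \<omega>} \<le> C * it y"
    using overshoot_bound[OF e R] by blast
  obtain B x0 where B: "0 \<le> B" and both: "\<And>x. x0 \<le> x \<Longrightarrow>
      measure (interval_measure (integrated_tail F) \<Otimes>\<^sub>M interval_measure (integrated_tail F))
       {z. B < fst z \<and> B < snd z \<and> x < fst z + snd z} \<le> (1 / (4 * C)) * it x"
    using subexponential_both_large[OF subexp_it, of "1 / (4 * C)"] C by auto
  obtain x1 where x1: "\<And>x. x1 \<le> x \<Longrightarrow> it (x - B) \<le> (1 + 1) * it x"
    using it_shift(1)[of 1 B] by (auto simp: eventually_at_top_linorder)
  define x2 where "x2 = max (max x0 x1) (max R 0)"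
  \<comment> \<open>\<open>4 * C\<close> lets the overshoot term be absorbed, and
    \<open>1 / it x2\<close> covers the arguments below \<open>x2\<close>, where the bound exceeds
    1.\<close>
  define K where "K = max (4 * C) (1 / it x2)"
  have K: "1 \<le> K" "4 * C \<le> K" "1 / it x2 \<le> K" using C by (auto simp: K_def)
  have low: "measure S {\<omega> \<in> space S. x < W N \<omega>} \<le> K * it x" if "x < x2" for x N
  proof -
    have "measure S {\<omega> \<in> space S. x < W N \<omega>} \<le> 1 / it x2 * it x2" using it_pos[of x2] by simp
    also have "\<dots> \<le> K * it x" using it_pos[of x2] that it_antimono[of x x2] K
      by (intro mult_mono) auto
    finally show ?thesis .
  qed
  have "measure S {\<omega> \<in> space S. x < W N \<omega>} \<le> K * it x" for N x
  proof (induction N arbitrary: x)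
    case 0
    show ?case
    proof (cases "x < x2")
      case False
      then have "{\<omega> \<in> space S. x < W 0 \<omega>} = {}" by (auto simp: W_def x2_def)
      then have "measure S {\<omega> \<in> space S. x < W 0 \<omega>} = 0" by (simp only: measure_empty)
      then show ?thesis using K it_pos[of x] by simp
    qed (rule low)
  next
    case (Suc N)
    show ?case
    proof (cases "x < x2")
      case False
      then have x: "x0 \<le> x" "x1 \<le> x" "R \<le> x" by (auto simp: x2_def)
      have "measure S {\<omega> \<in> space S. x < W (Suc N) \<omega>} \<le>
        measure (S \<Otimes>\<^sub>M S) {z \<in> space (S \<Otimes>\<^sub>M S). fst z \<in> D e R \<and> x < \<eta> e R (fst z) + W N (snd z)}"
        using e R x by (intro restart_tail) auto
      also have "\<dots> \<le> measure S (D e R) * measure S {w \<in> space S. x - B < W N w}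
          + measure S {p \<in> space S. p \<in> D e R \<and> x - B < \<eta> e R p} + C * K * (1 / (4 * C)) * it x"
        by (rule sum_tail_bound[OF df_it B both[OF x(1)] P.prob_space_axioms P.prob_space_axioms])
           (use C K Suc in auto)
      also have "\<dots> \<le> 1 / 8 * (K * it (x - B)) + C * it (x - B) + K / 4 * it x"
        using C K small Suc[of "x - B"] less_imp_le[OF it_pos[of x]] by (intro add_mono mult_mono) auto
      also have "\<dots> = (K / 8 + C) * it (x - B) + K / 4 * it x"
        by (simp only: distrib_right times_divide_eq_left mult_1_left)
      also have "\<dots> \<le> (K / 8 + K / 4) * ((1 + 1) * it x) + K / 4 * it x"
        using C K x1[OF x(2)] it_pos[of "x - B"] by (intro add_right_mono mult_mono) auto
      also have "\<dots> = K * it x" by (simp add: field_simps)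
      finally show ?thesis .
    qed (rule low)
  qed
  with K(1) show ?thesis by (rule that)
qed

definition g :: "real \<Rightarrow> real" where "g x = measure S {\<omega> \<in> space S. \<exists>k. x < V k \<omega>}"

lemma W_le_g: "measure S {\<omega> \<in> space S. x < W N \<omega>} \<le> g x"
  unfolding g_def by (intro P.finite_measure_mono) (auto simp: W_gt)

lemma measure_le_W:
  assumes "\<And>N. measure S {\<omega> \<in> space S. \<exists>k\<le>N. Q k \<omega>} \<le> c" and "\<And>k. Measurable.pred S (Q k)"
  shows "measure S {\<omega> \<in> space S. \<exists>k::nat. Q k \<omega>} \<le> c"
proof -
  note [measurable] = assms(2)
  have "(\<lambda>N. measure S {\<omega> \<in> space S. \<exists>k\<le>N. Q k \<omega>}) \<longlonglongrightarrow> measure S (\<Union>N. {\<omega> \<in> space S. \<exists>k\<le>N. Q k \<omega>})"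
    by (intro P.finite_Lim_measure_incseq) (auto simp: incseq_def intro: order_trans)
  also have "(\<Union>N. {\<omega> \<in> space S. \<exists>k\<le>N. Q k \<omega>}) = {\<omega> \<in> space S. \<exists>k. Q k \<omega>}" by auto
  finally have lim: "(\<lambda>N. measure S {\<omega> \<in> space S. \<exists>k\<le>N. Q k \<omega>}) \<longlonglongrightarrow> measure S {\<omega> \<in> space S. \<exists>k. Q k \<omega>}" .
  show ?thesis by (rule LIMSEQ_le_const2[OF lim]) (use assms(1) in auto)
qed

lemma g_le: "(\<And>N. measure S {\<omega> \<in> space S. x < W N \<omega>} \<le> c) \<Longrightarrow> g x \<le> c"
  unfolding g_def by (rule measure_le_W) (auto simp: W_gt)

text \<open>The fixed point of the affine map by which the asymptotic bound improves, plus
  \<open>e\<close> for stopping after finitely many rounds.\<close>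

definition psi :: "real \<Rightarrow> real" where
  "psi e = (phi e * (1 + e) + e) / (1 - e * (1 + e)) + e"

text \<open>After a restart only the fraction \<open>e\<close> of the mass is passed on, so every asymptotic bound \<open>K1\<close>
  for the ratio improves to \<open>e (1 + e) K1 + phi e (1 + e) + e\<close>.\<close>

lemma g_upper:
  assumes e: "0 < e" "e < a - max b1 b2" "e \<le> 1 / 8"
  obtains K where "1 \<le> K" "\<And>N x. measure S {\<omega> \<in> space S. x < W N \<omega>} \<le> K * it x"
    "\<forall>\<^sub>F x in at_top. g x \<le> psi e * it x"
proof -
  obtain R where R: "0 \<le> R" "measure S (D e R) < e" using D_small[OF e(1) e(1)] .
  obtain C where C: "1 \<le> C" "\<And>y. measure S {\<omega> \<in> space S. \<omega> \<in> D e R \<and> y < \<eta> e R \<omega>} \<le> C * it y"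
    using overshoot_bound[OF e(1,2) R(1)] by blast
  have "measure S (D e R) \<le> 1 / 8" using R e by simp
  then obtain K where K: "1 \<le> K" "\<And>N x. measure S {\<omega> \<in> space S. x < W N \<omega>} \<le> K * it x"
    using crude_bound[OF e(1,2) R(1)] by blast
  obtain B x0 where B: "0 \<le> B" and both: "\<And>x. x0 \<le> x \<Longrightarrow>
      measure (interval_measure (integrated_tail F) \<Otimes>\<^sub>M interval_measure (integrated_tail F))
       {z. B < fst z \<and> B < snd z \<and> x < fst z + snd z} \<le> (e / (C * K)) * it x"
    using subexponential_both_large[OF subexp_it, of "e / (C * K)"] C K e by auto
  have rec: "g x \<le> e * g (x - B) + measure S {p \<in> space S. p \<in> D e R \<and> x - B < \<eta> e R p} + e * it x"
    if x: "x0 \<le> x" "R \<le> x" for x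
  proof (rule g_le)
    fix N
    have "measure S {\<omega> \<in> space S. x < W N \<omega>} \<le> measure S {\<omega> \<in> space S. x < W (Suc N) \<omega>}"
      by (intro P.finite_measure_mono) (auto simp: W_gt intro: le_SucI)
    also have "\<dots> \<le>
      measure (S \<Otimes>\<^sub>M S) {z \<in> space (S \<Otimes>\<^sub>M S). fst z \<in> D e R \<and> x < \<eta> e R (fst z) + W N (snd z)}"
      using e R x by (intro restart_tail) auto
    also have "\<dots> \<le> measure S (D e R) * measure S {w \<in> space S. x - B < W N w}
        + measure S {p \<in> space S. p \<in> D e R \<and> x - B < \<eta> e R p} + C * K * (e / (C * K)) * it x"
      by (rule sum_tail_bound[OF df_it B both[OF x(1)] P.prob_space_axioms P.prob_space_axioms])
         (use C K in auto)
    also have "\<dots> \<le> e * g (x - B) + measure S {p \<in> space S. p \<in> D e R \<and> x - B < \<eta> e R p} + e * it x"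
      using C K R e W_le_g[of "x - B" N] less_imp_le[OF it_pos[of x]] by (intro add_mono mult_mono) auto
    finally show "measure S {\<omega> \<in> space S. x < W N \<omega>} \<le>
      e * g (x - B) + measure S {p \<in> space S. p \<in> D e R \<and> x - B < \<eta> e R p} + e * it x" .
  qed
  define \<kappa> where "\<kappa> = e * (1 + e)"
  define r where "r = phi e * (1 + e) + e"
  have "e * (1 + e) \<le> 1 / 8 * 2" using e by (intro mult_mono) auto
  then have \<kappa>: "0 < \<kappa>" "\<kappa> < 1" using e by (auto simp: \<kappa>_def)
  have phi0: "0 \<le> phi e" using e d_nonneg by (auto simp: phi_def)
  have r0: "0 \<le> r" using phi0 e by (simp add: r_def)
  have improve: "\<forall>\<^sub>F x in at_top. g x \<le> (\<kappa> * K1 + r) * it x"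
    if K1: "0 \<le> K1" "\<forall>\<^sub>F x in at_top. g x \<le> K1 * it x" for K1
    using eventually_ge_at_top[of x0] eventually_ge_at_top[of R] eventually_at_top_shift[OF K1(2), of B]
      eventually_at_top_shift[OF overshoot_tail[OF e(1,2) R(1)], of B] it_shift(1)[OF e(1), of B]
  proof eventually_elim
    case (elim x)
    have "g x \<le> e * (K1 * it (x - B)) + phi e * it (x - B) + e * it x"
      using rec[OF elim(1,2)] elim(3,4) e by (smt (verit) mult_left_mono)
    also have "\<dots> = (e * K1 + phi e) * it (x - B) + e * it x" by (simp add: algebra_simps)
    also have "\<dots> \<le> (e * K1 + phi e) * ((1 + e) * it x) + e * it x"
      using elim(5) e K1 phi0 by (intro add_right_mono mult_left_mono) auto
    also have "\<dots> = (\<kappa> * K1 + r) * it x" by (simp add: \<kappa>_def r_def algebra_simps)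
    finally show ?case .
  qed
  have iter: "\<forall>\<^sub>F x in at_top. g x \<le> (\<kappa> ^ m * K + r / (1 - \<kappa>)) * it x" for m
  proof (induction m)
    case 0
    have "g x \<le> (\<kappa> ^ 0 * K + r / (1 - \<kappa>)) * it x" for x
    proof (rule g_le)
      fix N
      have "measure S {\<omega> \<in> space S. x < W N \<omega>} \<le> K * it x" by (rule K)
      also have "\<dots> \<le> (\<kappa> ^ 0 * K + r / (1 - \<kappa>)) * it x"
        using r0 \<kappa> it_pos[of x] by (intro mult_right_mono) auto
      finally show "measure S {\<omega> \<in> space S. x < W N \<omega>} \<le> (\<kappa> ^ 0 * K + r / (1 - \<kappa>)) * it x" .
    qed
    then show ?case by simp
  next
    case (Suc m)
    have "\<forall>\<^sub>F x in at_top. g x \<le> (\<kappa> * (\<kappa> ^ m * K + r / (1 - \<kappa>)) + r) * it x"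
      using \<kappa> K r0 by (intro improve Suc add_nonneg_nonneg mult_nonneg_nonneg divide_nonneg_nonneg) auto
    moreover have "\<kappa> * (\<kappa> ^ m * K + r / (1 - \<kappa>)) + r = \<kappa> ^ Suc m * K + r / (1 - \<kappa>)"
      using \<kappa> by (simp add: field_simps)
    ultimately show ?case by simp
  qed
  \<comment> \<open>The threshold for \<open>x\<close> depends on the number of rounds, so a finite
    \<open>m\<close> is fixed instead of passing to the limit.\<close>
  have "(\<lambda>m. \<kappa> ^ m * K) \<longlonglongrightarrow> 0 * K" using \<kappa> by (intro tendsto_intros LIMSEQ_realpow_zero) auto
  then have "\<forall>\<^sub>F m in sequentially. \<kappa> ^ m * K < e" using e by (intro order_tendstoD(2)) auto
  then obtain m where m: "\<kappa> ^ m * K < e" by (auto simp: eventually_sequentially)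
  have "\<forall>\<^sub>F x in at_top. g x \<le> psi e * it x"
    using iter[of m]
  proof eventually_elim
    case (elim x)
    have "(\<kappa> ^ m * K + r / (1 - \<kappa>)) * it x \<le> psi e * it x"
      using m it_pos[of x] by (intro mult_right_mono) (auto simp: psi_def r_def \<kappa>_def)
    with elim show ?case by simp
  qed
  with K show ?thesis by (rule that)
qed

lemma psi_tendsto: "(psi \<longlongrightarrow> d1 / (a - max b1 b2) + d2 / (a - b2)) (at_right 0)"
proof -
  have ne: "a - max b1 b2 - 0 \<noteq> 0" "a - b2 - 0 \<noteq> 0" using stable by auto
  have "(psi \<longlongrightarrow> ((((d1 + 0) / (a - max b1 b2 - 0) + (d2 + 0 + 0 * d1) / (a - b2 - 0)) * (1 + 0)) * (1 + 0) + 0)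
      / (1 - 0 * (1 + 0)) + 0) (at_right 0)"
    unfolding psi_def phi_def using ne by (intro tendsto_intros) auto
  then show ?thesis by simp
qed

section \<open>The correction for customer 0\<close>

text \<open>The dater subtracts the interarrival times of the customers -1, ..., -k, whereas
  \<open>V (Suc k)\<close> subtracts that of customer 0 as well. Adding
  \<open>t (\<omega> 0)\<close> restores the end-to-end sojourn time.\<close>

definition h :: "real \<Rightarrow> real" where
  "h x = measure S {\<omega> \<in> space S. \<exists>k. x < V (Suc k) \<omega> + t (\<omega> 0)}"

text \<open>The tail of \<open>t (\<omega> 0)\<close> is not controlled by the integrated tail, so
  it cannot be treated as a summand. Splitting off customer 0 makes it cancel: what remains is
  \<open>s1 + s2\<close>, whose tail is of the order of that of \<open>F\<close> and hence
  negligible, plus an independent copy of the maximum.\<close>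

lemma h_upper:
  assumes e: "0 < e" "e < a - max b1 b2" "e \<le> 1 / 8"
  shows "\<forall>\<^sub>F x in at_top. h x \<le> (psi e * (1 + e) + 3 * e) * it x"
proof -
  obtain K where K: "1 \<le> K" "\<And>N x. measure S {\<omega> \<in> space S. x < W N \<omega>} \<le> K * it x"
    and gu: "\<forall>\<^sub>F x in at_top. g x \<le> psi e * it x"
    using g_upper[OF e] by blast
  have pos: "0 < e / (d1 + d2 + 1)" using d_nonneg e by (intro divide_pos_pos) auto
  have q12: "\<forall>\<^sub>F x in at_top. q12 x \<le> e * it x"
    using q12_upper[OF zero_less_one] tl_le_it[OF pos]
  proof eventually_elim
    case (elim x)
    have "q12 x \<le> (d1 + d2 + 1) * tl x" using elim(1) .
    also have "\<dots> \<le> (d1 + d2 + 1) * (e / (d1 + d2 + 1) * it x)"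
      using elim(2) d_nonneg e by (intro mult_left_mono) auto
    also have "\<dots> = e * it x" using d_nonneg by simp
    finally show ?case .
  qed
  obtain C where C: "1 \<le> C" "\<And>x. q12 x \<le> C * it x"
    using eventually_bound_imp_bound[OF _ it_pos it_antimono q12] by (auto simp: q12_def)
  obtain B x0 where B: "0 \<le> B" and both: "\<And>x. x0 \<le> x \<Longrightarrow>
      measure (interval_measure (integrated_tail F) \<Otimes>\<^sub>M interval_measure (integrated_tail F))
       {z. B < fst z \<and> B < snd z \<and> x < fst z + snd z} \<le> (e / (C * K)) * it x"
    using subexponential_both_large[OF subexp_it, of "e / (C * K)"] C K e by auto
  have m12: "measure S {\<omega> \<in> space S. \<omega> \<in> space S \<and> u < s1 (\<omega> 0) + s2 (\<omega> 0)} = q12 u" for u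
  proof -
    have "{\<omega> \<in> space S. \<omega> \<in> space S \<and> u < s1 (\<omega> 0) + s2 (\<omega> 0)} =
        {\<omega> \<in> space S. \<omega> 0 \<in> {p \<in> space M. u < s1 p + s2 p}}" by (auto simp: space_PiM PiE_iff)
    also have "measure S \<dots> = q12 u" unfolding q12_def by (rule measure_coord) measurable
    finally show ?thesis .
  qed
  have main: "h x \<le> g (x - B) + q12 (x - B) + e * it x" if x: "x0 \<le> x" for x
    unfolding h_def
  proof (rule measure_le_W)
    fix N
    let ?Y = "{\<omega> \<in> space S. x < (s1 (\<omega> 0) + s2 (\<omega> 0)) + W N (shift_by 1 \<omega>)}"
    have Y: "?Y \<in> sets S" by measurable
    have "measure S {\<omega> \<in> space S. \<exists>k\<le>N. x < V (Suc k) \<omega> + t (\<omega> 0)} \<le> measure S ?Y"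
    proof (rule P.finite_measure_mono)
      show "{\<omega> \<in> space S. \<exists>k\<le>N. x < V (Suc k) \<omega> + t (\<omega> 0)} \<subseteq> ?Y"
      proof safe
        fix \<omega> k assume k: "k \<le> N" "x < V (Suc k) \<omega> + t (\<omega> 0)"
        have "V 1 \<omega> + t (\<omega> 0) = s1 (\<omega> 0) + s2 (\<omega> 0)"
          using s2_nonneg[of "\<omega> 0"] by (simp add: A_def)
        then have "x - (s1 (\<omega> 0) + s2 (\<omega> 0)) < V k (shift_by 1 \<omega>)"
          using V_restart[of 1 k \<omega>] k(2) by simp
        then have "x - (s1 (\<omega> 0) + s2 (\<omega> 0)) < W N (shift_by 1 \<omega>)" using k(1) by (auto simp: W_gt)
        then show "x < (s1 (\<omega> 0) + s2 (\<omega> 0)) + W N (shift_by 1 \<omega>)" by simp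
      qed
    qed (rule Y)
    also have "measure S ?Y = measure (S \<Otimes>\<^sub>M S) {z \<in> space (S \<Otimes>\<^sub>M S). comb_seq 1 (fst z) (snd z) \<in> ?Y}"
      by (rule measure_comb_seq[OF Y])
    also have "{z \<in> space (S \<Otimes>\<^sub>M S). comb_seq 1 (fst z) (snd z) \<in> ?Y} =
        {z \<in> space (S \<Otimes>\<^sub>M S). fst z \<in> space S \<and> x < (s1 (fst z 0) + s2 (fst z 0)) + W N (snd z)}"
    proof -
      have "comb_seq 1 (fst z) (snd z) \<in> space S" "fst z \<in> space S" if "z \<in> space (S \<Otimes>\<^sub>M S)" for z
        using that measurable_space[OF measurable_comb_seq, of z M 1] by (auto simp: case_prod_beta space_pair_measure)
      moreover have "comb_seq 1 \<omega> \<omega>' 0 = \<omega> 0" for \<omega> \<omega>' :: "nat \<Rightarrow> 'a" by (simp add: comb_seq_def)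
      ultimately show ?thesis by (auto simp: shift_by_comb simp del: One_nat_def)
    qed
    also have "measure (S \<Otimes>\<^sub>M S) \<dots> \<le> measure S (space S) * measure S {w \<in> space S. x - B < W N w}
        + measure S {p \<in> space S. p \<in> space S \<and> x - B < s1 (p 0) + s2 (p 0)} + C * K * (e / (C * K)) * it x"
      by (rule sum_tail_bound[OF df_it B both[OF x] P.prob_space_axioms P.prob_space_axioms])
         (use C K in \<open>auto simp: m12[simplified]\<close>)
    also have "\<dots> \<le> g (x - B) + q12 (x - B) + e * it x"
      unfolding m12 using C K W_le_g[of "x - B" N] by (simp add: P.prob_space)
    finally show "measure S {\<omega> \<in> space S. \<exists>k\<le>N. x < V (Suc k) \<omega> + t (\<omega> 0)} \<le> g (x - B) + q12 (x - B) + e * it x" .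
  qed measurable
  have psi0: "0 \<le> psi e"
  proof -
    have "e * (1 + e) \<le> 1 / 8 * 2" using e by (intro mult_mono) auto
    moreover have "0 \<le> phi e" using e d_nonneg by (auto simp: phi_def)
    ultimately show ?thesis using e by (auto simp: psi_def)
  qed
  show ?thesis
    using eventually_ge_at_top[of x0] eventually_at_top_shift[OF gu, of B]
      eventually_at_top_shift[OF q12, of B] it_shift(1)[OF e(1), of B]
  proof eventually_elim
    case (elim x)
    have "h x \<le> (psi e + e) * it (x - B) + e * it x"
      using main[OF elim(1)] elim(2,3) by (simp add: algebra_simps)
    also have "\<dots> \<le> (psi e + e) * ((1 + e) * it x) + e * it x"
      using elim(4) psi0 e by (intro add_right_mono mult_left_mono) auto
    also have "\<dots> = (psi e * (1 + e) + e * (1 + e) + e) * it x" by (simp add: algebra_simps)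
    also have "\<dots> \<le> (psi e * (1 + e) + 3 * e) * it x"
    proof (rule mult_right_mono)
      have "e * e \<le> e * 1" using e by (intro mult_left_mono) auto
      then show "psi e * (1 + e) + e * (1 + e) + e \<le> psi e * (1 + e) + 3 * e" by (simp add: algebra_simps)
    qed (use it_pos[of x] in simp)
    finally show ?case .
  qed
qed

lemma g_le_h: "0 \<le> x \<Longrightarrow> g x \<le> h x"
  unfolding g_def h_def
proof (rule P.finite_measure_mono)
  assume x: "0 \<le> x"
  show "{\<omega> \<in> space S. \<exists>k. x < V k \<omega>} \<subseteq> {\<omega> \<in> space S. \<exists>k. x < V (Suc k) \<omega> + t (\<omega> 0)}"
  proof safe
    fix \<omega> k assume k: "x < V k \<omega>"
    with x obtain j where "k = Suc j" by (cases k) auto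
    with k t_nonneg[of "\<omega> 0"] show "\<exists>k. x < V (Suc k) \<omega> + t (\<omega> 0)"
      by (intro exI[of _ j]) simp
  qed
qed measurable

section \<open>The lower bound\<close>

text \<open>Inclusion and exclusion for the independent service times. The condition on
  \<open>t\<close> ensures that a jump is not eaten up by the interarrival time of the same
  customer.\<close>

lemma jump_and_t:
  "measure M {p \<in> space M. (y < s1 p \<or> z < s2 p) \<and> t p \<le> C} = (q1 y + q2 z - q1 y * q2 z) * measure M {p \<in> space M. t p \<le> C}"
proof -
  let ?P12 = "distr M (borel \<Otimes>\<^sub>M borel) (\<lambda>p. (s1 p, s2 p))" and ?T = "distr M borel t"
  let ?P = "distr M borel s1" and ?Q = "distr M borel s2"
  let ?U = "{y<..} \<times> UNIV \<union> UNIV \<times> {z<..} :: (real \<times> real) set"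
  have U: "?U \<in> sets (borel \<Otimes>\<^sub>M borel)" by (intro sets.Un pair_measureI) auto
  have pr: "prob_space ?P" "prob_space ?Q" "prob_space ?P12" "prob_space ?T" by (auto intro!: M.prob_space_distr)
  have "measure M {p \<in> space M. (y < s1 p \<or> z < s2 p) \<and> t p \<le> C} =
     measure (distr M ((borel \<Otimes>\<^sub>M borel) \<Otimes>\<^sub>M borel) (\<lambda>p. ((s1 p, s2 p), t p))) (?U \<times> {..C})"
    using U by (subst measure_distr) (auto intro!: arg_cong[where f="measure M"])
  also have "\<dots> = measure ?P12 ?U * measure ?T {..C}"
    unfolding indep_t by (rule measure_rect) (use pr U in auto)
  also have "measure ?T {..C} = measure M {p \<in> space M. t p \<le> C}"
    by (subst measure_distr) (auto intro!: arg_cong[where f="measure M"])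
  also have "measure ?P12 ?U = q1 y + q2 z - q1 y * q2 z"
  proof -
    have 12: "measure M {p \<in> space M. y < s1 p \<and> z < s2 p} = q1 y * q2 z"
    proof -
      have "measure M {p \<in> space M. y < s1 p \<and> z < s2 p} = measure ?P12 ({y<..} \<times> {z<..})"
        by (subst measure_distr) (auto intro!: arg_cong[where f="measure M"])
      also have "\<dots> = measure ?P {y<..} * measure ?Q {z<..}"
        unfolding indep12 by (rule measure_rect) (use pr in auto)
      also have "measure ?P {y<..} = q1 y"
        unfolding q1_def by (subst measure_distr) (auto intro!: arg_cong[where f="measure M"])
      also have "measure ?Q {z<..} = q2 z"
        unfolding q2_def by (subst measure_distr) (auto intro!: arg_cong[where f="measure M"])
      finally show ?thesis .
    qed
    have "measure ?P12 ?U = measure M ({p \<in> space M. y < s1 p} \<union> {p \<in> space M. z < s2 p})"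
      using U by (subst measure_distr) (auto intro!: arg_cong[where f="measure M"])
    also have "\<dots> = q1 y + q2 z - measure M ({p \<in> space M. y < s1 p} \<inter> {p \<in> space M. z < s2 p})"
      unfolding q1_def q2_def by (subst measure_Un3) (auto simp: M.fmeasurable_eq_sets)
    also have "{p \<in> space M. y < s1 p} \<inter> {p \<in> space M. z < s2 p} = {p \<in> space M. y < s1 p \<and> z < s2 p}" by auto
    finally show ?thesis by (simp only: 12)
  qed
  finally show ?thesis .
qed

text \<open>The events that the first large service time occurs at customer \<open>n\<close> while everything
  before it follows the law of large numbers are disjoint.\<close>

lemma g_lower:
  assumes e: "0 < e" "e < 1 / 2"
  shows "\<forall>\<^sub>F x in at_top. (1 - 2 * e) * (1 - e) ^ 4 * (d1 / (a - max b1 b2 + e) + d2 / (a - b2 + e)) * it x \<le> g x"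
proof -
  define al where "al = a - max b1 b2 + e"
  define al2 where "al2 = a - b2 + e"
  have al: "0 < al" "al \<le> al2" using stable e by (auto simp: al_def al2_def)
  \<comment> \<open>Both sums bound \<open>V\<close> from below. Whichever station has the larger
    mean provides the line with slope \<open>al\<close>, while a jump at station 2 needs the bound
    on \<open>A\<close> itself.\<close>
  define good where "good C n \<omega> \<longleftrightarrow> - C - real n * al2 \<le> A n \<omega> \<and>
     - C - real n * (a - b1 + e) \<le> (\<Sum>i<n. s1 (\<omega> i) - t (\<omega> i))" for C n \<omega>
  have [measurable]: "Measurable.pred S (good C n)" for C n unfolding good_def by measurable
  \<comment> \<open>Including \<open>C < t (\<omega> 0)\<close> makes the same \<open>C\<close>
    serve as the bound for the interarrival time at the jump.\<close>
  obtain C where C: "0 \<le> C" "measure S {\<omega> \<in> space S. \<exists>n. \<not> good C n \<omega> \<or> C < t (\<omega> 0)} < e"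
  proof (rule small_prob[of "\<lambda>C \<omega>. \<exists>n. \<not> good C n \<omega> \<or> C < t (\<omega> 0)"])
    show "AE \<omega> in S. \<exists>R. \<not> (\<exists>n. \<not> good R n \<omega> \<or> R < t (\<omega> 0))"
      using AE_lower[OF e(1)]
    proof eventually_elim
      case (elim \<omega>)
      then obtain C1 C2 where C: "\<And>n. - C1 - real n * (a - b2 + e) \<le> A n \<omega>"
        "\<And>n. - C2 - real n * (a - b1 + e) \<le> (\<Sum>i<n. s1 (\<omega> i) - t (\<omega> i))" by blast
      define R where "R = max (max C1 C2) (t (\<omega> 0))"
      have "- R \<le> - C1" "- R \<le> - C2" "t (\<omega> 0) \<le> R" by (auto simp: R_def)
      then have "- R - real n * (a - b2 + e) \<le> A n \<omega>"
        "- R - real n * (a - b1 + e) \<le> (\<Sum>i<n. s1 (\<omega> i) - t (\<omega> i))" for n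
        using C[of n] by linarith+
      with \<open>t (\<omega> 0) \<le> R\<close> have "\<not> (\<exists>n. \<not> good R n \<omega> \<or> R < t (\<omega> 0))"
        by (simp add: good_def al2_def not_less)
      then show ?case by blast
    qed
    show "\<exists>n. \<not> good R n \<omega> \<or> R < t (\<omega> 0)" if "R \<le> R'" "\<exists>n. \<not> good R' n \<omega> \<or> R' < t (\<omega> 0)" for R R' \<omega>
    proof -
      have "good R' n \<omega>" if "good R n \<omega>" for n using that \<open>R \<le> R'\<close> by (auto simp: good_def)
      with that show ?thesis by (meson le_less_trans)
    qed
  qed (use e in auto)
  have tC: "1 - e \<le> measure M {p \<in> space M. t p \<le> C}"
  proof -
    have "1 - measure M {p \<in> space M. t p \<le> C} = measure M {p \<in> space M. \<not> t p \<le> C}"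
      by (subst M.prob_neg) auto
    also have "\<dots> = measure S {\<omega> \<in> space S. \<omega> 0 \<in> {p \<in> space M. \<not> t p \<le> C}}"
      by (rule measure_coord[symmetric]) measurable
    also have "\<dots> \<le> measure S {\<omega> \<in> space S. \<exists>n. \<not> good C n \<omega> \<or> C < t (\<omega> 0)}"
      by (rule P.finite_measure_mono) auto
    finally show ?thesis using C(2) by simp
  qed
  \<comment> \<open>One \<open>C\<close> compensates the deviation allowed by \<open>good\<close>,
    the other the interarrival time at the jump.\<close>
  define y where "y x n = x + 2 * C + real n * al" for x n
  define z where "z x n = x + 2 * C + real n * al2" for x n
  define J where "J x n = {p \<in> space M. (y x n < s1 p \<or> z x n < s2 p) \<and> t p \<le> C}" for x n
  have J [measurable]: "J x n \<in> sets M" for x n unfolding J_def by measurable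
  obtain u0 where u0: "\<And>u. u0 \<le> u \<Longrightarrow> (1 - e) * d1 * tl u \<le> q1 u" "\<And>u. u0 \<le> u \<Longrightarrow> (1 - e) * d2 * tl u \<le> q2 u"
    "\<And>u. u0 \<le> u \<Longrightarrow> q1 u \<le> (d1 + e) * tl u" "\<And>u. u0 \<le> u \<Longrightarrow> q2 u \<le> (d2 + e) * tl u"
    "\<And>u. u0 \<le> u \<Longrightarrow> q2 u \<le> e"
  proof -
    have "\<forall>\<^sub>F u in at_top. (d2 + e) * tl u \<le> e"
    proof -
      have "((\<lambda>u. (d2 + e) * tl u) \<longlongrightarrow> (d2 + e) * (1 - 1)) at_top"
        using df by (intro tendsto_intros) (auto simp: df_on_Rplus_def)
      then have "\<forall>\<^sub>F u in at_top. (d2 + e) * tl u < e" using e by (intro order_tendstoD(2)) auto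
      then show ?thesis by (rule eventually_mono) simp
    qed
    with q_lower[OF e(1)] q_upper[OF e(1)]
    have "\<forall>\<^sub>F u in at_top. (1 - e) * d1 * tl u \<le> q1 u \<and> (1 - e) * d2 * tl u \<le> q2 u \<and>
      q1 u \<le> (d1 + e) * tl u \<and> q2 u \<le> (d2 + e) * tl u \<and> q2 u \<le> e"
      by eventually_elim auto
    then show ?thesis using that by (auto simp: eventually_at_top_linorder)
  qed
  \<comment> \<open>\<open>Kc\<close> bounds the jump probability relative to the tail of
    \<open>F\<close>. The condition on \<open>H\<close> that follows keeps the expected number of
    jumps at most \<open>e\<close>, so that earlier jumps can be excluded cheaply.\<close>
  define Kc where "Kc = d1 + d2 + 2 * e"
  have "\<forall>\<^sub>F x in at_top. H (x - (al - 2 * C)) < e * al / Kc"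
    using al e d_nonneg by (intro eventually_at_top_shift order_tendstoD(2)[OF H_tendsto]) (auto simp: Kc_def intro!: divide_pos_pos)
  then show ?thesis
    using eventually_ge_at_top[of "max (max u0 al) 0"] it_shift(2)[OF e(1), of "2 * C"]
      eventually_at_top_shift[OF it_eq_H, of "- 2 * C"]
  proof eventually_elim
    case (elim x)
    have x: "u0 \<le> x" "al \<le> x" "0 \<le> x" using elim(2) by auto
    have yz: "u0 \<le> y x n" "y x n \<le> z x n" for n
      using x C al by (auto simp: y_def z_def intro!: add_increasing2 mult_left_mono)
    have J_eq: "measure M (J x n) = (q1 (y x n) + q2 (z x n) - q1 (y x n) * q2 (z x n)) * measure M {p \<in> space M. t p \<le> C}" for n
      unfolding J_def by (rule jump_and_t)
    have J_up: "measure M (J x n) \<le> Kc * tl (y x n)" for n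
    proof -
      have "measure M (J x n) \<le> measure M ({p \<in> space M. y x n < s1 p} \<union> {p \<in> space M. z x n < s2 p})"
        unfolding J_def by (intro M.finite_measure_mono) auto
      also have "\<dots> \<le> q1 (y x n) + q2 (z x n)" unfolding q1_def q2_def by (intro measure_Un_le) auto
      also have "\<dots> \<le> (d1 + e) * tl (y x n) + (d2 + e) * tl (z x n)"
        using yz(1)[of n] yz(2)[of n] by (intro add_mono u0) auto
      also have "\<dots> \<le> (d1 + e) * tl (y x n) + (d2 + e) * tl (y x n)"
        using tl_antimono[OF yz(2)[of n]] d_nonneg e by (intro add_left_mono mult_left_mono) auto
      finally show ?thesis by (simp add: Kc_def algebra_simps)
    qed
    \<comment> \<open>One factor \<open>1 - e\<close> comes from the tails, one from the product
      \<open>q1 * q2\<close>, where \<open>q2\<close> is at most \<open>e\<close>, and one from the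
      condition on \<open>t\<close>. A fourth is spent on the shift by \<open>2 * C\<close> at the
      end.\<close>
    have J_lo: "(1 - e) ^ 3 * (d1 * tl (y x n) + d2 * tl (z x n)) \<le> measure M (J x n)" for n
    proof -
      have q0: "0 \<le> q1 (y x n)" "0 \<le> q2 (z x n)" by (auto simp: q1_def q2_def)
      have "(1 - e) ^ 2 * (d1 * tl (y x n) + d2 * tl (z x n)) =
        (1 - e) * ((1 - e) * d1 * tl (y x n)) + (1 - e) * ((1 - e) * d2 * tl (z x n))"
        by (simp add: algebra_simps power2_eq_square)
      also have "\<dots> \<le> (1 - e) * q1 (y x n) + (1 - e) * q2 (z x n)"
        using e yz[of n] by (intro add_mono mult_left_mono u0) auto
      also have "\<dots> \<le> (1 - e) * q1 (y x n) + q2 (z x n)"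
        using e q0 by (simp add: mult_left_le_one_le)
      also have "\<dots> \<le> q1 (y x n) + q2 (z x n) - q1 (y x n) * q2 (z x n)"
        using mult_left_mono[OF u0(5)[of "z x n"] q0(1)] yz[of n] by (simp add: algebra_simps)
      finally have le: "(1 - e) ^ 2 * (d1 * tl (y x n) + d2 * tl (z x n)) \<le> q1 (y x n) + q2 (z x n) - q1 (y x n) * q2 (z x n)" .
      have nn: "0 \<le> (1 - e) ^ 2 * (d1 * tl (y x n) + d2 * tl (z x n))"
        using d_nonneg tl_nonneg by (intro mult_nonneg_nonneg add_nonneg_nonneg) auto
      have "((1 - e) ^ 2 * (d1 * tl (y x n) + d2 * tl (z x n))) * (1 - e) \<le> measure M (J x n)"
        unfolding J_eq using le nn tC e by (intro mult_mono) auto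
      then show ?thesis by (simp add: power3_eq_cube power2_eq_square mult_ac)
    qed
    have J_sum: "(\<Sum>n<N. measure M (J x n)) \<le> e" for N
    proof -
      have "(\<Sum>n<N. measure M (J x n)) \<le> (\<Sum>n<N. Kc * tl ((x - (al - 2 * C)) + real (Suc n) * al))"
        using J_up by (intro sum_mono) (simp add: y_def algebra_simps)
      also have "\<dots> \<le> Kc * (H (x - (al - 2 * C)) / al)"
        unfolding sum_distrib_left[symmetric] using x al C d_nonneg e
        by (intro mult_left_mono sum_tl_upper) (auto simp: Kc_def)
      also have "\<dots> \<le> Kc * (e * al / Kc / al)"
        using elim(1) al d_nonneg e by (intro mult_left_mono divide_right_mono) (auto simp: Kc_def)
      also have "\<dots> = e" using al d_nonneg e by (simp add: Kc_def)
      finally show ?thesis .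
    qed
    define Gd where "Gd n = {\<omega> \<in> space S. good C n \<omega> \<and> (\<forall>i<n. \<omega> i \<notin> J x i)}" for n
    have Gd [measurable]: "Gd n \<in> sets S" for n unfolding Gd_def by measurable
    have Gd_lo: "1 - 2 * e \<le> measure S (Gd n)" for n
    proof -
      have "1 - measure S (Gd n) = measure S (space S - Gd n)" by (rule P.prob_compl[symmetric]) (rule Gd)
      also have "\<dots> \<le> measure S ({\<omega> \<in> space S. \<exists>n. \<not> good C n \<omega> \<or> C < t (\<omega> 0)} \<union> (\<Union>i<n. {\<omega> \<in> space S. \<omega> i \<in> J x i}))"
        by (rule P.finite_measure_mono) (auto simp: Gd_def)
      also have "\<dots> \<le> measure S {\<omega> \<in> space S. \<exists>n. \<not> good C n \<omega> \<or> C < t (\<omega> 0)} + measure S (\<Union>i<n. {\<omega> \<in> space S. \<omega> i \<in> J x i})"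
        by (rule measure_Un_le) measurable
      also have "measure S (\<Union>i<n. {\<omega> \<in> space S. \<omega> i \<in> J x i}) \<le> (\<Sum>i<n. measure S {\<omega> \<in> space S. \<omega> i \<in> J x i})"
        by (rule measure_UNION_le) auto
      also have "\<dots> = (\<Sum>i<n. measure M (J x i))" using J by (simp add: measure_coord)
      also have "\<dots> \<le> e" by (rule J_sum)
      finally show ?thesis using C(2) by simp
    qed
    define Q where "Q n = {\<omega> \<in> space S. \<omega> \<in> Gd n \<and> \<omega> n \<in> J x n}" for n
    have Q: "Q n \<in> sets S" for n unfolding Q_def by measurable
    \<comment> \<open>\<open>Gd n\<close> is determined by the coordinates below \<open>n\<close>,
      and hence independent of the jump at coordinate \<open>n\<close>.\<close>
    have Q_eq: "measure S (Q n) = measure S (Gd n) * measure M (J x n)" for n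
    proof -
      have 1: "comb_seq n \<omega> \<omega>' \<in> Gd n \<longleftrightarrow> \<omega> \<in> Gd n" if "\<omega> \<in> space S" "\<omega>' \<in> space S" for \<omega> \<omega>'
      proof -
        have "good C n (comb_seq n \<omega> \<omega>') = good C n \<omega>"
        proof -
          have "(\<Sum>i<n. s1 (comb_seq n \<omega> \<omega>' i) - t (comb_seq n \<omega> \<omega>' i)) = (\<Sum>i<n. s1 (\<omega> i) - t (\<omega> i))"
            by (intro sum.cong) (auto simp: comb_seq_less)
          then show ?thesis unfolding good_def by (simp only: A_comb[OF order_refl])
        qed
        moreover have "comb_seq n \<omega> \<omega>' \<in> space S"
          using that measurable_space[OF measurable_comb_seq, of "(\<omega>, \<omega>')" M n] by (auto simp: space_pair_measure)
        ultimately show ?thesis using that by (auto simp: Gd_def comb_seq_less)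
      qed
      have 2: "comb_seq n \<omega> \<omega>' n = \<omega>' 0" for \<omega> \<omega>' :: "nat \<Rightarrow> 'a" by (simp add: comb_seq_def)
      have 3: "comb_seq n \<omega> \<omega>' \<in> space S" if "\<omega> \<in> space S" "\<omega>' \<in> space S" for \<omega> \<omega>'
        using that measurable_space[OF measurable_comb_seq, of "(\<omega>, \<omega>')" M n] by (auto simp: space_pair_measure)
      have "measure S (Q n) = measure (S \<Otimes>\<^sub>M S) {z \<in> space (S \<Otimes>\<^sub>M S). comb_seq n (fst z) (snd z) \<in> Q n}"
        by (rule measure_comb_seq[OF Q])
      also have "{z \<in> space (S \<Otimes>\<^sub>M S). comb_seq n (fst z) (snd z) \<in> Q n} = Gd n \<times> {\<omega> \<in> space S. \<omega> 0 \<in> J x n}"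
        using sets.sets_into_space[OF Gd[of n]] by (auto simp: Q_def space_pair_measure 1 2 3)
      also have "measure (S \<Otimes>\<^sub>M S) \<dots> = measure S (Gd n) * measure S {\<omega> \<in> space S. \<omega> 0 \<in> J x n}"
        by (rule measure_rect) (auto intro: P.prob_space_axioms)
      also have "measure S {\<omega> \<in> space S. \<omega> 0 \<in> J x n} = measure M (J x n)" by (rule measure_coord[OF J])
      finally show ?thesis .
    qed
    have Q_sub: "Q n \<subseteq> {\<omega> \<in> space S. \<exists>k. x < V k \<omega>}" for n
    proof
      fix \<omega> assume "\<omega> \<in> Q n"
      then have \<omega>: "\<omega> \<in> space S" "good C n \<omega>" "y x n < s1 (\<omega> n) \<or> z x n < s2 (\<omega> n)" "t (\<omega> n) \<le> C"
        by (auto simp: Q_def Gd_def J_def)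
      have A: "- C - real n * al2 \<le> A n \<omega>" and B: "- C - real n * (a - b1 + e) \<le> V n \<omega>"
        using \<omega>(2) station1_le_V[of \<omega> n] by (auto simp: good_def)
      have "x < V (Suc n) \<omega>"
        using \<omega>(3)
      proof
        assume "z x n < s2 (\<omega> n)"
        then show ?thesis using A \<omega>(4) s1_nonneg[of "\<omega> n"] by (simp add: z_def less_max_iff_disj)
      next
        assume y: "y x n < s1 (\<omega> n)"
        have "- C - real n * al \<le> V n \<omega>"
        proof (cases "b1 \<le> b2")
          case True
          then show ?thesis using A A_le_V[of n \<omega>] by (simp add: al_def al2_def)
        next
          case False
          then show ?thesis using B by (simp add: al_def)
        qed
        then show ?thesis using y \<omega>(4) by (simp add: y_def less_max_iff_disj)
      qed
      then show "\<omega> \<in> {\<omega> \<in> space S. \<exists>k. x < V k \<omega>}" using \<omega>(1) by blast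
    qed
    have disj: "disjoint_family Q"
      unfolding disjoint_family_on_def
    proof (intro ballI impI)
      fix m n :: nat assume "m \<noteq> n"
      then show "Q m \<inter> Q n = {}" by (cases m n rule: linorder_cases) (auto simp: Q_def Gd_def)
    qed
    have bound: "(1 - 2 * e) * (1 - e) ^ 3 * (d1 * ((H (x + 2 * C) - H (x + 2 * C + real N * al)) / al)
        + d2 * ((H (x + 2 * C) - H (x + 2 * C + real N * al2)) / al2)) \<le> g x" for N
    proof -
      have "(1 - 2 * e) * (1 - e) ^ 3 * (d1 * ((H (x + 2 * C) - H (x + 2 * C + real N * al)) / al)
        + d2 * ((H (x + 2 * C) - H (x + 2 * C + real N * al2)) / al2)) \<le>
        (1 - 2 * e) * (1 - e) ^ 3 * (d1 * (\<Sum>n<N. tl (y x n)) + d2 * (\<Sum>n<N. tl (z x n)))"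
        unfolding y_def z_def using e x C al d_nonneg
        by (intro mult_left_mono add_mono sum_tl_lower) auto
      also have "\<dots> = (\<Sum>n<N. (1 - 2 * e) * ((1 - e) ^ 3 * (d1 * tl (y x n) + d2 * tl (z x n))))"
        by (simp only: sum.distrib sum_distrib_left distrib_left mult.assoc)
      also have "\<dots> \<le> (\<Sum>n<N. measure S (Q n))"
        unfolding Q_eq using Gd_lo J_lo e d_nonneg tl_nonneg
        by (intro sum_mono mult_mono mult_nonneg_nonneg add_nonneg_nonneg) auto
      also have "\<dots> = measure S (\<Union>n<N. Q n)"
        using Q disj by (intro P.finite_measure_finite_Union[symmetric]) (auto simp: disjoint_family_on_def)
      also have "\<dots> \<le> g x" unfolding g_def using Q_sub by (intro P.finite_measure_mono) auto
      finally show ?thesis .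
    qed
    \<comment> \<open>With more and more customers the subtracted values of \<open>H\<close> vanish
      and the full integrated tail remains.\<close>
    have "(\<lambda>N. (1 - 2 * e) * (1 - e) ^ 3 * (d1 * ((H (x + 2 * C) - H (x + 2 * C + real N * al)) / al)
        + d2 * ((H (x + 2 * C) - H (x + 2 * C + real N * al2)) / al2))) \<longlonglongrightarrow>
      (1 - 2 * e) * (1 - e) ^ 3 * (d1 * ((H (x + 2 * C) - 0) / al) + d2 * ((H (x + 2 * C) - 0) / al2))"
      using al by (intro tendsto_intros H_tendsto_step) auto
    then have "(1 - 2 * e) * (1 - e) ^ 3 * (d1 * ((H (x + 2 * C) - 0) / al) + d2 * ((H (x + 2 * C) - 0) / al2)) \<le> g x"
      by (rule LIMSEQ_le_const2) (use bound in auto)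
    then have le: "(1 - 2 * e) * (1 - e) ^ 3 * (d1 / al + d2 / al2) * H (x + 2 * C) \<le> g x"
      by (simp add: algebra_simps)
    have "(1 - 2 * e) * (1 - e) ^ 4 * (d1 / al + d2 / al2) * it x =
       (1 - 2 * e) * (1 - e) ^ 3 * (d1 / al + d2 / al2) * ((1 - e) * it x)"
      by (simp add: power_Suc numeral_eq_Suc mult_ac)
    also have "\<dots> \<le> (1 - 2 * e) * (1 - e) ^ 3 * (d1 / al + d2 / al2) * H (x + 2 * C)"
      using elim(3,4) e al d_nonneg by (intro mult_left_mono) auto
    also note le
    finally show ?case by (simp add: al_def al2_def)
  qed
qed

section \<open>The limit of the ratio\<close>

text \<open>For each small \<open>e\<close> the ratio is eventually between two bounds that both
  tend to the constant as \<open>e\<close> decreases to 0, so \<open>e\<close> is fixed before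
  \<open>x\<close> grows.\<close>

lemma h_asymp: "((\<lambda>x. h x / it x) \<longlongrightarrow> d1 / (a - max b1 b2) + d2 / (a - b2)) (at_top)"
proof -
  define c where "c = d1 / (a - max b1 b2) + d2 / (a - b2)"
  define lo where "lo e = (1 - 2 * e) * (1 - e) ^ 4 * (d1 / (a - max b1 b2 + e) + d2 / (a - b2 + e))" for e
  define up where "up e = psi e * (1 + e) + 3 * e" for e
  have ne: "a - max b1 b2 + 0 \<noteq> 0" "a - b2 + 0 \<noteq> 0" using stable by auto
  have "(lo \<longlongrightarrow> (1 - 2 * 0) * (1 - 0) ^ 4 * (d1 / (a - max b1 b2 + 0) + d2 / (a - b2 + 0))) (at_right 0)"
    unfolding lo_def using ne by (intro tendsto_intros)
  then have lo: "(lo \<longlongrightarrow> c) (at_right 0)" by (simp add: c_def)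
  have "(up \<longlongrightarrow> c * (1 + 0) + 3 * 0) (at_right 0)"
    unfolding up_def c_def by (intro tendsto_intros psi_tendsto)
  then have up: "(up \<longlongrightarrow> c) (at_right 0)" by simp
  have small: "\<forall>\<^sub>F e in at_right (0::real). 0 < e \<and> e < a - max b1 b2 \<and> e \<le> 1 / 8"
    using eventually_at_right_real[of 0 "min (a - max b1 b2) (1 / 8)"] stable
    by (auto elim!: eventually_mono)
  show ?thesis
    unfolding c_def[symmetric]
  proof (rule order_tendstoI)
    fix r assume "r < c"
    then have "\<forall>\<^sub>F e in at_right 0. r < lo e" by (rule order_tendstoD(1)[OF lo])
    with small have ev: "\<forall>\<^sub>F e in at_right (0::real). 0 < e \<and> e < 1 / 2 \<and> r < lo e"
      by eventually_elim auto
    then obtain e where e: "0 < e" "e < 1 / 2" "r < lo e"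
      using eventually_happens'[OF trivial_limit_at_right_real ev] by blast
    show "\<forall>\<^sub>F x in at_top. r < h x / it x"
      using g_lower[OF e(1,2)] eventually_ge_at_top[of 0]
    proof eventually_elim
      case (elim x)
      have "lo e * it x \<le> h x" using elim g_le_h[of x] by (simp add: lo_def)
      then have "lo e \<le> h x / it x" using it_pos[of x] by (simp add: pos_le_divide_eq)
      with e(3) show ?case by linarith
    qed
  next
    fix r assume "c < r"
    then have "\<forall>\<^sub>F e in at_right 0. up e < r" by (rule order_tendstoD(2)[OF up])
    with small have ev: "\<forall>\<^sub>F e in at_right (0::real). 0 < e \<and> e < a - max b1 b2 \<and> e \<le> 1 / 8 \<and> up e < r"
      by eventually_elim auto
    then obtain e where e: "0 < e" "e < a - max b1 b2" "e \<le> 1 / 8" "up e < r"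
      using eventually_happens'[OF trivial_limit_at_right_real ev] by blast
    show "\<forall>\<^sub>F x in at_top. h x / it x < r"
      using h_upper[OF e(1-3)]
    proof eventually_elim
      case (elim x)
      then have "h x / it x \<le> up e" using it_pos[of x] by (simp add: pos_divide_le_eq up_def)
      with e(4) show ?case by linarith
    qed
  qed
qed

end

section \<open>From the queue to the recursion\<close>

context tandem
begin

text \<open>Unfolding the recursion gives the maximum over the customer \<open>j\<close> at which
  the path switches, which is \<open>- q\<close> in the dater. The second branch of the recursion
  supplies the switch at the last customer.\<close>

lemma V_Suc_gt:
  "x < V (Suc k) \<omega> \<longleftrightarrow>
     (\<exists>j\<le>k. x < (\<Sum>i\<in>{j..k}. s1 (\<omega> i)) + (\<Sum>i\<le>j. s2 (\<omega> i)) - (\<Sum>i\<le>k. t (\<omega> i)))"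
proof (induction k arbitrary: x)
  case 0
  \<comment> \<open>The branch coming from the empty path lacks \<open>s2\<close> and is dominated,
    since \<open>s2\<close> is nonnegative.\<close>
  show ?case using s2_nonneg[of "\<omega> 0"] by (auto simp: A_def)
next
  case (Suc k)
  have "x < V (Suc (Suc k)) \<omega> \<longleftrightarrow> x + t (\<omega> (Suc k)) - s1 (\<omega> (Suc k)) < V (Suc k) \<omega> \<or>
      x + t (\<omega> (Suc k)) < A (Suc k) \<omega> + s2 (\<omega> (Suc k)) + s1 (\<omega> (Suc k))"
    by (subst V.simps) (auto simp: less_max_iff_disj algebra_simps)
  also have "x + t (\<omega> (Suc k)) - s1 (\<omega> (Suc k)) < V (Suc k) \<omega> \<longleftrightarrow>
      (\<exists>j\<le>k. x < (\<Sum>i\<in>{j..Suc k}. s1 (\<omega> i)) + (\<Sum>i\<le>j. s2 (\<omega> i)) - (\<Sum>i\<le>Suc k. t (\<omega> i)))"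
    unfolding Suc by (intro ex_cong1 conj_cong refl) (auto simp: algebra_simps)
  also have "x + t (\<omega> (Suc k)) < A (Suc k) \<omega> + s2 (\<omega> (Suc k)) + s1 (\<omega> (Suc k)) \<longleftrightarrow>
     x < (\<Sum>i\<in>{Suc k..Suc k}. s1 (\<omega> i)) + (\<Sum>i\<le>Suc k. s2 (\<omega> i)) - (\<Sum>i\<le>Suc k. t (\<omega> i))"
    by (auto simp: A_def sum_subtractf lessThan_Suc_atMost algebra_simps)
  finally show ?case unfolding le_Suc_eq[of _ k] by blast
qed

end

text \<open>A finite set of indices is sorted by sequence. Independence of the sequences factors the
  probability over the cylinder sets \<open>C i\<close>, and independence within each sequence
  factors these further.\<close>

lemma (in prob_space) indep_sequences_indep_vars:
  assumes "indep_sequences I X" "\<And>i. i \<in> I \<Longrightarrow> indep_vars (\<lambda>_. borel) (X i) UNIV"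
  shows "indep_vars (\<lambda>_. borel) (\<lambda>(i, n). X i n) (I \<times> UNIV)"
  unfolding indep_vars_def2
proof (intro conjI ballI indep_setsI)
  note seq = assms(1)[unfolded indep_sequences_def]
  have rv: "random_variable borel (X i n)" if "i \<in> I" for i n
    using assms(2)[OF that] by (auto simp: indep_vars_def)
  show "random_variable borel (case j of (i, n) \<Rightarrow> X i n)" if "j \<in> I \<times> UNIV" for j
    using that rv by auto
  show "{(case j of (i, n) \<Rightarrow> X i n) -` A \<inter> space M |A. A \<in> sets borel} \<subseteq> events" if "j \<in> I \<times> UNIV" for j
    using that rv by (auto intro: measurable_sets)
  fix A J assume J: "J \<noteq> {}" "J \<subseteq> I \<times> (UNIV :: int set)" "finite J"
    and A: "\<forall>j\<in>J. A j \<in> {(case j of (i, n) \<Rightarrow> X i n) -` A \<inter> space M |A. A \<in> sets borel}"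
  have "\<forall>j\<in>J. \<exists>B. B \<in> sets borel \<and> A j = X (fst j) (snd j) -` B \<inter> space M"
    using A by (auto simp: case_prod_beta)
  then obtain B where B: "\<And>j. j \<in> J \<Longrightarrow> B j \<in> sets borel"
    "\<And>j. j \<in> J \<Longrightarrow> A j = X (fst j) (snd j) -` B j \<inter> space M" by metis
  define N where "N i = {n. (i, n) \<in> J}" for i
  have JS: "J = Sigma (fst ` J) N" by (force simp: N_def)
  have finN: "finite (N i)" for i
    unfolding N_def by (rule finite_subset[of _ "snd ` J"]) (use J in force)+
  have Ne: "N i \<noteq> {}" if "i \<in> fst ` J" for i using that by (auto simp: N_def)
  define C where "C i = {f \<in> space (PiM UNIV (\<lambda>_. borel)). \<forall>n\<in>N i. f n \<in> B (i, n)}" for i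
  have C: "C i \<in> sets (PiM UNIV (\<lambda>_. borel))" for i
  proof -
    have [measurable]: "B (i, n) \<in> sets borel" if "n \<in> N i" for n using that B(1) by (auto simp: N_def)
    show ?thesis unfolding C_def using finN[of i] by measurable
  qed
  have eqC: "(\<lambda>\<omega> n. X i n \<omega>) -` C i \<inter> space M = (\<Inter>n\<in>N i. A (i, n))" if "i \<in> fst ` J" for i
    using Ne[OF that] B(2) by (auto simp: C_def N_def space_PiM)
  have "(\<Inter>j\<in>J. A j) = (\<Inter>i\<in>fst ` J. \<Inter>n\<in>N i. A (i, n))"
    using J(1) by (force simp: N_def)
  also have "\<dots> = (\<Inter>i\<in>fst ` J. (\<lambda>\<omega> n. X i n \<omega>) -` C i \<inter> space M)"
    using eqC by auto
  also have "prob \<dots> = (\<Prod>i\<in>fst ` J. prob ((\<lambda>\<omega> n. X i n \<omega>) -` C i \<inter> space M))"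
    using J C by (intro indep_varsD[OF seq]) auto
  also have "\<dots> = (\<Prod>i\<in>fst ` J. \<Prod>n\<in>N i. prob (A (i, n)))"
  proof (rule prod.cong[OF refl])
    fix i assume i: "i \<in> fst ` J"
    have "prob (\<Inter>n\<in>N i. X i n -` B (i, n) \<inter> space M) = (\<Prod>n\<in>N i. prob (X i n -` B (i, n) \<inter> space M))"
      using i J finN Ne B(1) by (intro indep_varsD[OF assms(2)]) (auto simp: N_def)
    moreover have "A (i, n) = X i n -` B (i, n) \<inter> space M" if "n \<in> N i" for n
      using that B(2)[of "(i, n)"] by (simp add: N_def)
    ultimately show "prob ((\<lambda>\<omega> n. X i n \<omega>) -` C i \<inter> space M) = (\<Prod>n\<in>N i. prob (A (i, n)))"
      unfolding eqC[OF i] by simp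
  qed
  also have "\<dots> = (\<Prod>j\<in>J. prob (A j))"
  proof -
    have "(\<Prod>i\<in>fst ` J. \<Prod>n\<in>N i. prob (A (i, n))) = (\<Prod>(i, n)\<in>Sigma (fst ` J) N. prob (A (i, n)))"
      using J(3) finN by (intro prod.Sigma) auto
    then show ?thesis by (simp add: JS[symmetric] case_prod_beta)
  qed
  finally show "prob (\<Inter>j\<in>J. A j) = (\<Prod>j\<in>J. prob (A j))" .
qed

lemma sum_neg_interval:
  "(\<Sum>m\<in>{- int k..- int j}. f m) = (\<Sum>i\<in>{j..k}. f (- int i))"
  by (rule sum.reindex_bij_witness[of _ "\<lambda>i. - int i" "\<lambda>m. nat (- m)"]) auto

text \<open>With \<open>p = - k\<close> and \<open>q = - j\<close>, a strict inequality turns both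
  suprema into existence statements, so that finiteness of the supremum is not an issue.\<close>

lemma tandem_dater_gt:
  assumes "\<And>n. \<tau> n = T (n + 1) \<omega> - T n \<omega>"
  shows "ereal x < tandem_dater T \<sigma> \<omega> \<longleftrightarrow>
    (\<exists>k. \<exists>j\<le>k. x < (\<Sum>i\<in>{j..k}. \<sigma> 1 (- int i) \<omega>) + (\<Sum>i\<le>j. \<sigma> 2 (- int i) \<omega>)
       - (\<Sum>i\<in>{1..k}. \<tau> (- int i)))"
proof -
  have T: "T 0 \<omega> - T (- int k) \<omega> = (\<Sum>i\<in>{1..k}. \<tau> (- int i))" for k
  proof (induction k)
    case (Suc k)
    have "\<tau> (- int (Suc k)) = T (- int k) \<omega> - T (- int (Suc k)) \<omega>"
      using assms[of "- int (Suc k)"] by simp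
    with Suc show ?case by simp
  qed simp
  have s2: "(\<Sum>m\<in>{- int j..0}. f m) = (\<Sum>i\<le>j. f (- int i))" for j and f :: "int \<Rightarrow> real"
    using sum_neg_interval[of f j 0] by (simp add: atLeast0AtMost)
  have "ereal x < tandem_dater T \<sigma> \<omega> \<longleftrightarrow> (\<exists>p\<in>{..0}. \<exists>q\<in>{p..0}.
      x < (\<Sum>m=p..q. \<sigma> 1 m \<omega>) + (\<Sum>m=q..0. \<sigma> 2 m \<omega>) - (T 0 \<omega> - T p \<omega>))"
    unfolding tandem_dater_def by (simp add: less_SUP_iff)
  also have "\<dots> \<longleftrightarrow> (\<exists>k. \<exists>j\<le>k. x < (\<Sum>m=- int k..- int j. \<sigma> 1 m \<omega>) + (\<Sum>m=- int j..0. \<sigma> 2 m \<omega>) - (T 0 \<omega> - T (- int k) \<omega>))"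
    (is "?L \<longleftrightarrow> ?R")
  proof
    assume ?L
    then obtain p q where pq: "p \<le> 0" "p \<le> q" "q \<le> 0"
      "x < (\<Sum>m=p..q. \<sigma> 1 m \<omega>) + (\<Sum>m=q..0. \<sigma> 2 m \<omega>) - (T 0 \<omega> - T p \<omega>)" by auto
    then show ?R
      by (intro exI[of _ "nat (- p)"] exI[of _ "nat (- q)"]) auto
  next
    assume ?R
    then obtain k j where "j \<le> k" "x < (\<Sum>m=- int k..- int j. \<sigma> 1 m \<omega>) + (\<Sum>m=- int j..0. \<sigma> 2 m \<omega>) - (T 0 \<omega> - T (- int k) \<omega>)"
      by blast
    then show ?L by (intro bexI[of _ "- int k"] bexI[of _ "- int j"]) auto
  qed
  finally show ?thesis by (simp only: T sum_neg_interval s2)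
qed


section \<open>The joint law of the customers\<close>

lemma (in prob_space) indep_var_distr_pair:
  assumes "indep_var S X T Y" and f: "f \<in> measurable S S'" and g: "g \<in> measurable T T'"
  shows "distr M (S' \<Otimes>\<^sub>M T') (\<lambda>\<omega>. (f (X \<omega>), g (Y \<omega>))) =
    distr M S' (\<lambda>\<omega>. f (X \<omega>)) \<Otimes>\<^sub>M distr M T' (\<lambda>\<omega>. g (Y \<omega>))"
proof -
  have rv: "random_variable S X" "random_variable T Y"
    and eq: "distr M S X \<Otimes>\<^sub>M distr M T Y = distr M (S \<Otimes>\<^sub>M T) (\<lambda>\<omega>. (X \<omega>, Y \<omega>))"
    using assms(1) by (auto simp: indep_var_distribution_eq)
  have 1: "distr (distr M S X) S' f = distr M S' (\<lambda>\<omega>. f (X \<omega>))" "distr (distr M T Y) T' g = distr M T' (\<lambda>\<omega>. g (Y \<omega>))"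
    using rv f g by (simp_all add: distr_distr comp_def)
  interpret Y: prob_space "distr (distr M T Y) T' g"
    unfolding 1 by (rule prob_space_distr[OF measurable_compose[OF rv(2) g]])
  have "distr M S' (\<lambda>\<omega>. f (X \<omega>)) \<Otimes>\<^sub>M distr M T' (\<lambda>\<omega>. g (Y \<omega>)) =
      distr (distr M S X \<Otimes>\<^sub>M distr M T Y) (S' \<Otimes>\<^sub>M T') (\<lambda>(x, y). (f x, g y))"
    unfolding 1[symmetric] by (rule pair_measure_distr) (use f g in \<open>auto intro: Y.sigma_finite_measure_axioms\<close>)
  also have "\<dots> = distr M (S' \<Otimes>\<^sub>M T') (\<lambda>\<omega>. (f (X \<omega>), g (Y \<omega>)))"
    unfolding eq using rv f g by (subst distr_distr) (auto simp: comp_def)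
  finally show ?thesis ..
qed

lemma (in prob_space) iid_nonneg_with_meanD:
  assumes "iid_nonneg_with_mean X m"
  shows "indep_vars (\<lambda>_. borel) X UNIV" "random_variable borel (X n)"
    "distr M borel (X n) = distr M borel (X 0)" "AE \<omega> in M. 0 \<le> X n \<omega>"
    "integrable M (X n)" "expectation (X n) = m"
  using assms unfolding iid_nonneg_with_mean_def by (auto simp: indep_vars_def)

text \<open>One customer is described by a point of \<open>((real \<times> real) \<times> real)\<close>, the two service
  times and the interarrival time, and customer \<open>- n\<close> becomes coordinate \<open>n\<close>. The maxima with 0
  only change the variables on a null set.\<close>

locale tandem_queue = prob_space M for M :: "'w measure" +
  fixes \<tau> :: "int \<Rightarrow> 'w \<Rightarrow> real" and \<sigma> :: "nat \<Rightarrow> int \<Rightarrow> 'w \<Rightarrow> real" and a :: real and b :: "nat \<Rightarrow> real"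
  assumes iid_\<tau>: "iid_nonneg_with_mean \<tau> a"
    and iid_\<sigma>: "\<And>i. i \<in> {1, 2} \<Longrightarrow> iid_nonneg_with_mean (\<sigma> i) (b i)"
    and indep: "indep_sequences {0, 1, 2} (\<lambda>i. if i = 0 then \<tau> else \<sigma> i)"
    and stable: "max (b 1) (b 2) < a"
begin

abbreviation N3 :: "((real \<times> real) \<times> real) measure" where "N3 \<equiv> (borel \<Otimes>\<^sub>M borel) \<Otimes>\<^sub>M borel"

definition X :: "nat \<Rightarrow> 'w \<Rightarrow> (real \<times> real) \<times> real" where
  "X n \<omega> = ((\<sigma> 1 (- int n) \<omega>, \<sigma> 2 (- int n) \<omega>), \<tau> (- int n) \<omega>)"

definition \<mu> :: "((real \<times> real) \<times> real) measure" where "\<mu> = distr M N3 (X 0)"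

definition S1 :: "(real \<times> real) \<times> real \<Rightarrow> real" where "S1 p = max 0 (fst (fst p))"
definition S2 :: "(real \<times> real) \<times> real \<Rightarrow> real" where "S2 p = max 0 (snd (fst p))"
definition T0 :: "(real \<times> real) \<times> real \<Rightarrow> real" where "T0 p = max 0 (snd p)"

lemma rv [measurable]: "\<sigma> 1 n \<in> borel_measurable M" "\<sigma> (Suc 0) n \<in> borel_measurable M" "\<sigma> 2 n \<in> borel_measurable M" "\<tau> n \<in> borel_measurable M"
  using iid_nonneg_with_meanD(2)[OF iid_\<sigma>[of 1], of n] iid_nonneg_with_meanD(2)[OF iid_\<sigma>[of 2], of n]
    iid_nonneg_with_meanD(2)[OF iid_\<tau>, of n] by auto

lemma rv_X [measurable]: "X n \<in> measurable M N3"
  unfolding X_def by (simp add: measurable_Pair)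

lemma sets_\<mu> [measurable_cong]: "sets \<mu> = sets N3"
  by (simp add: \<mu>_def)

lemma meas_S [measurable]: "S1 \<in> borel_measurable N3" "S2 \<in> borel_measurable N3" "T0 \<in> borel_measurable N3"
  unfolding S1_def S2_def T0_def by measurable

lemma indep_all: "indep_vars (\<lambda>_. borel) (\<lambda>(i, n). (if i = 0 then \<tau> else \<sigma> i) n) ({0, 1, 2} \<times> UNIV)"
proof (rule indep_sequences_indep_vars[OF indep])
  fix i :: nat assume "i \<in> {0, 1, 2}"
  then show "indep_vars (\<lambda>_. borel) (if i = 0 then \<tau> else \<sigma> i) UNIV"
    using iid_nonneg_with_meanD(1)[OF iid_\<tau>] iid_nonneg_with_meanD(1)[OF iid_\<sigma>] by auto
qed

lemma indep_X: "indep_vars (\<lambda>_. N3) X UNIV"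
proof -
  \<comment> \<open>Different customers use disjoint blocks of the index set, so the triples inherit
    independence.\<close>
  define K where "K n = {0, 1, 2::nat} \<times> {- int n}" for n
  define Y where "Y n f = ((f (1::nat, - int n), f (2, - int n)), f (0, - int n))" for n and f :: "nat \<times> int \<Rightarrow> real"
  have "indep_vars (\<lambda>n. PiM (K n) (\<lambda>_. borel))
      (\<lambda>n \<omega>. restrict (\<lambda>j. (case j of (i, m) \<Rightarrow> (if i = 0 then \<tau> else \<sigma> i) m) \<omega>) (K n)) (UNIV :: nat set)"
    by (rule indep_vars_restrict[OF indep_all]) (auto simp: K_def disjoint_family_on_def)
  then have "indep_vars (\<lambda>_. N3) (\<lambda>n \<omega>. Y n (restrict (\<lambda>j. (case j of (i, m) \<Rightarrow> (if i = 0 then \<tau> else \<sigma> i) m) \<omega>) (K n))) UNIV"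
  proof (rule indep_vars_compose2)
    fix n :: nat
    have [measurable]: "(\<lambda>f. f (i, - int n)) \<in> borel_measurable (PiM (K n) (\<lambda>_. borel))" if "i \<in> {0, 1, 2}" for i
      using that by (intro measurable_component_singleton) (auto simp: K_def)
    show "Y n \<in> measurable (PiM (K n) (\<lambda>_. borel)) N3"
      unfolding Y_def by (intro measurable_Pair) auto
  qed
  then show ?thesis by (simp add: Y_def K_def X_def[abs_def])
qed

text \<open>The functions \<open>f\<close> and \<open>g\<close> allow for two uses: the identity
  gives the law of a customer, the maximum with 0 the independence of the truncated
  variables.\<close>

lemma distr_services:
  assumes "f \<in> measurable borel S'" "g \<in> measurable borel T'"
  shows "distr M (S' \<Otimes>\<^sub>M T') (\<lambda>\<omega>. (f (\<sigma> 1 n \<omega>), g (\<sigma> 2 n \<omega>))) =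
    distr M S' (\<lambda>\<omega>. f (\<sigma> 1 n \<omega>)) \<Otimes>\<^sub>M distr M T' (\<lambda>\<omega>. g (\<sigma> 2 n \<omega>))"
proof -
  let ?Y = "\<lambda>(i, n). (if i = 0 then \<tau> else \<sigma> i) n"
  have "indep_var (PiM {(1, n)} (\<lambda>_. borel)) (\<lambda>\<omega>. restrict (\<lambda>j. ?Y j \<omega>) {(1, n)})
    (PiM {(2, n)} (\<lambda>_. borel)) (\<lambda>\<omega>. restrict (\<lambda>j. ?Y j \<omega>) {(2, n)})"
    by (rule indep_var_restrict[OF indep_all]) auto
  from indep_var_distr_pair[OF this, of "\<lambda>h. f (h (1, n))" S' "\<lambda>h. g (h (2, n))" T'] assms
  show ?thesis by simp
qed

lemma distr_services_arrival:
  assumes "f \<in> measurable (borel \<Otimes>\<^sub>M borel) S'" "g \<in> measurable borel T'"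
  shows "distr M (S' \<Otimes>\<^sub>M T') (\<lambda>\<omega>. (f (\<sigma> 1 n \<omega>, \<sigma> 2 n \<omega>), g (\<tau> n \<omega>))) =
    distr M S' (\<lambda>\<omega>. f (\<sigma> 1 n \<omega>, \<sigma> 2 n \<omega>)) \<Otimes>\<^sub>M distr M T' (\<lambda>\<omega>. g (\<tau> n \<omega>))"
proof -
  let ?Y = "\<lambda>(i, n). (if i = 0 then \<tau> else \<sigma> i) n"
  have "indep_var (PiM {(1, n), (2, n)} (\<lambda>_. borel)) (\<lambda>\<omega>. restrict (\<lambda>j. ?Y j \<omega>) {(1, n), (2, n)})
    (PiM {(0, n)} (\<lambda>_. borel)) (\<lambda>\<omega>. restrict (\<lambda>j. ?Y j \<omega>) {(0, n)})"
    by (rule indep_var_restrict[OF indep_all]) auto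
  note * = indep_var_distr_pair[OF this, of "\<lambda>h. f (h (1, n), h (2, n))" S' "\<lambda>h. g (h (0, n))" T']
  have "(\<lambda>h. f (h (1, n), h (2, n))) \<in> measurable (PiM {(1::nat, n), (2, n)} (\<lambda>_. borel)) S'"
    by (rule measurable_compose[OF _ assms(1)]) simp
  with * assms(2) show ?thesis by simp
qed

lemma distr_X: "distr M N3 (X n) = \<mu>"
proof -
  have "distr M N3 (X n) = (distr M borel (\<sigma> 1 0) \<Otimes>\<^sub>M distr M borel (\<sigma> 2 0)) \<Otimes>\<^sub>M distr M borel (\<tau> 0)" for n
  proof -
    have "distr M N3 (X n) = distr M (borel \<Otimes>\<^sub>M borel) (\<lambda>\<omega>. (\<sigma> 1 (- int n) \<omega>, \<sigma> 2 (- int n) \<omega>)) \<Otimes>\<^sub>M distr M borel (\<tau> (- int n))"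
      using distr_services_arrival[of "\<lambda>x. x" "borel \<Otimes>\<^sub>M borel" "\<lambda>x. x" borel "- int n"] by (simp add: X_def[abs_def])
    also have "distr M (borel \<Otimes>\<^sub>M borel) (\<lambda>\<omega>. (\<sigma> 1 (- int n) \<omega>, \<sigma> 2 (- int n) \<omega>)) =
       distr M borel (\<sigma> 1 (- int n)) \<Otimes>\<^sub>M distr M borel (\<sigma> 2 (- int n))"
      using distr_services[of "\<lambda>x. x" borel "\<lambda>x. x" borel "- int n"] by simp
    finally show ?thesis
      using iid_nonneg_with_meanD(3)[OF iid_\<sigma>[of 1], of "- int n"] iid_nonneg_with_meanD(3)[OF iid_\<sigma>[of 2], of "- int n"]
        iid_nonneg_with_meanD(3)[OF iid_\<tau>, of "- int n"] by simp
  qed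
  from this[of n] this[of 0] show ?thesis by (simp add: \<mu>_def)
qed

text \<open>Transfers every event about the backward sequence of customers to the product space on
  which the recursion is analysed.\<close>

lemma distr_sequence: "distr M (PiM UNIV (\<lambda>_. \<mu>)) (\<lambda>\<omega> n. X n \<omega>) = PiM UNIV (\<lambda>_. \<mu>)"
proof -
  have "distr M (PiM UNIV (\<lambda>_. N3)) (\<lambda>\<omega>. \<lambda>n\<in>UNIV. X n \<omega>) = PiM UNIV (\<lambda>n. distr M N3 (X n))"
    using indep_X by (subst (asm) indep_vars_iff_distr_eq_PiM') auto
  moreover have sets: "sets (PiM UNIV (\<lambda>_. \<mu>)) = sets (PiM UNIV (\<lambda>_. N3))"
    by (intro sets_PiM_cong) (auto simp: sets_\<mu>)
  then have "distr M (PiM UNIV (\<lambda>_. \<mu>)) (\<lambda>\<omega> n. X n \<omega>) = distr M (PiM UNIV (\<lambda>_. N3)) (\<lambda>\<omega> n. X n \<omega>)"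
    by (intro distr_cong) auto
  ultimately show ?thesis by (simp add: distr_X restrict_def)
qed

lemma measurable_sequence [measurable]: "(\<lambda>\<omega> n. X n \<omega>) \<in> measurable M (PiM UNIV (\<lambda>_. \<mu>))"
proof (rule measurable_PiM_single')
  show "X n \<in> measurable M \<mu>" for n by measurable
qed (auto simp: space_PiM \<mu>_def space_pair_measure)

lemma AE_nonneg:
  "AE \<omega> in M. \<forall>n. 0 \<le> \<sigma> 1 n \<omega> \<and> 0 \<le> \<sigma> 2 n \<omega> \<and> 0 \<le> \<tau> n \<omega>"
  using iid_nonneg_with_meanD(4)[OF iid_\<sigma>[of 1]] iid_nonneg_with_meanD(4)[OF iid_\<sigma>[of 2]] iid_nonneg_with_meanD(4)[OF iid_\<tau>]
  by (auto simp: AE_all_countable)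

lemma law_S:
  "integrable \<mu> S1" "integrable \<mu> S2" "integrable \<mu> T0"
  "(\<integral>p. S1 p \<partial>\<mu>) = b 1" "(\<integral>p. S2 p \<partial>\<mu>) = b 2" "(\<integral>p. T0 p \<partial>\<mu>) = a"
proof -
  have *: "integrable \<mu> f \<and> (\<integral>p. f p \<partial>\<mu>) = m"
    if f: "f \<in> borel_measurable N3" "AE \<omega> in M. f (X 0 \<omega>) = g \<omega>" "integrable M g" "expectation g = m" for f g and m :: real
  proof -
    have 1: "(\<lambda>\<omega>. f (X 0 \<omega>)) \<in> borel_measurable M" using f(1) by measurable
    have "integrable M (\<lambda>\<omega>. f (X 0 \<omega>))"
      using integrable_cong_AE[OF 1 borel_measurable_integrable[OF f(3)] f(2)] f(3) by simp
    moreover have "expectation (\<lambda>\<omega>. f (X 0 \<omega>)) = m"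
      using integral_cong_AE[OF 1 borel_measurable_integrable[OF f(3)] f(2)] f(4) by simp
    ultimately show ?thesis
      using integrable_distr_eq[OF rv_X f(1)] integral_distr[OF rv_X f(1)] by (simp add: \<mu>_def)
  qed
  have "AE \<omega> in M. S1 (X 0 \<omega>) = \<sigma> 1 0 \<omega>" "AE \<omega> in M. S2 (X 0 \<omega>) = \<sigma> 2 0 \<omega>" "AE \<omega> in M. T0 (X 0 \<omega>) = \<tau> 0 \<omega>"
    using AE_nonneg by (auto simp: S1_def S2_def T0_def X_def elim!: AE_mp)
  then show "integrable \<mu> S1" "integrable \<mu> S2" "integrable \<mu> T0"
    "(\<integral>p. S1 p \<partial>\<mu>) = b 1" "(\<integral>p. S2 p \<partial>\<mu>) = b 2" "(\<integral>p. T0 p \<partial>\<mu>) = a"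
    using *[of S1 "\<sigma> 1 0" "b 1"] *[of S2 "\<sigma> 2 0" "b 2"] *[of T0 "\<tau> 0" a]
      iid_nonneg_with_meanD(5,6)[OF iid_\<sigma>[of 1], of 0] iid_nonneg_with_meanD(5,6)[OF iid_\<sigma>[of 2], of 0]
      iid_nonneg_with_meanD(5,6)[OF iid_\<tau>, of 0]
    by auto
qed

lemma tail_S:
  "measure \<mu> {p \<in> space \<mu>. x < S1 p} = prob {\<omega> \<in> space M. \<sigma> 1 0 \<omega> > x}"
  "measure \<mu> {p \<in> space \<mu>. x < S2 p} = prob {\<omega> \<in> space M. \<sigma> 2 0 \<omega> > x}"
proof -
  have *: "measure \<mu> {p \<in> space \<mu>. x < f p} = prob {\<omega> \<in> space M. g \<omega> > x}"
    if f: "f \<in> borel_measurable N3" "AE \<omega> in M. f (X 0 \<omega>) = g \<omega>" "random_variable borel g" for f g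
  proof -
    note [measurable] = f(1,3)
    have "{p \<in> space N3. x < f p} \<in> sets N3" by measurable
    then have "measure \<mu> {p \<in> space \<mu>. x < f p} = prob (X 0 -` {p \<in> space N3. x < f p} \<inter> space M)"
      unfolding \<mu>_def by (subst measure_distr) auto
    also have "\<dots> = prob {\<omega> \<in> space M. g \<omega> > x}"
    proof (rule finite_measure_eq_AE)
      show "AE \<omega> in M. (\<omega> \<in> X 0 -` {p \<in> space N3. x < f p} \<inter> space M) = (\<omega> \<in> {\<omega> \<in> space M. g \<omega> > x})"
        using f(2) by eventually_elim (auto simp: space_pair_measure)
    qed measurable
    finally show ?thesis .
  qed
  have "AE \<omega> in M. S1 (X 0 \<omega>) = \<sigma> 1 0 \<omega>" "AE \<omega> in M. S2 (X 0 \<omega>) = \<sigma> 2 0 \<omega>"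
    using AE_nonneg by (auto simp: S1_def S2_def X_def elim!: AE_mp)
  then show "measure \<mu> {p \<in> space \<mu>. x < S1 p} = prob {\<omega> \<in> space M. \<sigma> 1 0 \<omega> > x}"
    "measure \<mu> {p \<in> space \<mu>. x < S2 p} = prob {\<omega> \<in> space M. \<sigma> 2 0 \<omega> > x}"
    by (auto intro!: *)
qed

lemma indep_S:
  "distr \<mu> (borel \<Otimes>\<^sub>M borel) (\<lambda>p. (S1 p, S2 p)) = distr \<mu> borel S1 \<Otimes>\<^sub>M distr \<mu> borel S2"
  "distr \<mu> ((borel \<Otimes>\<^sub>M borel) \<Otimes>\<^sub>M borel) (\<lambda>p. ((S1 p, S2 p), T0 p)) =
     distr \<mu> (borel \<Otimes>\<^sub>M borel) (\<lambda>p. (S1 p, S2 p)) \<Otimes>\<^sub>M distr \<mu> borel T0"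
proof -
  show "distr \<mu> (borel \<Otimes>\<^sub>M borel) (\<lambda>p. (S1 p, S2 p)) = distr \<mu> borel S1 \<Otimes>\<^sub>M distr \<mu> borel S2"
    using distr_services[of "max 0" borel "max 0" borel 0] unfolding \<mu>_def
    by (simp add: distr_distr comp_def X_def S1_def S2_def)
  show "distr \<mu> ((borel \<Otimes>\<^sub>M borel) \<Otimes>\<^sub>M borel) (\<lambda>p. ((S1 p, S2 p), T0 p)) =
     distr \<mu> (borel \<Otimes>\<^sub>M borel) (\<lambda>p. (S1 p, S2 p)) \<Otimes>\<^sub>M distr \<mu> borel T0"
    using distr_services_arrival[of "\<lambda>q. (max 0 (fst q), max 0 (snd q))" "borel \<Otimes>\<^sub>M borel" "max 0" borel 0]
    unfolding \<mu>_def by (simp add: distr_distr comp_def X_def S1_def S2_def T0_def)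
qed

lemma prob_space_\<mu>: "prob_space \<mu>"
  unfolding \<mu>_def by (rule prob_space_distr) measurable

sublocale canonical: tandem \<mu> S1 S2 T0 "b 1" "b 2" a
proof -
  interpret \<mu>: prob_space \<mu> by (rule prob_space_\<mu>)
  interpret product_prob_space "\<lambda>_. \<mu>" "UNIV :: nat set" by (rule product_prob_spaceI) (rule prob_space_\<mu>)
  have m: "S1 \<in> borel_measurable \<mu>" "S2 \<in> borel_measurable \<mu>" "T0 \<in> borel_measurable \<mu>" by measurable
  have nn: "0 \<le> S1 p" "0 \<le> S2 p" "0 \<le> T0 p" for p by (simp_all add: S1_def S2_def T0_def)
  have lt: "b 1 < a" "b 2 < a" using stable by auto
  show "tandem \<mu> S1 S2 T0 (b 1) (b 2) a"
    by unfold_locales (rule m nn law_S lt)+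
qed

lemma dater_canonical:
  assumes \<tau>: "\<And>n \<omega>. \<omega> \<in> space M \<Longrightarrow> \<tau> n \<omega> = T (n + 1) \<omega> - T n \<omega>"
  shows "prob {\<omega> \<in> space M. tandem_dater T \<sigma> \<omega> > ereal x} =
    measure (PiM UNIV (\<lambda>_. \<mu>)) {\<omega> \<in> space (PiM UNIV (\<lambda>_. \<mu>)). \<exists>k. x < canonical.V (Suc k) \<omega> + T0 (\<omega> 0)}"
proof -
  let ?S = "PiM UNIV (\<lambda>_::nat. \<mu>)"
  let ?Z = "{\<omega> \<in> space M. \<exists>k. \<exists>j\<le>k. x < (\<Sum>i\<in>{j..k}. \<sigma> 1 (- int i) \<omega>) + (\<Sum>i\<le>j. \<sigma> 2 (- int i) \<omega>)
       - (\<Sum>i\<in>{1..k}. \<tau> (- int i) \<omega>)}"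
  let ?C = "{\<omega> \<in> space ?S. \<exists>k. x < canonical.V (Suc k) \<omega> + T0 (\<omega> 0)}"
  have C: "?C \<in> sets ?S" by measurable
  have Z: "?Z \<in> sets M" by measurable
  have "{\<omega> \<in> space M. tandem_dater T \<sigma> \<omega> > ereal x} = ?Z"
    by (intro Collect_cong conj_cong refl tandem_dater_gt) (simp add: \<tau>)
  also have "prob ?Z = prob ((\<lambda>\<omega> n. X n \<omega>) -` ?C \<inter> space M)"
  proof (rule finite_measure_eq_AE)
    show "AE \<omega> in M. \<omega> \<in> ?Z \<longleftrightarrow> \<omega> \<in> (\<lambda>\<omega> n. X n \<omega>) -` ?C \<inter> space M"
      using AE_nonneg AE_space
    proof eventually_elim
      case (elim \<omega>)
      have S: "S1 (X i \<omega>) = \<sigma> 1 (- int i) \<omega>" "S2 (X i \<omega>) = \<sigma> 2 (- int i) \<omega>" "T0 (X i \<omega>) = \<tau> (- int i) \<omega>" for i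
        using elim(1) by (auto simp: S1_def S2_def T0_def X_def)
      have sp: "(\<lambda>n. X n \<omega>) \<in> space ?S" using measurable_space[OF measurable_sequence elim(2)] .
      \<comment> \<open>The sum in \<open>V\<close> starts at customer 0 and that of the dater at
        customer -1; the difference is the term \<open>T0 (\<omega> 0)\<close>.\<close>
      have t: "(\<Sum>i\<le>k. \<tau> (- int i) \<omega>) = \<tau> 0 \<omega> + (\<Sum>i\<in>{1..k}. \<tau> (- int i) \<omega>)" for k
        by (simp add: atMost_atLeast0 sum.atLeast_Suc_atMost)
      have "x < canonical.V (Suc k) (\<lambda>n. X n \<omega>) + T0 (X 0 \<omega>) \<longleftrightarrow>
        (\<exists>j\<le>k. x < (\<Sum>i\<in>{j..k}. \<sigma> 1 (- int i) \<omega>) + (\<Sum>i\<le>j. \<sigma> 2 (- int i) \<omega>) - (\<Sum>i\<in>{1..k}. \<tau> (- int i) \<omega>))" for k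
      proof -
        have "x < canonical.V (Suc k) (\<lambda>n. X n \<omega>) + T0 (X 0 \<omega>) \<longleftrightarrow> x - \<tau> 0 \<omega> < canonical.V (Suc k) (\<lambda>n. X n \<omega>)"
          using S(3)[of 0] by (auto simp del: canonical.V.simps)
        also have "\<dots> \<longleftrightarrow> (\<exists>j\<le>k. x < (\<Sum>i\<in>{j..k}. \<sigma> 1 (- int i) \<omega>) + (\<Sum>i\<le>j. \<sigma> 2 (- int i) \<omega>) - (\<Sum>i\<in>{1..k}. \<tau> (- int i) \<omega>))"
          unfolding canonical.V_Suc_gt S t by (intro ex_cong1 conj_cong refl) auto
        finally show ?thesis .
      qed
      then show ?case using elim(2) sp by simp
    qed
  qed (use Z C in auto)
  also have "\<dots> = measure (distr M ?S (\<lambda>\<omega> n. X n \<omega>)) ?C"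
    using C by (intro measure_distr[symmetric]) auto
  also have "\<dots> = measure ?S ?C" by (simp only: distr_sequence)
  finally show ?thesis .
qed

end

theorem theorem9:
  fixes M :: "'w measure"
    and T \<tau> :: "int \<Rightarrow> 'w \<Rightarrow> real"
    and \<sigma> :: "nat \<Rightarrow> int \<Rightarrow> 'w \<Rightarrow> real"
    and a :: real and b d :: "nat \<Rightarrow> real"
    and F :: "real \<Rightarrow> real"
  assumes "prob_space M"
    and "\<And>n \<omega>. \<omega> \<in> space M \<Longrightarrow> \<tau> n \<omega> = T (n + 1) \<omega> - T n \<omega>"
    and "prob_space.iid_nonneg_with_mean M \<tau> a"
    and "\<And>i. i \<in> {1, 2} \<Longrightarrow> prob_space.iid_nonneg_with_mean M (\<sigma> i) (b i)"
    and "prob_space.indep_sequences M {0, 1, 2} (\<lambda>i. if i = 0 then \<tau> else \<sigma> i)"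
    and "max (b 1) (b 2) < a"
    and "df_on_Rplus F" and "has_finite_mean F"
    and "subexponential F" and "subexponential (integrated_tail F)"
    and "\<And>i. i \<in> {1, 2} \<Longrightarrow> d i \<ge> 0" and "d 1 + d 2 > 0"
    and "\<And>i. i \<in> {1, 2} \<Longrightarrow>
           tail_sim (\<lambda>x. measure M {\<omega> \<in> space M. \<sigma> i 0 \<omega> > x}) (d i) (\<lambda>x. 1 - F x)"
  shows "tail_sim (\<lambda>x. measure M {\<omega> \<in> space M. tandem_dater T \<sigma> \<omega> > ereal x})
           (d 1 / (a - max (b 1) (b 2)) + d 2 / (a - b 2))
           (\<lambda>x. 1 - integrated_tail F x)"
proof -
  interpret prob_space M by fact
  interpret Q: tandem_queue M \<tau> \<sigma> a b by unfold_locales (use assms(3-6) in auto)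
  interpret heavy_tandem Q.\<mu> Q.S1 Q.S2 Q.T0 "b 1" "b 2" a F "d 1" "d 2"
    by unfold_locales (use assms(7,9,10,11) assms(13)[of 1] assms(13)[of 2] Q.indep_S in \<open>auto simp: Q.tail_S\<close>)
  \<comment> \<open>A positive constant selects the quotient form of
    \<open>tail_sim\<close>.\<close>
  have pos: "0 < d 1 / (a - max (b 1) (b 2)) + d 2 / (a - b 2)"
  proof -
    have "0 < d 1 \<and> 0 \<le> d 2 \<or> 0 \<le> d 1 \<and> 0 < d 2" using assms(11)[of 1] assms(11)[of 2] assms(12) by auto
    then show ?thesis using assms(6) by (auto intro: add_pos_nonneg add_nonneg_pos)
  qed
  have "measure M {\<omega> \<in> space M. tandem_dater T \<sigma> \<omega> > ereal x} = h x" for x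
    unfolding h_def by (rule Q.dater_canonical[OF assms(2)])
  with h_asymp pos show ?thesis by (simp add: tail_sim_def)
qed

end
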